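(* Let $G$ be a graph with maximal local edge-connectivity $3$. Then $G$ is $3$-colourable if and only if each block of $G$ cannot be obtained from an odd wheel by performing a (possibly empty) sequence of Haj\'os joins with an odd wheel (that is, if and only if no block of $G$ can be obtained in this way).
   Context: All graphs are finite and simple. For distinct vertices $x,y$, the local edge-connectivity $\lambda(x,y)$ is the maximum number of edge-disjoint paths between $x$ and $y$. A graph has maximal local edge-connectivity $3$ if $\lambda(x,y)\leq 3$ for all pairs of distinct vertices $x,y$. An odd wheel is a graph obtained from a cycle of odd length by adding a vertex adjacent to every vertex of the cycle (in particular $K_4$ is an odd wheel). A block of $G$ is a maximal connected subgraph $B$ of $G$ such that $B$ does not have a cut-vertex. Let $G_1$ and $G_2$ be (vertex-disjoint) graphs and, for $i\in\{1,2\}$, let $(u_i,v_i)$ be an ordered pair of adjacent vertices of $G_i$. The Haj\'os join of $G_1$ and $G_2$ with respect to $(u_1,v_1)$ and $(u_2,v_2)$ is the graph obtained by deleting the edges $u_1v_1$ and $u_2v_2$ from $G_1$ and $G_2$, respectively, identifying the vertices $u_1$ and $u_2$, and adding a new edge joining $v_1$ and $v_2$. In the sequence of Haj\'os joins, each step joins the current graph with some odd wheel (possibly a different one at each step), with respect to arbitrary ordered pairs of adjacent vertices; graphs are considered up to isomorphism. *)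

theory Defs
  imports Main
begin

section \<open>Finite simple graphs\<close>

datatype 'a sgraph = SGraph (verts: "'a set") (edges: "'a set set")

definition simple_graph :: "'a sgraph \<Rightarrow> bool" where
  "simple_graph G \<longleftrightarrow>
     finite (verts G) \<and> (\<forall>e\<in>edges G. e \<subseteq> verts G \<and> card e = 2)"

definition subgraph :: "'a sgraph \<Rightarrow> 'a sgraph \<Rightarrow> bool" where
  "subgraph H G \<longleftrightarrow>
     simple_graph H \<and> verts H \<subseteq> verts G \<and> edges H \<subseteq> edges G"

definition graph_iso :: "'a sgraph \<Rightarrow> 'b sgraph \<Rightarrow> bool" where
  "graph_iso G H \<longleftrightarrow>
     (\<exists>f. bij_betw f (verts G) (verts H) \<and> edges H = (\<lambda>e. f ` e) ` edges G)"

definition colourable :: "nat \<Rightarrow> 'a sgraph \<Rightarrow> bool" where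
  "colourable k G \<longleftrightarrow>
     (\<exists>c :: 'a \<Rightarrow> nat. (\<forall>v\<in>verts G. c v < k) \<and>
        (\<forall>u v. {u, v} \<in> edges G \<longrightarrow> c u \<noteq> c v))"

section \<open>Paths and local edge-connectivity\<close>

text \<open>A path is represented by the list of its vertices, without repetition.\<close>

fun path_edges :: "'a list \<Rightarrow> 'a set set" where
  "path_edges (x # y # xs) = insert {x, y} (path_edges (y # xs))"
| "path_edges _ = {}"

definition is_path :: "'a sgraph \<Rightarrow> 'a \<Rightarrow> 'a list \<Rightarrow> 'a \<Rightarrow> bool" where
  "is_path G x p y \<longleftrightarrow>
     p \<noteq> [] \<and> hd p = x \<and> last p = y \<and> distinct p \<and>
     set p \<subseteq> verts G \<and> path_edges p \<subseteq> edges G"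

text \<open>Only meaningful for distinct vertices of a finite graph, where the set below
  is finite and contains 0.\<close>

definition local_edge_connectivity :: "'a sgraph \<Rightarrow> 'a \<Rightarrow> 'a \<Rightarrow> nat" where
  "local_edge_connectivity G x y =
     Max {card P | P. (\<forall>p\<in>P. is_path G x p y) \<and>
        pairwise (\<lambda>p q. path_edges p \<inter> path_edges q = {}) P}"

text \<open>As in the source, this is an upper bound: the value \<open>k\<close> need not be attained.\<close>

definition maximal_local_edge_connectivity :: "nat \<Rightarrow> 'a sgraph \<Rightarrow> bool" where
  "maximal_local_edge_connectivity k G \<longleftrightarrow>
     (\<forall>x\<in>verts G. \<forall>y\<in>verts G. x \<noteq> y \<longrightarrow> local_edge_connectivity G x y \<le> k)"

section \<open>Blocks\<close>

definition connected_graph :: "'a sgraph \<Rightarrow> bool" where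
  "connected_graph G \<longleftrightarrow>
     verts G \<noteq> {} \<and> (\<forall>x\<in>verts G. \<forall>y\<in>verts G. \<exists>p. is_path G x p y)"

text \<open>A cut-vertex separates two other vertices of the same component. Hence the
  graphs with one vertex and the connected graphs with two vertices have none, so
  isolated vertices and bridges form blocks.\<close>

definition cut_vertex :: "'a sgraph \<Rightarrow> 'a \<Rightarrow> bool" where
  "cut_vertex G v \<longleftrightarrow> v \<in> verts G \<and>
     (\<exists>x\<in>verts G - {v}. \<exists>y\<in>verts G - {v}.
        (\<exists>p. is_path G x p y) \<and> (\<forall>p. is_path G x p y \<longrightarrow> v \<in> set p))"

definition nonseparable :: "'a sgraph \<Rightarrow> bool" where
  "nonseparable G \<longleftrightarrow> connected_graph G \<and> (\<nexists>v. cut_vertex G v)"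

definition block :: "'a sgraph \<Rightarrow> 'a sgraph \<Rightarrow> bool" where
  "block B G \<longleftrightarrow> subgraph B G \<and> nonseparable B \<and>
     (\<forall>B'. subgraph B' G \<and> nonseparable B' \<and> subgraph B B' \<longrightarrow> B' = B)"

section \<open>Odd wheels and Haj\'os joins\<close>

definition cycle_graph :: "nat \<Rightarrow> 'a sgraph \<Rightarrow> bool" where
  "cycle_graph n C \<longleftrightarrow>
     (\<exists>xs. n \<ge> 3 \<and> length xs = n \<and> distinct xs \<and> verts C = set xs \<and>
        edges C = insert {last xs, hd xs} (path_edges xs))"

definition odd_wheel :: "'a sgraph \<Rightarrow> bool" where
  "odd_wheel W \<longleftrightarrow>
     (\<exists>C n h. cycle_graph n C \<and> odd n \<and> h \<notin> verts C \<and>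
        W = SGraph (insert h (verts C)) (edges C \<union> {{h, x} | x. x \<in> verts C}))"

text \<open>The identified vertex keeps the name \<open>u1\<close>. The definition is intended for
  vertex-disjoint \<open>G1\<close>, \<open>G2\<close> with \<open>u1\<close>, \<open>v1\<close> adjacent in \<open>G1\<close> and
  \<open>u2\<close>, \<open>v2\<close> adjacent in \<open>G2\<close>.\<close>

definition hajos_join ::
  "'a sgraph \<Rightarrow> 'a \<times> 'a \<Rightarrow> 'a sgraph \<Rightarrow> 'a \<times> 'a \<Rightarrow> 'a sgraph" where
  "hajos_join G1 p1 G2 p2 =
     (case (p1, p2) of ((u1, v1), (u2, v2)) \<Rightarrow>
        let r = (\<lambda>x. if x = u2 then u1 else x) in
        SGraph (verts G1 \<union> r ` verts G2)
          ((edges G1 - {{u1, v1}}) \<union> (\<lambda>e. r ` e) ` (edges G2 - {{u2, v2}}) \<union> {{v1, v2}}))"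

text \<open>The sequences are built from graphs on natural numbers, so that there are always
  enough unused vertices for a disjoint wheel, whatever the vertex type of \<open>G\<close>.
  As every wheel on natural numbers is available at each step, the
  isomorphism in the second definition gives the class up to isomorphism.\<close>

inductive hajos_wheel_sequence :: "nat sgraph \<Rightarrow> bool" where
  wheel: "odd_wheel W \<Longrightarrow> hajos_wheel_sequence W"
| join: "\<lbrakk>hajos_wheel_sequence H; odd_wheel W; verts H \<inter> verts W = {};
      {u1, v1} \<in> edges H; {u2, v2} \<in> edges W\<rbrakk>
    \<Longrightarrow> hajos_wheel_sequence (hajos_join H (u1, v1) W (u2, v2))"

definition obtainable_from_odd_wheels :: "'a sgraph \<Rightarrow> bool" where
  "obtainable_from_odd_wheels B \<longleftrightarrow>
     (\<exists>H. hajos_wheel_sequence H \<and> graph_iso H B)"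

end

theory Submission
  imports Defs
begin

text \<open>
  Obtainable graphs are not 3-colourable because in a Haj\'os join both halves would force their
  ends to have the colour of the identified vertex. Conversely, a graph that is not 3-colourable has a
  4-critical subgraph \<open>K\<close>. Permuting colours on one side of a cut shows that every edge cut of
  \<open>K\<close> has at least three edges, while by Menger's theorem any two vertices are separated by a cut
  of at most three edges. Such a cut uses up three edges of \<open>K\<close>, so \<open>K\<close> has no ear in
  the graph and is a block.

  If \<open>K\<close> becomes disconnected by removing a vertex and an edge, it is a Haj\'os join of two
  smaller critical graphs of the same kind, one of which is an odd wheel if its side was chosen
  minimal. Otherwise every three-edge cut isolates a single vertex (this uses that minimum cuts of odd
  size are laminar), so that at most one vertex has degree more than three, and a Brooks-type
  greedy colouring shows that \<open>K\<close> is an odd wheel.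
\<close>

section \<open>Edge cuts\<close>

text \<open>Three is the threshold because one cut edge excludes exactly two of the six permutations
  of the colours. In the extremal case of a three-edge cut, the ends on one side \<open>A\<close>
  get a common colour in every colouring of that side. The main obstacle is to turn such a side, if
  it is larger than a vertex, into a separation by a vertex and an edge. Two ends \<open>x'\<close>,
  \<open>x''\<close> of the cut in \<open>A\<close> are always coloured alike, so \<open>A\<close>
  with the extra edge \<open>{x', x''}\<close> contains a critical graph \<open>K\<close>. The
  maximal smaller three-edge cuts inside \<open>A\<close> bound disjoint pieces that cover all of
  \<open>A\<close> except at most one vertex \<open>v\<close>. Cuts of \<open>K\<close> need three
  edges as well, so a piece whose cut loses too many edges in \<open>K\<close> loses all of them.
  The pieces not crossed by \<open>K\<close>, among them the one around the third end, can be left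
  only through \<open>v\<close> and the third cut edge.

  The connectivity hypothesis enters through its dual, small separating cuts, because a bound on
  cuts is inherited by subgraphs and by both halves of a Hajos join.\<close>

definition between :: "'a set set \<Rightarrow> 'a set \<Rightarrow> 'a set \<Rightarrow> 'a set set" where
  "between E P Q = {e \<in> E. \<exists>a\<in>P. \<exists>b\<in>Q. e = {a, b}}"

abbreviation cut :: "'a set set \<Rightarrow> 'a set \<Rightarrow> 'a set set" where
  "cut E S \<equiv> between E S (- S)"

text \<open>A graph is handled as its bare set of edges, with vertex set \<open>\<Union>E\<close>.
  Isolated vertices vanish this way; they affect neither colourings nor edge cuts.\<close>

definition doubletons :: "'a set set \<Rightarrow> bool" where
  "doubletons E \<longleftrightarrow> finite E \<and> (\<forall>e\<in>E. card e = 2)"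

lemma simple_graph_doubletons: "simple_graph G \<Longrightarrow> doubletons (edges G)"
  unfolding simple_graph_def doubletons_def
  by (metis Pow_iff finite_Pow_iff finite_subset subsetI)

lemma doubletons_subset: "doubletons E \<Longrightarrow> F \<subseteq> E \<Longrightarrow> doubletons F"
  unfolding doubletons_def using finite_subset by blast

lemma doubletonsE:
  assumes "doubletons E" "e \<in> E"
  obtains a b where "e = {a, b}" "a \<noteq> b"
  using assms unfolding doubletons_def by (metis card_2_iff)

lemma doubletons_neq: "doubletons E \<Longrightarrow> {a, b} \<in> E \<Longrightarrow> a \<noteq> b"
  unfolding doubletons_def by (auto simp: card_2_iff doubleton_eq_iff)

lemma doubletons_finite_Union: "doubletons E \<Longrightarrow> finite (\<Union>E)"
  unfolding doubletons_def by (metis card.infinite finite_Union zero_neq_numeral)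

lemma finite_between: "doubletons E \<Longrightarrow> finite (between E P Q)"
  unfolding doubletons_def between_def by auto

lemma between_commute: "between E P Q = between E Q P"
  unfolding between_def by (metis insert_commute)

lemma cut_Compl: "cut E (- S) = cut E S"
  using between_commute[of E S] by simp

text \<open>The complement in \<open>cut\<close> is taken in the whole type, so a side may contain
  points that are not vertices. This lemma and the next trim sides to the vertex set.\<close>

lemma cut_Diff:
  assumes "\<Union>E \<subseteq> V"
  shows "cut E (V - S) = cut E S"
  using assms unfolding between_def by (auto simp: doubleton_eq_iff)

lemma cut_Int:
  assumes "\<Union>E \<subseteq> V"
  shows "cut E (V \<inter> S) = cut E S"
  using assms unfolding between_def by (auto simp: doubleton_eq_iff)

lemma in_cutI: "{a, b} \<in> E \<Longrightarrow> a \<in> S \<Longrightarrow> b \<notin> S \<Longrightarrow> {a, b} \<in> cut E S"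
  unfolding between_def by blast

lemma between_mono: "E \<subseteq> F \<Longrightarrow> between E P Q \<subseteq> between F P Q"
  unfolding between_def by blast

lemma cutE:
  assumes "e \<in> cut E S"
  obtains a b where "e = {a, b}" "a \<in> S" "b \<notin> S" "e \<in> E"
  using assms unfolding between_def by blast

section \<open>Colourings and critical edge sets\<close>

text \<open>The bound on the colours holds on the whole type, so colourings can be restricted,
  permuted and overwritten without mentioning a vertex set.\<close>

definition proper :: "'a set set \<Rightarrow> ('a \<Rightarrow> nat) \<Rightarrow> bool" where
  "proper E c \<longleftrightarrow> (\<forall>x. c x < 3) \<and> (\<forall>u v. {u, v} \<in> E \<longrightarrow> c u \<noteq> c v)"

definition colourable3 :: "'a set set \<Rightarrow> bool" where
  "colourable3 E \<longleftrightarrow> (\<exists>c. proper E c)"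

definition critical :: "'a set set \<Rightarrow> bool" where
  "critical E \<longleftrightarrow> doubletons E \<and> \<not> colourable3 E \<and> (\<forall>F. F \<subset> E \<longrightarrow> colourable3 F)"

definition induced :: "'a set set \<Rightarrow> 'a set \<Rightarrow> 'a set set" where
  "induced E S = {e \<in> E. e \<subseteq> S}"

lemma induced_subset: "induced E S \<subseteq> E"
  unfolding induced_def by blast

lemma proper_subset: "proper E c \<Longrightarrow> F \<subseteq> E \<Longrightarrow> proper F c"
  unfolding proper_def by blast

lemma colourable3_subset: "colourable3 E \<Longrightarrow> F \<subseteq> E \<Longrightarrow> colourable3 F"
  unfolding colourable3_def using proper_subset by blast

lemma colourable_iff:
  assumes "simple_graph G"
  shows "colourable 3 G \<longleftrightarrow> colourable3 (edges G)"
proof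
  assume "colourable 3 G"
  then obtain c :: "'a \<Rightarrow> nat" where c: "\<forall>v\<in>verts G. c v < 3" "\<forall>u v. {u, v} \<in> edges G \<longrightarrow> c u \<noteq> c v"
    unfolding colourable_def by blast
  define d where "d x = (if x \<in> verts G then c x else 0)" for x
  have "proper (edges G) d"
    using c assms unfolding proper_def d_def simple_graph_def by fastforce
  then show "colourable3 (edges G)" unfolding colourable3_def by blast
next
  assume "colourable3 (edges G)"
  then show "colourable 3 G" unfolding colourable3_def colourable_def proper_def by blast
qed

lemma critical_subset_exists:
  assumes "doubletons E" "\<not> colourable3 E"
  obtains K where "K \<subseteq> E" "critical K"
proof -
  have "finite E" using assms(1) unfolding doubletons_def by blast
  then have "\<not> colourable3 E \<Longrightarrow> \<exists>K. K \<subseteq> E \<and> \<not> colourable3 K \<and> (\<forall>F. F \<subset> K \<longrightarrow> colourable3 F)"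
  proof (induction rule: finite_psubset_induct)
    case (psubset A)
    then show ?case by (cases "\<forall>F. F \<subset> A \<longrightarrow> colourable3 F") (blast, metis order.trans psubset_imp_subset)
  qed
  then obtain K where "K \<subseteq> E" "\<not> colourable3 K" "\<forall>F. F \<subset> K \<longrightarrow> colourable3 F"
    using assms(2) by blast
  then show ?thesis using that assms(1) doubletons_subset unfolding critical_def by blast
qed

lemma critical_doubletons: "critical E \<Longrightarrow> doubletons E"
  unfolding critical_def by blast

text \<open>The edges at \<open>x\<close> are lost in the induced graph, so criticality colours it.
  This provides the colouring of each side of a cut.\<close>

lemma critical_induced_proper:
  assumes "critical E" "x \<in> \<Union>E" "x \<notin> S"
  obtains c where "proper (induced E S) c"
proof -
  have "induced E S \<subset> E" using assms(2,3) unfolding induced_def by blast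
  then show ?thesis using that assms(1) unfolding critical_def colourable3_def by blast
qed

section \<open>Fitting colourings of two sides together by permuting the three colours\<close>

definition colour_perm :: "(nat \<Rightarrow> nat) \<Rightarrow> bool" where
  "colour_perm p \<longleftrightarrow> inj_on p {..<3} \<and> (\<forall>i<3. p i < 3)"

text \<open>An injective renaming of the colours keeps \<open>c2\<close> proper on its own side, so
  only the edges across the cut can fail.\<close>

lemma proper_combine:
  assumes dE: "doubletons E" and c1: "proper (induced E S) c1" and c2: "proper (induced E (- S)) c2"
    and p: "colour_perm p" "\<And>a b. {a, b} \<in> E \<Longrightarrow> a \<in> S \<Longrightarrow> b \<notin> S \<Longrightarrow> c1 a \<noteq> p (c2 b)"
  shows "colourable3 E"
proof -
  define c where "c x = (if x \<in> S then c1 x else p (c2 x))" for x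
  have "proper E c"
    unfolding proper_def
  proof safe
    fix x show "c x < 3"
      using c1 c2 p(1) unfolding c_def proper_def colour_perm_def by auto
  next
    fix u v assume e: "{u, v} \<in> E" "c u = c v"
    show False
    proof (cases "u \<in> S"; cases "v \<in> S")
      assume "u \<in> S" "v \<in> S"
      then show False using e c1 unfolding c_def proper_def induced_def by auto
    next
      assume "u \<in> S" "v \<notin> S"
      then show False using e p(2)[of u v] unfolding c_def by auto
    next
      assume "u \<notin> S" "v \<in> S"
      then show False using e p(2)[of v u] unfolding c_def by (auto simp: insert_commute)
    next
      assume "u \<notin> S" "v \<notin> S"
      then have "c2 u \<noteq> c2 v" "p (c2 u) = p (c2 v)"
        using e c2 unfolding c_def proper_def induced_def by auto
      then show False using p(1) c2 unfolding colour_perm_def proper_def inj_on_def by auto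
    qed
  qed
  then show ?thesis unfolding colourable3_def by blast
qed

definition perm_of :: "nat \<Rightarrow> nat \<Rightarrow> nat \<Rightarrow> nat \<Rightarrow> nat" where
  "perm_of i j k n = (if n = 0 then i else if n = 1 then j else k)"

lemma less3_iff: "(n::nat) < 3 \<longleftrightarrow> n = 0 \<or> n = 1 \<or> n = 2"
  by auto

lemma colour_perm_perm_of: "i < 3 \<Longrightarrow> j < 3 \<Longrightarrow> k < 3 \<Longrightarrow> distinct [i, j, k] \<Longrightarrow> colour_perm (perm_of i j k)"
  unfolding colour_perm_def inj_on_def perm_of_def by (auto simp: less3_iff)

lemma colour_perm_perm_of3:
  "colour_perm (perm_of 0 1 2)" "colour_perm (perm_of 0 2 1)" "colour_perm (perm_of 1 0 2)"
  "colour_perm (perm_of 1 2 0)" "colour_perm (perm_of 2 0 1)" "colour_perm (perm_of 2 1 0)"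
  by (auto intro!: colour_perm_perm_of)

text \<open>View a permutation as three cells of a 3 by 3 grid. Each pair of \<open>b\<close> and
  \<open>a\<close> is a cell lying on two of the six permutations, and three cells meet all six only
  if they fill a row or a column. These are the two excluded patterns; the proof inspects all
  values.\<close>

lemma colour_perm_avoid3:
  fixes a1 a2 a3 b1 b2 b3 :: nat
  assumes less: "a1 < 3" "a2 < 3" "a3 < 3" "b1 < 3" "b2 < 3" "b3 < 3"
    and a: "\<not> (a1 = a2 \<and> a2 = a3 \<and> distinct [b1, b2, b3])"
    and b: "\<not> (b1 = b2 \<and> b2 = b3 \<and> distinct [a1, a2, a3])"
  shows "\<exists>p. colour_perm p \<and> a1 \<noteq> p b1 \<and> a2 \<noteq> p b2 \<and> a3 \<noteq> p b3"
proof -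
  let ?P = "\<lambda>p. a1 \<noteq> p b1 \<and> a2 \<noteq> p b2 \<and> a3 \<noteq> p b3"
  have "?P (perm_of 0 1 2) \<or> ?P (perm_of 0 2 1) \<or> ?P (perm_of 1 0 2) \<or>
      ?P (perm_of 1 2 0) \<or> ?P (perm_of 2 0 1) \<or> ?P (perm_of 2 1 0)"
    using less[unfolded less3_iff] a b
    by (elim disjE; hypsubst; simp add: perm_of_def)
  then show ?thesis
    by (elim disjE) (blast intro!: colour_perm_perm_of3)+
qed

text \<open>Two permutations send \<open>b\<close> to \<open>a\<close>. If \<open>b'\<close> is
  different from \<open>b\<close>, they disagree at \<open>b'\<close>, so one of them avoids
  \<open>a'\<close>; otherwise both do.\<close>

lemma colour_perm_fix_avoid:
  fixes a a' b b' :: nat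
  assumes less: "a < 3" "a' < 3" "b < 3" "b' < 3" and "a \<noteq> a'"
  shows "\<exists>p. colour_perm p \<and> p b = a \<and> p b' \<noteq> a'"
proof -
  let ?P = "\<lambda>p. p b = a \<and> p b' \<noteq> a'"
  have "?P (perm_of 0 1 2) \<or> ?P (perm_of 0 2 1) \<or> ?P (perm_of 1 0 2) \<or>
      ?P (perm_of 1 2 0) \<or> ?P (perm_of 2 0 1) \<or> ?P (perm_of 2 1 0)"
    using less[unfolded less3_iff] assms(5)
    by (elim disjE; hypsubst; simp add: perm_of_def)
  then show ?thesis
    by (elim disjE) (blast intro!: colour_perm_perm_of3)+
qed

section \<open>Menger's theorem\<close>

lemma rtrancl_distinct_walk:
  assumes "(x, y) \<in> R\<^sup>*"
  obtains p where "p \<noteq> []" "hd p = x" "last p = y" "distinct p" "successively (\<lambda>a b. (a, b) \<in> R) p"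
proof -
  from assms have "\<exists>p. p \<noteq> [] \<and> hd p = x \<and> last p = y \<and> distinct p \<and> successively (\<lambda>a b. (a, b) \<in> R) p"
  proof (induction rule: rtrancl_induct)
    case base
    show ?case by (rule exI[of _ "[x]"]) simp
  next
    case (step y z)
    then obtain p where p: "p \<noteq> []" "hd p = x" "last p = y" "distinct p"
      "successively (\<lambda>a b. (a, b) \<in> R) p" by blast
    show ?case
    proof (cases "z \<in> set p")
      case True
      \<comment> \<open>The walk returns to \<open>z\<close>, so it is cut off there, which keeps it
        free of repetitions.\<close>
      then obtain q r where "p = q @ z # r" by (meson split_list)
      then show ?thesis using p
        by (intro exI[of _ "q @ [z]"]) (auto simp: successively_append_iff hd_append split: if_splits)
    next
      case False
      then show ?thesis using p step.hyps
        by (intro exI[of _ "p @ [z]"]) (auto simp: successively_append_iff)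
    qed
  qed
  then show ?thesis using that by blast
qed

lemma successively_set_subset:
  assumes "successively (\<lambda>a b. (a, b) \<in> R) p" "p \<noteq> []" "hd p \<in> V" "R `` V \<subseteq> V"
  shows "set p \<subseteq> V"
  using assms by (induction p rule: induct_list012) auto

lemma path_edges_subset_iff: "path_edges p \<subseteq> E \<longleftrightarrow> successively (\<lambda>a b. {a, b} \<in> E) p"
  by (induction p rule: induct_list012) auto

lemma path_edges_crossing:
  assumes "p \<noteq> []" "hd p \<in> S" "last p \<notin> S"
  obtains a b where "{a, b} \<in> path_edges p" "a \<in> S" "b \<notin> S" "a \<in> set p" "b \<in> set p"
proof -
  from assms have "\<exists>a b. {a, b} \<in> path_edges p \<and> a \<in> S \<and> b \<notin> S \<and> a \<in> set p \<and> b \<in> set p"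
  proof (induction p rule: induct_list012)
    case (3 u v p)
    show ?case
    proof (cases "v \<in> S")
      case True
      then obtain a b where "{a, b} \<in> path_edges (v # p)" "a \<in> S" "b \<notin> S" "a \<in> set (v # p)" "b \<in> set (v # p)"
        using 3 by auto
      then show ?thesis by (intro exI[of _ a] exI[of _ b]) simp
    next
      case False
      then show ?thesis using 3(4) by (intro exI[of _ u] exI[of _ v]) simp
    qed
  qed auto
  then show ?thesis using that by blast
qed

text \<open>An undirected unit flow: \<open>g a b\<close> is the signed amount sent along the edge from
  \<open>a\<close> to \<open>b\<close>.\<close>

definition flow :: "'a set \<Rightarrow> 'a set set \<Rightarrow> 'a \<Rightarrow> 'a \<Rightarrow> int \<Rightarrow> ('a \<Rightarrow> 'a \<Rightarrow> int) \<Rightarrow> bool" where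
  "flow V E x y m g \<longleftrightarrow> (\<forall>a b. g a b = - g b a) \<and> (\<forall>a b. g a b \<le> 1) \<and>
     (\<forall>a b. {a, b} \<notin> E \<longrightarrow> g a b = 0) \<and>
     (\<forall>v\<in>V. (\<Sum>w\<in>V. g v w) = (if v = x then m else 0) - (if v = y then m else 0))"

lemma flowD:
  assumes "flow V E x y m g"
  shows "g a b = - g b a" "g a b \<le> 1" "{a, b} \<notin> E \<Longrightarrow> g a b = 0"
    "v \<in> V \<Longrightarrow> (\<Sum>w\<in>V. g v w) = (if v = x then m else 0) - (if v = y then m else 0)"
  using assms unfolding flow_def by blast+

text \<open>The unit flow along a path: each step contributes 1 forwards and -1 backwards, so the
  net outflow telescopes to the two ends.\<close>

fun path_flow :: "'a list \<Rightarrow> 'a \<Rightarrow> 'a \<Rightarrow> int" where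
  "path_flow (u # v # p) a b =
     (if a = u \<and> b = v then 1 else 0) - (if b = u \<and> a = v then 1 else 0) + path_flow (v # p) a b"
| "path_flow _ a b = 0"

lemma path_flow_antisym: "path_flow p a b = - path_flow p b a"
proof (induction p rule: induct_list012)
  case (3 u v p)
  have "x - y + f = - (y - x + g)" if "f = - g" for x y f g :: int
    using that by simp
  then show ?case
    unfolding path_flow.simps using 3(2) by blast
qed simp_all

lemma path_flow_outside:
  assumes "a \<notin> set p \<or> b \<notin> set p"
  shows "path_flow p a b = 0"
proof -
  have *: "a \<notin> set p \<Longrightarrow> path_flow p a b = 0" for a b
  proof (induction p rule: induct_list012)
    case (3 u v p)
    then have "path_flow (v # p) a b = 0" "a \<noteq> u" "a \<noteq> v" by simp_all
    then show ?case by simp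
  qed simp_all
  show ?thesis using assms *[of a b] *[of b a] path_flow_antisym[of p a b] by linarith
qed

text \<open>A path without repetitions never uses an edge twice, so contributions of different steps
  neither add up nor cancel.\<close>

lemma path_flow_pos:
  assumes "distinct p" "successively R p" "path_flow p a b > 0"
  shows "path_flow p a b = 1 \<and> R a b"
  using assms
proof (induction p rule: induct_list012)
  case (3 u v p)
  have *: "path_flow (v # p) a b = 0" if "a = u \<or> b = u"
    using that 3(3) by (intro path_flow_outside) auto
  show ?case
  proof (cases "a = u \<or> b = u")
    case True
    then show ?thesis using * 3 by (auto split: if_splits)
  next
    case False
    then show ?thesis using 3 by auto
  qed
qed auto

lemma path_flow_path_edges:
  assumes "distinct p"
  shows "path_flow p a b \<noteq> 0 \<longleftrightarrow> {a, b} \<in> path_edges p"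
  using assms
proof (induction p rule: induct_list012)
  case (3 u v p)
  have *: "path_flow (v # p) a b = 0" if "a = u \<or> b = u"
    using that 3(3) by (intro path_flow_outside) auto
  have **: "{a, b} \<notin> path_edges (v # p)" if "a = u \<or> b = u"
    using * that 3 by auto
  show ?case
    using * ** 3 by (cases "a = u \<or> b = u") (auto simp: doubleton_eq_iff)
qed auto

lemma sum_path_flow:
  assumes "finite V" "p \<noteq> []" "set p \<subseteq> V"
  shows "(\<Sum>w\<in>V. path_flow p v w) = (if v = hd p then 1 else 0) - (if v = last p then 1 else 0)"
  using assms(2,3)
proof (induction p rule: induct_list012)
  case (3 u z p)
  have "(\<Sum>w\<in>V. path_flow (u # z # p) v w) =
      (\<Sum>w\<in>V. if v = u \<and> w = z then 1 else 0) - (\<Sum>w\<in>V. if w = u \<and> v = z then 1 else 0)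
        + (\<Sum>w\<in>V. path_flow (z # p) v w)"
    by (simp only: path_flow.simps sum.distrib sum_subtractf)
  also have "(\<Sum>w\<in>V. if v = u \<and> w = z then 1 else 0 :: int) = (if v = u then 1 else 0)"
    using assms(1) 3 by (cases "v = u") auto
  also have "(\<Sum>w\<in>V. if w = u \<and> v = z then 1 else 0 :: int) = (if v = z then 1 else 0)"
    using assms(1) 3 by (cases "v = z") auto
  finally show ?case using 3 by simp
qed auto

text \<open>Sum the net outflow over \<open>S\<close>: antisymmetry cancels the terms inside
  \<open>S\<close>, and only the source contributes.\<close>

lemma flow_across_cut:
  assumes "finite V" "flow V E x y m g" "S \<subseteq> V" "x \<in> S" "y \<notin> S"
  shows "(\<Sum>v\<in>S. \<Sum>w\<in>V - S. g v w) = m"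
proof -
  have fS: "finite S" using assms finite_subset by blast
  have anti: "g a b = - g b a" for a b using assms(2) unfolding flow_def by blast
  have "(\<Sum>v\<in>S. \<Sum>w\<in>S. g v w) = (\<Sum>v\<in>S. \<Sum>w\<in>S. g w v)"
    by (rule sum.swap)
  also have "\<dots> = (\<Sum>v\<in>S. \<Sum>w\<in>S. - g v w)"
    by (intro sum.cong refl anti)
  finally have 0: "(\<Sum>v\<in>S. \<Sum>w\<in>S. g v w) = 0" by (simp add: sum_negf)
  have "(\<Sum>v\<in>S. \<Sum>w\<in>V. g v w) = (\<Sum>v\<in>S. (if v = x then m else 0))"
    using assms(3,5) flowD(4)[OF assms(2)] by (intro sum.cong) auto
  also have "\<dots> = m" using fS assms(4) by simp
  finally have "(\<Sum>v\<in>S. \<Sum>w\<in>V. g v w) = m" .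
  moreover have "(\<Sum>w\<in>V. g v w) = (\<Sum>w\<in>V - S. g v w) + (\<Sum>w\<in>S. g v w)" for v
    by (rule sum.subset_diff[OF assms(3,1)])
  ultimately show ?thesis using 0 by (simp add: sum.distrib)
qed

lemma flow_add_path:
  assumes "finite V" "flow V E x y m g" "p \<noteq> []" "hd p = x" "last p = y" "distinct p" "set p \<subseteq> V"
    and "successively (\<lambda>a b. {a, b} \<in> E \<and> g a b \<le> 0) p"
  shows "flow V E x y (m + 1) (\<lambda>a b. g a b + path_flow p a b)"
  unfolding flow_def
proof (intro conjI allI impI ballI)
  fix a b
  show "g a b + path_flow p a b = - (g b a + path_flow p b a)"
    using flowD(1)[OF assms(2), of a b] path_flow_antisym[of p a b] by simp
  show "g a b + path_flow p a b \<le> 1"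
    using path_flow_pos[OF assms(6,8), of a b] flowD(2)[OF assms(2), of a b]
    by (cases "path_flow p a b > 0") auto
  show "g a b + path_flow p a b = 0" if "{a, b} \<notin> E"
  proof -
    have "path_flow p a b = 0"
      using path_flow_path_edges[OF assms(6), of a b] that assms(8)
      by (metis (mono_tags, lifting) in_mono path_edges_subset_iff successively_mono)
    then show ?thesis using flowD(3)[OF assms(2) that] by simp
  qed
next
  fix v assume "v \<in> V"
  then show "(\<Sum>w\<in>V. g v w + path_flow p v w) = (if v = x then m + 1 else 0) - (if v = y then m + 1 else 0)"
    using sum_path_flow[OF assms(1,3,7), of v] flowD(4)[OF assms(2), of v] assms(4,5)
    by (simp add: sum.distrib)
qed

text \<open>The augmenting path argument: as long as the value is below the size of every separating
  cut, \<open>y\<close> is reachable from \<open>x\<close> in the residual graph and the flow grows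
  by one unit.\<close>

lemma flow_exists:
  assumes V: "finite V" "\<Union>E \<subseteq> V" "doubletons E" and xy: "x \<in> V" "y \<in> V"
    and cuts: "\<And>S. x \<in> S \<Longrightarrow> y \<notin> S \<Longrightarrow> S \<subseteq> V \<Longrightarrow> card (cut E S) \<ge> k" and "m \<le> k"
  shows "\<exists>g. flow V E x y (int m) g"
  using \<open>m \<le> k\<close>
proof (induction m)
  case 0
  show ?case by (rule exI[of _ "\<lambda>_ _. 0"]) (simp add: flow_def)
next
  case (Suc m)
  then obtain g where g: "flow V E x y (int m) g" by auto
  define R where "R = {(a, b). {a, b} \<in> E \<and> g a b \<le> 0}"
  have RV: "R `` V \<subseteq> V" using V(2) unfolding R_def by auto
  have "(x, y) \<in> R\<^sup>*"
  proof (rule ccontr)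
    assume n: "(x, y) \<notin> R\<^sup>*"
    define S where "S = R\<^sup>* `` {x}"
    have SV: "S \<subseteq> V"
    proof
      fix s assume "s \<in> S"
      then have "(x, s) \<in> R\<^sup>*" unfolding S_def by blast
      then show "s \<in> V" using xy(1) RV by (induction rule: rtrancl_induct) auto
    qed
    have S: "x \<in> S" "y \<notin> S" using n unfolding S_def by auto
    define C where "C = {(a, b) \<in> S \<times> (V - S). {a, b} \<in> E}"
    \<comment> \<open>No residual arc leaves the reachable set, so all edges of its cut are
      saturated and the flow value equals the size of the cut.\<close>
    have g1: "g a b = (if {a, b} \<in> E then 1 else 0)" if "a \<in> S" "b \<notin> S" for a b
    proof (cases "{a, b} \<in> E")
      case True
      have "(a, b) \<notin> R" using that unfolding S_def by (metis Image_singleton_iff rtrancl.rtrancl_into_rtrancl)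
      then have "g a b \<ge> 1" using True unfolding R_def by auto
      then show ?thesis using True flowD(2)[OF g, of a b] by simp
    next
      case False then show ?thesis using flowD(3)[OF g] by simp
    qed
    have "int m = (\<Sum>v\<in>S. \<Sum>w\<in>V - S. g v w)"
      using flow_across_cut[OF V(1) g SV S] by simp
    also have "\<dots> = (\<Sum>(v, w)\<in>S \<times> (V - S). g v w)" by (rule sum.cartesian_product)
    also have "\<dots> = (\<Sum>e\<in>S \<times> (V - S). if e \<in> C then 1 else 0)"
      by (intro sum.cong) (auto simp: g1 C_def split: if_splits)
    also have "\<dots> = int (card C)"
      using V(1) SV finite_subset unfolding C_def by (subst sum.If_cases) (auto simp: Int_def intro!: arg_cong[where f = card])
    also have "card C = card ((\<lambda>(a, b). {a, b}) ` C)"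
      by (intro card_image[symmetric]) (auto simp: inj_on_def C_def doubleton_eq_iff)
    also have "(\<lambda>(a, b). {a, b}) ` C = cut E S"
      using V(2) unfolding C_def between_def by (auto simp: image_iff)
    finally show False using cuts[OF S SV] Suc.prems by simp
  qed
  then obtain p where p: "p \<noteq> []" "hd p = x" "last p = y" "distinct p" "successively (\<lambda>a b. (a, b) \<in> R) p"
    by (rule rtrancl_distinct_walk)
  have "set p \<subseteq> V" using successively_set_subset[OF p(5,1) _ RV] p xy by simp
  from flow_add_path[OF V(1) g p(1-4) this] p(5) show ?case
    unfolding R_def by (auto simp: add.commute)
qed

text \<open>A path along positive arcs is peeled off and its unit subtracted. The clause that paths
  use only edges with nonzero flow carries the induction: the edges of the peeled path have no flow
  left, so the other paths avoid them.\<close>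

lemma flow_decomposition:
  assumes V: "finite V" "\<Union>E \<subseteq> V" and xy: "x \<in> V" "y \<in> V" "x \<noteq> y"
    and "flow V E x y (int m) g"
  shows "\<exists>P. finite P \<and> card P = m \<and> (\<forall>p\<in>P. is_path (SGraph V E) x p y) \<and>
    (\<forall>p\<in>P. \<forall>a b. {a, b} \<in> path_edges p \<longrightarrow> g a b \<noteq> 0) \<and>
    pairwise (\<lambda>p q. path_edges p \<inter> path_edges q = {}) P"
  using assms(6)
proof (induction m arbitrary: g)
  case 0
  show ?case by (rule exI[of _ "{}"]) simp
next
  case (Suc m)
  note g = Suc.prems
  have anti: "g a b = - g b a" and gE: "g a b \<noteq> 0 \<Longrightarrow> {a, b} \<in> E" for a b
    using flowD[OF g] by blast+
  define R where "R = {(a, b). g a b > 0}"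
  have RV: "R `` V \<subseteq> V" using V(2) gE unfolding R_def
  proof safe
    fix a b assume "0 < g a b"
    then have "{a, b} \<in> E" using gE[of a b] by simp
    then show "b \<in> V" using V(2) by auto
  qed
  have "(x, y) \<in> R\<^sup>*"
  proof (rule ccontr)
    assume n: "(x, y) \<notin> R\<^sup>*"
    define S where "S = R\<^sup>* `` {x}"
    have SV: "S \<subseteq> V"
    proof
      fix s assume "s \<in> S"
      then have "(x, s) \<in> R\<^sup>*" unfolding S_def by blast
      then show "s \<in> V" using xy(1) RV by (induction rule: rtrancl_induct) auto
    qed
    have S: "x \<in> S" "y \<notin> S" using n unfolding S_def by auto
    have "g a b \<le> 0" if "a \<in> S" "b \<notin> S" for a b
    proof -
      have "(a, b) \<notin> R" using that unfolding S_def by (metis Image_singleton_iff rtrancl.rtrancl_into_rtrancl)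
      then show ?thesis unfolding R_def by auto
    qed
    then have "(\<Sum>v\<in>S. \<Sum>w\<in>V - S. g v w) \<le> 0" by (intro sum_nonpos) auto
    then show False using flow_across_cut[OF V(1) g SV S] by simp
  qed
  then obtain p where p: "p \<noteq> []" "hd p = x" "last p = y" "distinct p" "successively (\<lambda>a b. (a, b) \<in> R) p"
    by (rule rtrancl_distinct_walk)
  have pV: "set p \<subseteq> V" using successively_set_subset[OF p(5,1) _ RV] p xy by simp
  have pE: "successively (\<lambda>a b. {a, b} \<in> E) p"
    using p(5) by (rule successively_mono) (auto simp: R_def intro: gE)
  have path: "is_path (SGraph V E) x p y"
    unfolding is_path_def using p pV pE by (simp add: path_edges_subset_iff)
  have pos: "path_flow p a b > 0 \<Longrightarrow> path_flow p a b = 1 \<and> g a b = 1" for a b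
    using path_flow_pos[OF p(4,5), of a b] flowD(2)[OF g, of a b] unfolding R_def by auto
  have "flow V E x y (int m) (\<lambda>a b. g a b - path_flow p a b)"
    unfolding flow_def
  proof (intro conjI allI impI ballI)
    fix a b
    show "g a b - path_flow p a b = - (g b a - path_flow p b a)"
      using anti[of a b] path_flow_antisym[of p a b] by simp
    have "g b a \<le> 1" "g a b \<le> 1" using flowD(2)[OF g] by blast+
    then show "g a b - path_flow p a b \<le> 1"
      using pos[of a b] pos[of b a] anti[of a b] path_flow_antisym[of p a b]
      by (cases "path_flow p a b > 0"; cases "path_flow p b a > 0") auto
    show "g a b - path_flow p a b = 0" if "{a, b} \<notin> E"
      using that pE gE path_flow_path_edges[OF p(4), of a b] path_edges_subset_iff[of p E] by auto
  next
    fix v assume "v \<in> V"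
    then show "(\<Sum>w\<in>V. g v w - path_flow p v w) = (if v = x then int m else 0) - (if v = y then int m else 0)"
      using flowD(4)[OF g, of v] p(2,3) xy sum_path_flow[OF V(1) p(1) pV, of v]
      by (simp add: sum_subtractf)
  qed
  from Suc.IH[OF this] obtain P where P: "finite P" "card P = m" "\<forall>p\<in>P. is_path (SGraph V E) x p y"
    "\<forall>q\<in>P. \<forall>a b. {a, b} \<in> path_edges q \<longrightarrow> g a b - path_flow p a b \<noteq> 0"
    "pairwise (\<lambda>p q. path_edges p \<inter> path_edges q = {}) P" by blast
  have zero: "g a b = path_flow p a b" if "{a, b} \<in> path_edges p" for a b
  proof -
    have "path_flow p a b \<noteq> 0" using path_flow_path_edges[OF p(4)] that by blast
    then show ?thesis
      using pos[of a b] pos[of b a] anti[of a b] path_flow_antisym[of p a b]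
      by (cases "path_flow p a b > 0") auto
  qed
  have pe: "\<exists>a b. e = {a, b}" if "e \<in> path_edges q" for e :: "'a set" and q
    using that by (induction q rule: induct_list012) auto
  have disj: "path_edges p \<inter> path_edges q = {}" if "q \<in> P" for q
  proof (rule ccontr)
    assume "path_edges p \<inter> path_edges q \<noteq> {}"
    then obtain a b where ab: "{a, b} \<in> path_edges p" "{a, b} \<in> path_edges q"
      using pe by blast
    then have "g a b - path_flow p a b \<noteq> 0" using P(4) that by blast
    then show False using zero[OF ab(1)] by simp
  qed
  \<comment> \<open>As \<open>x\<close> and \<open>y\<close> differ, \<open>p\<close> has an edge
    and is not disjoint from itself; so it is a new path and raises the cardinality.\<close>
  have "p \<notin> P"
  proof
    assume "p \<in> P"
    then have "path_edges p = {}" using disj by blast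
    moreover have "length p \<ge> 2" using p xy(3) by (cases p; cases "tl p") auto
    ultimately show False by (cases p; cases "tl p") auto
  qed
  show ?case
  proof (intro exI[of _ "insert p P"] conjI ballI allI impI)
    show "card (insert p P) = Suc m" using P \<open>p \<notin> P\<close> by simp
    fix q a b assume "q \<in> insert p P" "{a, b} \<in> path_edges q"
    then consider "q = p" | "q \<in> P" "{a, b} \<notin> path_edges p" using disj by blast
    then show "g a b \<noteq> 0"
    proof cases
      case 1
      then show ?thesis using zero path_flow_path_edges[OF p(4)] \<open>{a, b} \<in> path_edges q\<close> by metis
    next
      case 2
      then show ?thesis using P(4) path_flow_path_edges[OF p(4)] \<open>{a, b} \<in> path_edges q\<close>
        by (metis diff_zero)
    qed
  next
    show "pairwise (\<lambda>p q. path_edges p \<inter> path_edges q = {}) (insert p P)"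
      using P(5) disj by (auto simp: pairwise_insert Int_commute)
  qed (use P path in auto)
qed

theorem edge_menger:
  assumes G: "simple_graph G" and xy: "x \<in> verts G" "y \<in> verts G" "x \<noteq> y"
    and k: "local_edge_connectivity G x y \<le> k"
  obtains S where "x \<in> S" "y \<notin> S" "card (cut (edges G) S) \<le> k"
proof (rule ccontr)
  note result = that
  assume "\<not> thesis"
  then have *: "card (cut (edges G) S) \<ge> Suc k" if "x \<in> S" "y \<notin> S" for S
    using result[OF that] \<open>\<not> thesis\<close> by linarith
  have fin: "finite (verts G)" and sub: "\<Union>(edges G) \<subseteq> verts G" using G unfolding simple_graph_def by auto
  obtain g where "flow (verts G) (edges G) x y (int (Suc k)) g"
    using flow_exists[OF fin sub simple_graph_doubletons[OF G] xy(1,2), of "Suc k" "Suc k"] * by blast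
  from flow_decomposition[OF fin sub xy this] obtain P where P: "finite P" "card P = Suc k"
    "\<forall>p\<in>P. is_path G x p y" "pairwise (\<lambda>p q. path_edges p \<inter> path_edges q = {}) P" by auto
  let ?D = "{card P | P. (\<forall>p\<in>P. is_path G x p y) \<and> pairwise (\<lambda>p q. path_edges p \<inter> path_edges q = {}) P}"
  \<comment> \<open>Paths are repetition-free lists of bounded length. Hence there are finitely many
    path systems, and \<open>Max\<close> in the definition of connectivity is a genuine
    maximum.\<close>
  let ?L = "{p. set p \<subseteq> verts G \<and> length p \<le> card (verts G)}"
  have "finite ?L" using fin by (rule finite_lists_length_le)
  moreover have "P \<subseteq> ?L" if "\<forall>p\<in>P. is_path G x p y" for P
    using that fin unfolding is_path_def by (auto, metis card_mono distinct_card)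
  ultimately have "?D \<subseteq> card ` Pow ?L" "finite (card ` Pow ?L)" by auto
  then have "finite ?D" using finite_subset by blast
  moreover have "Suc k \<in> ?D" using P by (intro CollectI exI[of _ P]) auto
  ultimately have "Suc k \<le> local_edge_connectivity G x y"
    unfolding local_edge_connectivity_def by (rule Max_ge)
  then show False using k by simp
qed

section \<open>Edge cuts in critical graphs\<close>

lemma card_le_2E:
  assumes "finite C" "card C \<le> 2" "C \<noteq> {}"
  obtains e f where "C = {e, f}"
proof -
  have "card C = 1 \<or> card C = 2" using assms card_gt_0_iff[of C] by linarith
  then show ?thesis using that by (metis card_1_singletonE card_2_iff insert_absorb2)
qed

text \<open>The three edges may coincide, so cuts with one or two edges are covered as well; a
  repetition rules out both forbidden patterns.\<close>

lemma colourable3_cut3: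
  assumes "doubletons E" "proper (induced E S) c1" "proper (induced E (- S)) c2"
    and cut: "cut E S \<subseteq> {{a1, b1}, {a2, b2}, {a3, b3}}"
    and ab: "a1 \<in> S" "a2 \<in> S" "a3 \<in> S" "b1 \<notin> S" "b2 \<notin> S" "b3 \<notin> S"
    and "\<not> (c1 a1 = c1 a2 \<and> c1 a2 = c1 a3 \<and> distinct [c2 b1, c2 b2, c2 b3])"
    and "\<not> (c2 b1 = c2 b2 \<and> c2 b2 = c2 b3 \<and> distinct [c1 a1, c1 a2, c1 a3])"
  shows "colourable3 E"
proof -
  have "c1 x < 3" "c2 x < 3" for x using assms(2,3) unfolding proper_def by blast+
  from colour_perm_avoid3[OF this(1) this(1) this(1) this(2) this(2) this(2) assms(11,12)]
  obtain p where p: "colour_perm p" "c1 a1 \<noteq> p (c2 b1)" "c1 a2 \<noteq> p (c2 b2)" "c1 a3 \<noteq> p (c2 b3)"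
    by blast
  show ?thesis
  proof (rule proper_combine[OF assms(1-3) p(1)])
    fix a b assume "{a, b} \<in> E" "a \<in> S" "b \<notin> S"
    then have "{a, b} \<in> {{a1, b1}, {a2, b2}, {a3, b3}}"
      using subsetD[OF cut in_cutI] by blast
    then have "a = a1 \<and> b = b1 \<or> a = a2 \<and> b = b2 \<or> a = a3 \<and> b = b3"
      using ab \<open>a \<in> S\<close> \<open>b \<notin> S\<close> by (auto simp: doubleton_eq_iff)
    then show "c1 a \<noteq> p (c2 b)" using p by blast
  qed
qed

text \<open>Both sides miss a vertex and are colourable separately. With at most two edges across,
  some permutation of the colours makes the two colourings fit.\<close>

lemma critical_cut_ge_3:
  assumes "critical E" "x \<in> \<Union>E" "x \<in> S" "y \<in> \<Union>E" "y \<notin> S"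
  shows "card (cut E S) \<ge> 3"
proof (rule ccontr)
  assume "\<not> ?thesis"
  then have le: "card (cut E S) \<le> 2" by simp
  have dE: "doubletons E" and ncol: "\<not> colourable3 E" using assms(1) unfolding critical_def by blast+
  obtain c1 where c1: "proper (induced E S) c1" using critical_induced_proper assms by metis
  obtain c2 where c2: "proper (induced E (- S)) c2" using critical_induced_proper assms(1-3) by (metis ComplD)
  show False
  proof (cases "cut E S = {}")
    case True
    then have "\<And>a b. {a, b} \<in> E \<Longrightarrow> a \<in> S \<Longrightarrow> b \<notin> S \<Longrightarrow> False" using in_cutI by fastforce
    then show False using proper_combine[OF dE c1 c2 colour_perm_perm_of3(1)] ncol by blast
  next
    case False
    then obtain e f where ef: "cut E S = {e, f}" using card_le_2E[OF finite_between[OF dE] le] by metis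
    then have "e \<in> cut E S" "f \<in> cut E S" by auto
    then obtain a1 b1 a2 b2 where "e = {a1, b1}" "a1 \<in> S" "b1 \<notin> S" "f = {a2, b2}" "a2 \<in> S" "b2 \<notin> S"
      by (metis cutE)
    then show False
      using colourable3_cut3[OF dE c1 c2, of a1 b1 a2 b2 a2 b2] ef ncol by auto
  qed
qed

lemma critical_cut_empty:
  assumes "critical E" "card (cut E S) < 3"
  shows "S \<inter> \<Union>E = {} \<or> \<Union>E \<subseteq> S"
  using critical_cut_ge_3[OF assms(1), of _ S] assms(2) by fastforce

lemma critical_cut_less_3:
  assumes "critical E" "card (cut E S) < 3"
  shows "cut E S = {}"
proof (rule ccontr)
  assume "cut E S \<noteq> {}"
  then obtain e where "e \<in> cut E S" by blast
  then obtain a b where "e = {a, b}" "a \<in> S" "b \<notin> S" "e \<in> E" by (rule cutE)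
  then show False using critical_cut_empty[OF assms] by auto
qed

text \<open>Each of the three edges of a cut rules out two of the six ways to match the colours of the two
  sides, so that all six are ruled out only if the three ends have one colour on one side and three
  colours on the other.\<close>

lemma critical_cut_monochromatic:
  assumes crit: "critical E" and card: "card (cut E S) = 3"
  obtains T a1 b1 a2 b2 a3 b3 where "T = S \<or> T = - S"
    "cut E T = {{a1, b1}, {a2, b2}, {a3, b3}}" "distinct [{a1, b1}, {a2, b2}, {a3, b3}]"
    "a1 \<in> T" "a2 \<in> T" "a3 \<in> T" "b1 \<notin> T" "b2 \<notin> T" "b3 \<notin> T"
    "\<forall>c. proper (induced E T) c \<longrightarrow> c a1 = c a2 \<and> c a2 = c a3"
proof -
  have dE: "doubletons E" and ncol: "\<not> colourable3 E" using assms(1) unfolding critical_def by blast+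
  obtain e f g where efg: "cut E S = {e, f, g}" "distinct [e, f, g]"
    using card by (auto simp: card_3_iff)
  then have "e \<in> cut E S" "f \<in> cut E S" "g \<in> cut E S" by auto
  then obtain a1 b1 a2 b2 a3 b3 where e: "e = {a1, b1}" "a1 \<in> S" "b1 \<notin> S" "e \<in> E"
    and f: "f = {a2, b2}" "a2 \<in> S" "b2 \<notin> S" and g: "g = {a3, b3}" "a3 \<in> S" "b3 \<notin> S"
    by (metis cutE)
  have "a1 \<in> \<Union>E" "b1 \<in> \<Union>E" using e by auto
  then obtain d1 d2 where d: "proper (induced E S) d1" "proper (induced E (- S)) d2"
    using critical_induced_proper[OF crit] e(2,3) by (metis ComplD)
  have *: "c1 a1 = c1 a2 \<and> c1 a2 = c1 a3 \<and> distinct [c2 b1, c2 b2, c2 b3] \<or>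
      c2 b1 = c2 b2 \<and> c2 b2 = c2 b3 \<and> distinct [c1 a1, c1 a2, c1 a3]"
    if "proper (induced E S) c1" "proper (induced E (- S)) c2" for c1 c2
    using colourable3_cut3[OF dE that, of a1 b1 a2 b2 a3 b3] ncol e f g efg by blast
  \<comment> \<open>One fixed pair of colourings decides which side is the constant one. Every other
    colouring of that side, paired with the fixed one of the opposite side, must follow the same
    pattern.\<close>
  show ?thesis
  proof (cases "d1 a1 = d1 a2")
    case True
    then have "\<not> (d2 b1 = d2 b2 \<and> d2 b2 = d2 b3)" using *[OF d] by auto
    then have "c a1 = c a2 \<and> c a2 = c a3" if "proper (induced E S) c" for c
      using *[OF that d(2)] by blast
    then show ?thesis using that[of S a1 b1 a2 b2 a3 b3] e f g efg by auto
  next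
    case False
    then have "c b1 = c b2 \<and> c b2 = c b3" if "proper (induced E (- S)) c" for c
      using *[OF d(1) that] by blast
    then show ?thesis using that[of "- S" b1 a1 b2 a2 b3 a3] e f g efg
      by (auto simp: insert_commute between_commute[of E "- S"])
  qed
qed

lemma card_between_Un:
  assumes "doubletons E" "P \<inter> Q = {}" "P \<inter> R = {}" "Q \<inter> R = {}"
  shows "card (between E P (Q \<union> R)) = card (between E P Q) + card (between E P R)"
proof -
  have "between E P (Q \<union> R) = between E P Q \<union> between E P R"
    unfolding between_def by blast
  moreover have "between E P Q \<inter> between E P R = {}"
    using assms(2-4) unfolding between_def by (auto simp: doubleton_eq_iff)
  ultimately show ?thesis using finite_between[OF assms(1)] by (simp add: card_Un_disjoint)
qed

text \<open>Since three is odd, minimum cuts do not cross.\<close>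

lemma critical_cuts_laminar:
  assumes crit: "critical E" and A: "card (cut E A) = 3" and B: "card (cut E B) = 3"
  shows "A \<inter> B \<inter> \<Union>E = {} \<or> (A - B) \<inter> \<Union>E = {} \<or> (B - A) \<inter> \<Union>E = {} \<or> \<Union>E \<subseteq> A \<union> B"
proof (rule ccontr)
  assume "\<not> ?thesis"
  then obtain x1 x2 x3 x4 where x: "x1 \<in> \<Union>E" "x1 \<in> A \<inter> B" "x2 \<in> \<Union>E" "x2 \<in> A - B"
    "x3 \<in> \<Union>E" "x3 \<in> B - A" "x4 \<in> \<Union>E" "x4 \<in> - A - B" by blast
  have dE: "doubletons E" using crit by (rule critical_doubletons)
  define P1 P2 P3 P4 where P: "P1 = A \<inter> B" "P2 = A - B" "P3 = B - A" "P4 = - A - B"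
  define n where "n X Y = card (between E X Y)" for X Y
  have n_Un: "n X (Y \<union> Z) = n X Y + n X Z" if "X \<inter> Y = {}" "X \<inter> Z = {}" "Y \<inter> Z = {}" for X Y Z
    unfolding n_def using card_between_Un[OF dE that] .
  have n_comm: "n X Y = n Y X" for X Y unfolding n_def by (simp add: between_commute)
  have n_Un_Un: "n (X \<union> Y) (Z \<union> W) = (n Z X + n Z Y) + (n W X + n W Y)"
    if "X \<inter> Y = {}" "X \<inter> Z = {}" "X \<inter> W = {}" "Y \<inter> Z = {}" "Y \<inter> W = {}" "Z \<inter> W = {}" for X Y Z W
  proof -
    have "n (X \<union> Y) (Z \<union> W) = n (X \<union> Y) Z + n (X \<union> Y) W"
      by (rule n_Un) (use that in auto)
    also have "\<dots> = n Z (X \<union> Y) + n W (X \<union> Y)" by (simp only: n_comm)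
    also have "n Z (X \<union> Y) = n Z X + n Z Y" by (rule n_Un) (use that in auto)
    also have "n W (X \<union> Y) = n W X + n W Y" by (rule n_Un) (use that in auto)
    finally show ?thesis .
  qed
  have disj: "P1 \<inter> P2 = {}" "P1 \<inter> P3 = {}" "P1 \<inter> P4 = {}" "P2 \<inter> P3 = {}" "P2 \<inter> P4 = {}" "P3 \<inter> P4 = {}"
    "P2 \<inter> P1 = {}" "P3 \<inter> P1 = {}" "P4 \<inter> P1 = {}" "P3 \<inter> P2 = {}" "P4 \<inter> P2 = {}" "P4 \<inter> P3 = {}"
    unfolding P by auto
  have "- P1 = P2 \<union> (P3 \<union> P4)" "- P2 = P1 \<union> (P3 \<union> P4)" "- P3 = P1 \<union> (P2 \<union> P4)" "- P4 = P1 \<union> (P2 \<union> P3)"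
    unfolding P by auto
  then have cuts: "n P1 (- P1) = n P1 P2 + (n P1 P3 + n P1 P4)" "n P2 (- P2) = n P2 P1 + (n P2 P3 + n P2 P4)"
    "n P3 (- P3) = n P3 P1 + (n P3 P2 + n P3 P4)" "n P4 (- P4) = n P4 P1 + (n P4 P2 + n P4 P3)"
    using disj by (simp_all add: n_Un Int_Un_distrib)
  have ge: "n P1 (- P1) \<ge> 3" "n P2 (- P2) \<ge> 3" "n P3 (- P3) \<ge> 3" "n P4 (- P4) \<ge> 3"
    using critical_cut_ge_3[OF crit x(1), of P1 x4] critical_cut_ge_3[OF crit x(3), of P2 x4]
      critical_cut_ge_3[OF crit x(5), of P3 x4] critical_cut_ge_3[OF crit x(7), of P4 x1] x
    unfolding P n_def by auto
  have "A = P1 \<union> P2" "- A = P3 \<union> P4" "B = P1 \<union> P3" "- B = P2 \<union> P4" unfolding P by auto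
  then have "n (P1 \<union> P2) (P3 \<union> P4) = 3" "n (P1 \<union> P3) (P2 \<union> P4) = 3"
    using A B unfolding n_def by metis+
  moreover have "n (P1 \<union> P2) (P3 \<union> P4) = (n P3 P1 + n P3 P2) + (n P4 P1 + n P4 P2)"
    by (rule n_Un_Un) (use disj in auto)
  moreover have "n (P1 \<union> P3) (P2 \<union> P4) = (n P2 P1 + n P2 P3) + (n P4 P1 + n P4 P3)"
    by (rule n_Un_Un) (use disj in auto)
  \<comment> \<open>The corners \<open>P1\<close> and \<open>P4\<close> together have at least six
    cut edges, while the cuts of \<open>A\<close> and \<open>B\<close> count these edges plus twice
    those between \<open>P2\<close> and \<open>P3\<close>, and sum to six. So
    \<open>n P2 P3 = 0\<close>, and likewise \<open>n P1 P4 = 0\<close>, and every corner has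
    exactly three cut edges. Comparing \<open>P1\<close> with \<open>P2\<close> gives
    \<open>n P1 P3 = n P2 P4\<close>, and these two sum to the cut of \<open>A\<close>.\<close>
  ultimately have "2 * n P1 P3 = 3"
    using cuts ge n_comm[of P1 P2] n_comm[of P1 P3] n_comm[of P1 P4] n_comm[of P2 P3] n_comm[of P2 P4]
      n_comm[of P3 P4] by linarith
  then show False by presburger
qed

section \<open>Decomposition along a vertex and an edge\<close>

text \<open>Allowing no edge between the sides includes ordinary cut-vertices, so excluding that
  case for critical graphs also gives that they have no cut-vertex.\<close>

definition separation :: "'a set set \<Rightarrow> 'a \<Rightarrow> 'a set \<Rightarrow> 'a set \<Rightarrow> bool" where
  "separation E u P Q \<longleftrightarrow> u \<in> \<Union>E \<and> P \<noteq> {} \<and> Q \<noteq> {} \<and> P \<inter> Q = {} \<and> P \<union> Q = \<Union>E - {u} \<and>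
     card (between E P Q) \<le> 1"

lemma separation_commute: "separation E u P Q \<Longrightarrow> separation E u Q P"
  unfolding separation_def by (auto simp: between_commute[of E Q P])

text \<open>The vertex \<open>u\<close> belongs to both coloured parts. Once the permutation aligns
  the colours at \<open>u\<close>, the edges at \<open>u\<close> are safe and only those between
  \<open>P\<close> and \<open>Q\<close> remain to be checked.\<close>

lemma proper_glue:
  assumes dE: "doubletons E" and PQ: "P \<union> Q = \<Union>E - {u}" "P \<inter> Q = {}"
    and c1: "proper (induced E (insert u P)) c1" and c2: "proper (induced E (insert u Q)) c2"
    and p: "colour_perm p" "p (c2 u) = c1 u"
    and b: "\<And>a b. {a, b} \<in> E \<Longrightarrow> a \<in> P \<Longrightarrow> b \<in> Q \<Longrightarrow> c1 a \<noteq> p (c2 b)"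
  shows "colourable3 E"
proof (rule proper_combine[OF dE _ _ p(1)])
  show "proper (induced E P) c1"
    by (rule proper_subset[OF c1]) (auto simp: induced_def)
  show "proper (induced E (- P)) c2"
    by (rule proper_subset[OF c2]) (use PQ in \<open>auto simp: induced_def\<close>)
  fix a b' assume e: "{a, b'} \<in> E" "a \<in> P" "b' \<notin> P"
  show "c1 a \<noteq> p (c2 b')"
  proof (cases "b' = u")
    case True
    then have "{a, b'} \<in> induced E (insert u P)" using e unfolding induced_def by auto
    then have "c1 a \<noteq> c1 b'" using c1 unfolding proper_def by blast
    then show ?thesis using True p(2) by simp
  next
    case False
    then have "b' \<in> Q" using e PQ by auto
    then show ?thesis using b e by blast
  qed
qed

text \<open>If \<open>v1\<close> and \<open>u\<close> had different colours, the colouring of the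
  other side could be aligned at \<open>u\<close> and still avoid the colour of \<open>v1\<close> at
  \<open>v2\<close>.\<close>

lemma separation_forces:
  assumes crit: "critical E" and sep: "separation E u P Q"
    and "between E P Q \<subseteq> {{v1, v2}}" "v1 \<in> P" "v2 \<in> Q"
    and c1: "proper (induced E (insert u P)) c1"
  shows "c1 v1 = c1 u"
proof (rule ccontr)
  assume n: "c1 v1 \<noteq> c1 u"
  have PQ: "P \<inter> Q = {}" "P \<union> Q = \<Union>E - {u}" using sep unfolding separation_def by blast+
  have "v1 \<in> \<Union>E" "v1 \<notin> insert u Q" using assms(4) PQ by blast+
  then obtain c2 where c2: "proper (induced E (insert u Q)) c2"
    using critical_induced_proper[OF crit] by metis
  obtain p where p: "colour_perm p" "p (c2 u) = c1 u" "p (c2 v2) \<noteq> c1 v1"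
    using colour_perm_fix_avoid[of "c1 u" "c1 v1" "c2 u" "c2 v2"] c1 c2 n unfolding proper_def by metis
  have "colourable3 E"
  proof (rule proper_glue[OF critical_doubletons[OF crit] PQ(2,1) c1 c2 p(1,2)])
    fix a b assume "{a, b} \<in> E" "a \<in> P" "b \<in> Q"
    then have "{a, b} = {v1, v2}" using assms(3) unfolding between_def by blast
    then have "a = v1" "b = v2" using \<open>a \<in> P\<close> \<open>b \<in> Q\<close> assms(4,5) PQ(1) by (auto simp: doubleton_eq_iff)
    then show "c1 a \<noteq> p (c2 b)" using p(3) by simp
  qed
  then show False using crit unfolding critical_def by blast
qed

lemma separation_edge:
  assumes crit: "critical E" and sep: "separation E u P Q"
  obtains v1 v2 where "between E P Q = {{v1, v2}}" "v1 \<in> P" "v2 \<in> Q"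
proof -
  have PQ: "P \<inter> Q = {}" "P \<union> Q = \<Union>E - {u}" "P \<noteq> {}" "Q \<noteq> {}" "card (between E P Q) \<le> 1"
    using sep unfolding separation_def by blast+
  have dE: "doubletons E" using crit by (rule critical_doubletons)
  show ?thesis
  proof (cases "between E P Q = {}")
    case True
    obtain x y where xy: "x \<in> P" "y \<in> Q" using PQ by blast
    then have "x \<in> \<Union>E" "x \<notin> insert u Q" "y \<in> \<Union>E" "y \<notin> insert u P" using PQ by blast+
    then obtain c1 c2 where c: "proper (induced E (insert u P)) c1" "proper (induced E (insert u Q)) c2"
      using critical_induced_proper[OF crit] by metis
    \<comment> \<open>Only the alignment at \<open>u\<close> is wanted here; the colour to avoid is
      an arbitrary one other than \<open>c1 u\<close>.\<close>
    obtain p where p: "colour_perm p" "p (c2 u) = c1 u"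
      using colour_perm_fix_avoid[of "c1 u" "if c1 u = 0 then 1 else 0" "c2 u" 0] c
      unfolding proper_def by (metis (full_types) one_less_numeral_iff semiring_norm(77) zero_less_numeral zero_neq_one)
    have "colourable3 E"
      by (rule proper_glue[OF dE PQ(2,1) c p]) (use True in \<open>auto simp: between_def\<close>)
    then show ?thesis using crit unfolding critical_def by blast
  next
    case False
    then have "card (between E P Q) > 0" using finite_between[OF dE] by (simp add: card_gt_0_iff)
    then have "card (between E P Q) = 1" using PQ(5) by linarith
    then obtain e where e: "between E P Q = {e}" by (rule card_1_singletonE)
    then have "e \<in> between E P Q" by simp
    then obtain v1 v2 where "v1 \<in> P" "v2 \<in> Q" "e = {v1, v2}" unfolding between_def by blast
    then show ?thesis using that e by simp
  qed
qed

text \<open>All colourings of the half on \<open>P\<close> give \<open>u\<close> and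
  \<open>v1\<close> the same colour, so adding the edge destroys them all. The half itself is
  colourable, hence the edge was absent.\<close>

lemma separation_no_edge:
  assumes crit: "critical E" and sep: "separation E u P Q"
    and b: "between E P Q = {{v1, v2}}" "v1 \<in> P" "v2 \<in> Q"
  shows "{u, v1} \<notin> E" "\<not> colourable3 (insert {u, v1} (induced E (insert u P)))"
proof -
  have f: "c v1 = c u" if "proper (induced E (insert u P)) c" for c
    using separation_forces[OF crit sep _ b(2,3) that] b(1) by blast
  show nc: "\<not> colourable3 (insert {u, v1} (induced E (insert u P)))"
  proof
    assume "colourable3 (insert {u, v1} (induced E (insert u P)))"
    then obtain c where c: "proper (insert {u, v1} (induced E (insert u P))) c"
      unfolding colourable3_def by blast
    then have "c u \<noteq> c v1" unfolding proper_def by blast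
    then show False using f[OF proper_subset[OF c]] by auto
  qed
  show "{u, v1} \<notin> E"
  proof
    assume "{u, v1} \<in> E"
    then have "{u, v1} \<in> induced E (insert u P)" using b(2) unfolding induced_def by auto
    moreover have "v2 \<in> \<Union>E" "v2 \<notin> insert u P" using b(3) sep unfolding separation_def by blast+
    then obtain c where "proper (induced E (insert u P)) c"
      using critical_induced_proper[OF crit] by metis
    ultimately show False using nc unfolding colourable3_def by (metis insert_absorb)
  qed
qed

lemma separation_union:
  assumes sep: "separation E u P Q" and dE: "doubletons E"
    and b: "between E P Q = {{v1, v2}}"
  shows "E = induced E (insert u P) \<union> induced E (insert u Q) \<union> {{v1, v2}}"
proof
  have PQ: "P \<union> Q = \<Union>E - {u}" using sep unfolding separation_def by blast
  show "E \<subseteq> induced E (insert u P) \<union> induced E (insert u Q) \<union> {{v1, v2}}"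
  proof
    fix e assume e: "e \<in> E"
    then obtain x y where xy: "e = {x, y}" using doubletonsE[OF dE] by metis
    then have "x \<in> insert u P \<or> x \<in> Q" "y \<in> insert u P \<or> y \<in> Q" using e PQ by auto
    moreover have "{x, y} \<in> between E P Q" if "x \<in> P \<and> y \<in> Q \<or> x \<in> Q \<and> y \<in> P"
      using that e xy unfolding between_def by (auto simp: insert_commute)
    ultimately show "e \<in> induced E (insert u P) \<union> induced E (insert u Q) \<union> {{v1, v2}}"
      using e xy b unfolding induced_def by auto
  qed
  have "{v1, v2} \<in> E" using b unfolding between_def by blast
  then show "induced E (insert u P) \<union> induced E (insert u Q) \<union> {{v1, v2}} \<subseteq> E"
    unfolding induced_def by auto
qed

text \<open>Critical subgraphs of the two completed halves are joined again to a graph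
  \<open>J\<close> inside \<open>E\<close>. The join is not 3-colourable, so criticality gives
  \<open>J = E\<close>, and neither half can have lost an edge.\<close>

lemma separation_critical:
  assumes crit: "critical E" and sep: "separation E u P Q"
    and b: "between E P Q = {{v1, v2}}" "v1 \<in> P" "v2 \<in> Q"
  shows "critical (insert {u, v1} (induced E (insert u P)))"
proof -
  define E1 where "E1 = insert {u, v1} (induced E (insert u P))"
  define E2 where "E2 = insert {u, v2} (induced E (insert u Q))"
  have dE: "doubletons E" using crit by (rule critical_doubletons)
  have PQ: "P \<inter> Q = {}" "P \<union> Q = \<Union>E - {u}" using sep unfolding separation_def by blast+
  have b': "between E Q P = {{v2, v1}}" using b(1) by (simp add: between_commute[of E Q] insert_commute)
  note n1 = separation_no_edge[OF crit sep b]
  note n2 = separation_no_edge[OF crit separation_commute[OF sep] b' b(3,2)]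
  have "u \<noteq> v1" "u \<noteq> v2" using b PQ by blast+
  then have d: "doubletons E1" "doubletons E2"
    using dE unfolding doubletons_def E1_def E2_def induced_def by auto
  obtain K1 where K1: "K1 \<subseteq> E1" "critical K1"
    using critical_subset_exists[OF d(1)] n1(2) unfolding E1_def by metis
  obtain K2 where K2: "K2 \<subseteq> E2" "critical K2"
    using critical_subset_exists[OF d(2)] n2(2) unfolding E2_def by metis
  define J where "J = (K1 - {{u, v1}}) \<union> (K2 - {{u, v2}}) \<union> {{v1, v2}}"
  have "{v1, v2} \<in> E" using b unfolding between_def by blast
  then have JE: "J \<subseteq> E" using K1 K2 unfolding J_def E1_def E2_def induced_def by auto
  have "\<not> colourable3 J"
  proof
    assume "colourable3 J"
    then obtain c where c: "proper J c" unfolding colourable3_def by blast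
    have force: "c u = c v" if "critical K" "K - {{u, v}} \<subseteq> J" for K v
    proof (rule ccontr)
      assume "c u \<noteq> c v"
      have "proper K c"
        unfolding proper_def
      proof (intro conjI allI impI)
        show "c x < 3" for x using c unfolding proper_def by blast
        fix x y assume "{x, y} \<in> K"
        then have "{x, y} = {u, v} \<or> {x, y} \<in> J" using that(2) by blast
        then show "c x \<noteq> c y"
          using c \<open>c u \<noteq> c v\<close> unfolding proper_def by (auto simp: doubleton_eq_iff)
      qed
      then show False using that(1) unfolding critical_def colourable3_def by blast
    qed
    have "c u = c v1" "c u = c v2"
      using force[OF K1(2)] force[OF K2(2)] unfolding J_def by blast+
    then show False using c unfolding proper_def J_def by (metis UnI2 singletonI)
  qed
  then have J: "J = E" using JE crit unfolding critical_def by blast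
  have "induced E (insert u P) \<subseteq> K1"
  proof
    fix e assume e: "e \<in> induced E (insert u P)"
    then have "e \<in> E" "e \<subseteq> insert u P" unfolding induced_def by auto
    have "e \<noteq> {v1, v2}" using e PQ b unfolding induced_def by blast
    \<comment> \<open>The halves share only the vertex \<open>u\<close>, so no edge lies in both of
      them.\<close>
    moreover have "e \<notin> K2 - {{u, v2}}"
    proof
      assume "e \<in> K2 - {{u, v2}}"
      then have "e \<subseteq> insert u Q" using K2 unfolding E2_def induced_def by auto
      then have "e \<subseteq> {u}" using \<open>e \<subseteq> insert u P\<close> PQ by blast
      then have "card e \<le> 1" by (metis card.empty card.insert_remove card_mono finite.emptyI finite.insertI empty_Diff One_nat_def)
      then show False using dE \<open>e \<in> E\<close> unfolding doubletons_def by fastforce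
    qed
    ultimately show "e \<in> K1" using J \<open>e \<in> E\<close> unfolding J_def by blast
  qed
  moreover have "{u, v1} \<in> K1"
  proof (rule ccontr)
    assume "{u, v1} \<notin> K1"
    then have "K1 \<subseteq> induced E (insert u P)" using K1 unfolding E1_def by blast
    moreover have "v2 \<in> \<Union>E" "v2 \<notin> insert u P" using b(3) PQ by blast+
    then obtain c where "proper (induced E (insert u P)) c"
      using critical_induced_proper[OF crit] by metis
    ultimately have "colourable3 K1" unfolding colourable3_def using proper_subset by metis
    then show False using K1(2) unfolding critical_def by blast
  qed
  ultimately have "K1 = E1" using K1 unfolding E1_def by blast
  then show ?thesis using K1 unfolding E1_def by blast
qed

lemma separation_Union:
  assumes sep: "separation E u P Q" and b: "between E P Q = {{v1, v2}}" "v1 \<in> P" "v2 \<in> Q"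
    and dE: "doubletons E"
  shows "\<Union>(insert {u, v1} (induced E (insert u P))) = insert u P"
proof
  show "\<Union>(insert {u, v1} (induced E (insert u P))) \<subseteq> insert u P"
    using b(2) unfolding induced_def by auto
  have PQ: "P \<inter> Q = {}" "P \<union> Q = \<Union>E - {u}" using sep unfolding separation_def by blast+
  show "insert u P \<subseteq> \<Union>(insert {u, v1} (induced E (insert u P)))"
  proof
    fix x assume x: "x \<in> insert u P"
    show "x \<in> \<Union>(insert {u, v1} (induced E (insert u P)))"
    proof (cases "x = u \<or> x = v1")
      case False
      then obtain e where e: "x \<in> e" "e \<in> E" using x PQ by blast
      have "e \<noteq> {v1, v2}" using False e x b(3) PQ by blast
      moreover have "e \<notin> induced E (insert u Q)" using False x e PQ unfolding induced_def by blast
      ultimately show ?thesis using separation_union[OF sep dE b(1)] e by blast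
    qed auto
  qed
qed

text \<open>The form, dual by Menger, in which the bound on local connectivity is used from here on:
  inheritance becomes a comparison of cut sizes.\<close>

definition separable3 :: "'a set set \<Rightarrow> bool" where
  "separable3 E \<longleftrightarrow> (\<forall>x\<in>\<Union>E. \<forall>y\<in>\<Union>E. x \<noteq> y \<longrightarrow> (\<exists>S. x \<in> S \<and> y \<notin> S \<and> card (cut E S) \<le> 3))"

lemma separable3_subset:
  assumes "separable3 E" "K \<subseteq> E" "doubletons E"
  shows "separable3 K"
proof -
  have "card (cut K S) \<le> card (cut E S)" for S
    by (rule card_mono[OF finite_between[OF assms(3)] between_mono[OF assms(2)]])
  then show ?thesis using assms(1,2) unfolding separable3_def
    by (meson Union_mono le_trans subsetD)
qed

text \<open>Every side \<open>S\<close> cuts the completed half in at most as many edges as it cuts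
  \<open>E\<close>. If the new edge is cut, some edge of \<open>E\<close> outside the half is cut as
  well and pays for it. By complementation \<open>S\<close> may be assumed to contain
  \<open>u\<close>.\<close>

lemma separation_separable3:
  assumes crit: "critical E" and sep: "separation E u P Q"
    and b: "between E P Q = {{v1, v2}}" "v1 \<in> P" "v2 \<in> Q" and s3: "separable3 E"
  shows "separable3 (insert {u, v1} (induced E (insert u P)))"
proof -
  define E1 where "E1 = insert {u, v1} (induced E (insert u P))"
  have dE: "doubletons E" using crit by (rule critical_doubletons)
  have PQ: "P \<inter> Q = {}" "P \<union> Q = \<Union>E - {u}" "u \<in> \<Union>E" using sep unfolding separation_def by blast+
  have UE1: "\<Union>E1 = insert u P" unfolding E1_def by (rule separation_Union[OF sep b dE])
  have main: "card (cut E1 S) \<le> card (cut E S)" if S: "u \<in> S" for S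
  proof (cases "v1 \<in> S")
    case True
    then have nin: "{u, v1} \<notin> cut E1 S" using S by (auto simp: between_def doubleton_eq_iff)
    have E1E: "E1 \<subseteq> insert {u, v1} E" unfolding E1_def induced_def by auto
    have "e \<in> cut E S" if e: "e \<in> cut E1 S" for e
    proof -
      have "e \<in> E1" using e by (rule cutE)
      moreover have "e \<noteq> {u, v1}" using e nin by blast
      ultimately have "e \<in> E" using E1E by blast
      then show ?thesis using e unfolding between_def by simp
    qed
    then have "cut E1 S \<subseteq> cut E S" by blast
    then show ?thesis by (rule card_mono[OF finite_between[OF dE]])
  next
    case v1: False
    have "\<exists>f\<in>cut E S. f \<notin> induced E (insert u P)"
    proof (rule ccontr)
      assume n: "\<not> ?thesis"
      have ve: "{v1, v2} \<in> E" using b unfolding between_def by blast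
      moreover have "{v1, v2} \<notin> induced E (insert u P)" using b PQ unfolding induced_def by blast
      ultimately have v2: "v2 \<notin> S" using n v1 in_cutI[of v2 v1 E S] by (auto simp: insert_commute)
      \<comment> \<open>If no edge outside the half is cut, then \<open>v2\<close> lies with
        \<open>v1\<close>, and the part of \<open>Q\<close> on their side is attached to the rest by
        \<open>{v1, v2}\<close> alone, against the lower bound of three.\<close>
      define R where "R = Q - S"
      have "cut E R \<subseteq> {{v1, v2}}"
      proof
        fix e assume "e \<in> cut E R"
        then obtain x y where e: "e = {x, y}" "x \<in> R" "y \<notin> R" "e \<in> E" by (rule cutE)
        have y: "y \<in> P \<or> y \<in> insert u Q" using e PQ by auto
        show "e \<in> {{v1, v2}}"
        proof (cases "y \<in> P")
          case True
          moreover have "x \<in> Q" using e(2) unfolding R_def by simp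
          ultimately have "e \<in> between E P Q"
            using e(1,4) insert_commute[of x y] unfolding between_def by auto
          then show ?thesis using b(1) by simp
        next
          case False
          then have "y \<in> S" using y e S unfolding R_def by auto
          then have "e \<in> cut E S" using e in_cutI[of y x E S] unfolding R_def by (auto simp: insert_commute)
          moreover have "e \<notin> induced E (insert u P)" using e PQ unfolding R_def induced_def by auto
          ultimately show ?thesis using n by blast
        qed
      qed
      then have "card (cut E R) \<le> 1" using card_mono[of "{{v1, v2}}"] by fastforce
      moreover have "v2 \<in> R" "u \<notin> R" using v2 b(3) PQ unfolding R_def by blast+
      moreover have "v2 \<in> \<Union>E" using ve by blast
      ultimately show False using critical_cut_ge_3[OF crit, of v2 R u] PQ(3) by simp
    qed
    then obtain f where f: "f \<in> cut E S" "f \<notin> induced E (insert u P)" by blast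
    have "cut E1 S \<subseteq> insert {u, v1} (cut E S - {f})"
      using f unfolding E1_def between_def induced_def by blast
    moreover have fin: "finite (cut E S)" by (rule finite_between[OF dE])
    ultimately have "card (cut E1 S) \<le> card (insert {u, v1} (cut E S - {f}))"
      by (intro card_mono) auto
    also have "\<dots> \<le> Suc (card (cut E S - {f}))" by (rule card_insert_le_m1[THEN order.trans]) (use fin in \<open>auto simp: card_insert_if\<close>)
    also have "\<dots> = card (cut E S)" using fin f by (metis card_Suc_Diff1)
    finally show ?thesis .
  qed
  have main': "card (cut E1 S) \<le> card (cut E S)" for S
    using main[of S] main[of "- S"] by (cases "u \<in> S") (auto simp: cut_Compl between_commute[of _ "- S"])
  show ?thesis
    unfolding separable3_def E1_def[symmetric]
  proof (intro ballI impI)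
    fix x y assume "x \<in> \<Union>E1" "y \<in> \<Union>E1" "x \<noteq> y"
    then have "x \<in> \<Union>E" "y \<in> \<Union>E" using UE1 PQ by auto
    then obtain S where "x \<in> S" "y \<notin> S" "card (cut E S) \<le> 3"
      using s3 \<open>x \<noteq> y\<close> unfolding separable3_def by meson
    then show "\<exists>S. x \<in> S \<and> y \<notin> S \<and> card (cut E1 S) \<le> 3" using main'[of S] by (meson le_trans)
  qed
qed

text \<open>Choose the side \<open>R\<close> without \<open>u\<close>, and also without
  \<open>v1\<close> if \<open>u\<close> is the separating vertex. It is a side in \<open>E\<close>
  too: if \<open>v1\<close> lies in \<open>R\<close>, the single crossing edge was
  \<open>{u, v1}\<close>, and \<open>{v1, v2}\<close> takes its place.\<close>

lemma separation_refine:
  assumes crit: "critical E" and sep: "separation E u P Q"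
    and b: "between E P Q = {{v1, v2}}" "v1 \<in> P" "v2 \<in> Q"
    and sep1: "separation (insert {u, v1} (induced E (insert u P))) u' P' Q'"
  obtains u'' P'' Q'' where "separation E u'' P'' Q''" "P'' \<subset> P"
proof -
  define E1 where "E1 = insert {u, v1} (induced E (insert u P))"
  have dE: "doubletons E" using crit by (rule critical_doubletons)
  have PQ: "P \<inter> Q = {}" "P \<union> Q = \<Union>E - {u}" "u \<in> \<Union>E" "Q \<noteq> {}" using sep unfolding separation_def by blast+
  have UE1: "\<Union>E1 = insert u P" unfolding E1_def by (rule separation_Union[OF sep b dE])
  have crit1: "critical E1" unfolding E1_def by (rule separation_critical[OF crit sep b])
  have "\<exists>P' Q'. separation E1 u' P' Q' \<and> u \<notin> P' \<and> (u = u' \<longrightarrow> v1 \<notin> P')"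
  proof (cases "u \<in> P' \<or> u = u' \<and> v1 \<in> P'")
    case True
    moreover have "P' \<inter> Q' = {}" "P' \<union> Q' = \<Union>E1 - {u'}"
      using sep1 unfolding separation_def E1_def by blast+
    ultimately have "u \<notin> Q' \<and> (u = u' \<longrightarrow> v1 \<notin> Q')" by auto
    then show ?thesis using separation_commute[OF sep1[folded E1_def]] by blast
  next
    case False
    then show ?thesis using sep1[folded E1_def] by blast
  qed
  then obtain R T where RT: "separation E1 u' R T" and uR: "u \<notin> R" "u = u' \<Longrightarrow> v1 \<notin> R" by blast
  have R: "R \<inter> T = {}" "R \<union> T = insert u P - {u'}" "R \<noteq> {}" "T \<noteq> {}" "u' \<in> insert u P"
    "card (between E1 R T) \<le> 1"
    using RT by (simp_all only: separation_def UE1 simp_thms)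
  have RT_iff: "x \<in> R \<or> x \<in> T \<longleftrightarrow> x \<in> insert u P \<and> x \<noteq> u'" for x
    using R(2) by (metis Diff_iff Un_iff singleton_iff)
  have "R \<subseteq> P"
  proof
    fix x assume "x \<in> R"
    then show "x \<in> P" using RT_iff[of x] uR(1) by fast
  qed
  moreover have "R \<noteq> P"
  proof
    assume "R = P"
    have "u' \<notin> P" using RT_iff[of u'] \<open>R = P\<close> by simp
    then have "u' = u" using R(5) by simp
    then have "T \<subseteq> P" using RT_iff by blast
    then show False using R(1,4) \<open>R = P\<close> by auto
  qed
  ultimately have RP: "R \<subset> P" by blast
  define T' where "T' = \<Union>E - {u'} - R"
  have bt: "e \<in> between E1 R T \<or> e = {v1, v2} \<and> v1 \<in> R" if e: "e \<in> between E R T'" for e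
  proof -
    obtain x y where xy: "e = {x, y}" "x \<in> R" "y \<in> T'" "e \<in> E" using e unfolding between_def by blast
    show ?thesis
    proof (cases "y \<in> Q")
      case True
      then have "e \<in> between E P Q" using xy RP unfolding between_def by blast
      then have "{x, y} = {v1, v2}" using b(1) xy(1) by simp
      moreover have "x \<in> P" using xy(2) RP by (rule psubsetD[rotated])
      then have "x \<noteq> v2" using b(3) PQ(1) by blast
      ultimately have "x = v1" by (metis doubleton_eq_iff)
      then show ?thesis using xy \<open>{x, y} = {v1, v2}\<close> by simp
    next
      case False
      then have "y \<in> insert u P" using xy PQ unfolding T'_def by auto
      then have "y \<in> T" using xy RT_iff[of y] unfolding T'_def by simp
      moreover have "e \<in> E1" using xy RP \<open>y \<in> insert u P\<close> unfolding E1_def induced_def by auto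
      ultimately show ?thesis using xy unfolding between_def by blast
    qed
  qed
  have "card (between E R T') \<le> 1"
  proof (cases "v1 \<in> R")
    case True
    then have "u \<in> T" using uR RT_iff[of u] by blast
    then have "{v1, u} \<in> between E1 R T"
      using True unfolding between_def E1_def by (auto simp: insert_commute)
    then have "{u, v1} \<in> between E1 R T" by (simp add: insert_commute)
    moreover have "finite (between E1 R T)" by (rule finite_between[OF critical_doubletons[OF crit1]])
    ultimately have eq: "between E1 R T = {{u, v1}}" using R(6)
      by (intro equalityI subsetI) (auto simp: card_le_Suc0_iff_eq)
    have "between E R T' \<subseteq> {{v1, v2}}"
    proof
      fix e assume e: "e \<in> between E R T'"
      then have "e \<noteq> {u, v1}" using separation_no_edge(1)[OF crit sep b] unfolding between_def by blast
      then show "e \<in> {{v1, v2}}" using bt[OF e] eq by blast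
    qed
    then show ?thesis using card_mono[of "{{v1, v2}}"] by fastforce
  next
    case False
    then have "between E R T' \<subseteq> between E1 R T" using bt by blast
    then show ?thesis using R(6) card_mono[OF finite_between[OF critical_doubletons[OF crit1]]] le_trans by blast
  qed
  moreover have PE: "P \<subseteq> \<Union>E" "Q \<subseteq> \<Union>E" "u \<notin> Q" using PQ(2) by auto
  moreover have "u' \<in> \<Union>E" using R(5) PE(1) PQ(3) by auto
  moreover have "R \<subseteq> \<Union>E - {u'}"
  proof
    fix x assume x: "x \<in> R"
    then have "x \<in> \<Union>E" using PE(1) RP by blast
    then show "x \<in> \<Union>E - {u'}" using x RT_iff[of x] by simp
  qed
  moreover have "T' \<noteq> {}"
  proof -
    have "v2 \<notin> R" using RP b(3) PQ(1) by blast
    moreover have "v2 \<noteq> u'" using R(5) b(3) PE(3) PQ(1) by blast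
    ultimately have "v2 \<in> T'" using b(3) PE(2) unfolding T'_def by blast
    then show ?thesis by blast
  qed
  ultimately have "separation E u' R T'"
    unfolding separation_def using R(3) by (simp add: T'_def Un_absorb1 Int_Diff)
  then show ?thesis using that RP by blast
qed

section \<open>Three-edge cuts\<close>

text \<open>The indecomposable case: no vertex and edge together disconnect the graph. Here every
  three-edge cut turns out to be trivial and the graph an odd wheel.\<close>

locale no_separation =
  fixes E :: "'a set set"
  assumes crit: "critical E" and s3: "separable3 E"
    and nosep: "\<And>u P Q. \<not> separation E u P Q"
begin

lemma dE: "doubletons E"
  using crit by (rule critical_doubletons)

lemma cut_ge_3:
  assumes "S \<subseteq> \<Union>E" "S \<noteq> {}" "S \<noteq> \<Union>E"
  shows "card (cut E S) \<ge> 3"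
proof -
  obtain x y where "x \<in> S" "y \<in> \<Union>E" "y \<notin> S" using assms by blast
  then show ?thesis using critical_cut_ge_3[OF crit, of x S y] assms(1) by blast
qed

lemma no_monochromatic_cut:
  assumes A: "A \<subseteq> \<Union>E" "A \<noteq> \<Union>E" and A2: "\<And>x. A \<noteq> {x}"
    and cutA: "cut E A = {{x1, y1}, {x2, y2}, {x3, y3}}"
    and dist: "distinct [{x1, y1}, {x2, y2}, {x3, y3}]"
    and xA: "x1 \<in> A" "x2 \<in> A" "x3 \<in> A" and yA: "y1 \<notin> A" "y2 \<notin> A" "y3 \<notin> A"
    and mono: "\<And>c. proper (induced E A) c \<Longrightarrow> c x1 = c x2 \<and> c x2 = c x3"
  shows False
proof -
  define V where "V = \<Union>E"
  have AV: "A \<subseteq> V" "A \<noteq> V" using A unfolding V_def by blast+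
  have cardA: "card (cut E A) = 3" using cutA dist by simp
  have fin: "finite V" unfolding V_def by (rule doubletons_finite_Union[OF dE])
  \<comment> \<open>If \<open>u\<close> is on all cut edges except \<open>e\<close>, then
    \<open>u\<close> and \<open>e\<close> separate the rest of \<open>A\<close> from the outside.
    Hence the three ends in \<open>A\<close> are distinct.\<close>
  have star: False if u: "u \<in> A" and e: "\<And>f. f \<in> cut E A \<Longrightarrow> u \<in> f \<or> f = e" for u e
  proof -
    have "between E (A - {u}) (V - A) \<subseteq> {e}"
    proof
      fix f assume "f \<in> between E (A - {u}) (V - A)"
      then obtain a b where f: "f \<in> E" "f = {a, b}" "a \<in> A" "a \<noteq> u" "b \<notin> A" unfolding between_def by blast
      then have "f \<in> cut E A" "u \<notin> f" using u in_cutI[of a b E A] by auto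
      then show "f \<in> {e}" using e by blast
    qed
    then have "card (between E (A - {u}) (V - A)) \<le> 1" using card_mono[of "{e}"] by fastforce
    moreover have "A - {u} \<noteq> {}" using A2[of u] u by blast
    ultimately have "separation E u (A - {u}) (V - A)"
      unfolding separation_def V_def[symmetric] using AV u by blast
    then show False using nosep by blast
  qed
  have xne: "x1 \<noteq> x2" "x1 \<noteq> x3" "x2 \<noteq> x3"
    using star[OF xA(1), of "{x3, y3}"] star[OF xA(1), of "{x2, y2}"] star[OF xA(2), of "{x1, y1}"]
    unfolding cutA by auto
  \<comment> \<open>\<open>M\<close> collects the maximal proper parts of \<open>A\<close> with a
    three-edge cut. Laminarity makes them disjoint, since two of them cannot cover the vertices
    outside \<open>A\<close>.\<close>
  define F where "F = {Z. Z \<subset> A \<and> Z \<noteq> {} \<and> card (cut E Z) = 3}"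
  define M where "M = {Z \<in> F. \<forall>Z'\<in>F. Z \<subseteq> Z' \<longrightarrow> Z' = Z}"
  have finF: "finite F"
    using fin AV(1) finite_subset[of F "Pow A"] finite_subset[of A V] unfolding F_def by auto
  have FM: "\<exists>Z'\<in>M. Z \<subseteq> Z'" if ZF: "Z \<in> F" for Z
  proof -
    obtain m where m: "m \<in> F" "Z \<subseteq> m" "\<And>b. b \<in> F \<Longrightarrow> m \<subseteq> b \<Longrightarrow> m = b"
      using finite_has_maximal2[OF finF ZF] by auto
    then have "m \<in> M" unfolding M_def by auto
    then show ?thesis using m(2) by blast
  qed
  have disj: "Z \<inter> Z' = {}" if Z: "Z \<in> M" "Z' \<in> M" "Z \<noteq> Z'" for Z Z'
  proof -
    have ZF: "Z \<in> F" "Z' \<in> F" using Z unfolding M_def by blast+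
    then have sub: "Z \<subset> A" "Z' \<subset> A" unfolding F_def by blast+
    have "Z \<inter> Z' \<inter> V = {} \<or> (Z - Z') \<inter> V = {} \<or> (Z' - Z) \<inter> V = {} \<or> V \<subseteq> Z \<union> Z'"
      unfolding V_def by (rule critical_cuts_laminar[OF crit]) (use ZF in \<open>auto simp: F_def\<close>)
    moreover have "\<not> V \<subseteq> Z \<union> Z'" using sub AV by blast
    moreover have "\<not> Z \<subseteq> Z'" "\<not> Z' \<subseteq> Z" using Z ZF unfolding M_def by blast+
    ultimately show ?thesis using sub AV(1) by blast
  qed
  \<comment> \<open>Two uncovered vertices are separated by a three-edge cut that does not cross
    \<open>A\<close>. One of its sides lies inside \<open>A\<close>, so it belongs to
    \<open>F\<close> and covers one of them.\<close>
  have "\<exists>v\<in>A. \<forall>z\<in>A. z \<noteq> v \<longrightarrow> (\<exists>Z\<in>F. z \<in> Z)"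
  proof (rule ccontr)
    assume n: "\<not> ?thesis"
    then obtain z1 where z1: "z1 \<in> A" "\<forall>Z\<in>F. z1 \<notin> Z" using xA(1) by meson
    then obtain z2 where z2: "z2 \<in> A" "z1 \<noteq> z2" "\<forall>Z\<in>F. z2 \<notin> Z" using n by metis
    have zV: "z1 \<in> \<Union>E" "z2 \<in> \<Union>E" using z1 z2 A(1) by auto
    then obtain S where S: "z1 \<in> S" "z2 \<notin> S" "card (cut E S) \<le> 3"
      using s3 z2(2) unfolding separable3_def by meson
    then have cS: "card (cut E S) = 3" using critical_cut_ge_3[OF crit zV(1) S(1) zV(2) S(2)] by simp
    have VS: "card (cut E (V \<inter> S)) = 3" "card (cut E (V - S)) = 3"
      using cS cut_Int[of E V S] cut_Diff[of E V S] unfolding V_def by simp_all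
    have "A \<inter> S \<inter> V = {} \<or> (A - S) \<inter> V = {} \<or> (S - A) \<inter> V = {} \<or> V \<subseteq> A \<union> S"
      unfolding V_def by (rule critical_cuts_laminar[OF crit cardA cS])
    moreover have "z1 \<in> A \<inter> S \<inter> V" "z2 \<in> (A - S) \<inter> V" using z1 z2 S zV unfolding V_def by auto
    ultimately have "(S - A) \<inter> V = {} \<or> V \<subseteq> A \<union> S" by blast
    then show False
    proof
      assume "(S - A) \<inter> V = {}"
      then have "V \<inter> S \<subseteq> A" by blast
      moreover have "V \<inter> S \<noteq> A" "z1 \<in> V \<inter> S" using z2 z1 S zV unfolding V_def by auto
      ultimately have "V \<inter> S \<in> F" unfolding F_def using VS by blast
      then show False using z1(2) \<open>z1 \<in> V \<inter> S\<close> by blast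
    next
      assume "V \<subseteq> A \<union> S"
      then have "V - S \<subseteq> A" by blast
      moreover have "V - S \<noteq> A" "z2 \<in> V - S" using z2 z1 S zV unfolding V_def by auto
      ultimately have "V - S \<in> F" unfolding F_def using VS by blast
      then show False using z2(3) \<open>z2 \<in> V - S\<close> by blast
    qed
  qed
  then obtain v where v: "v \<in> A" "\<And>z. z \<in> A \<Longrightarrow> z \<noteq> v \<Longrightarrow> \<exists>Z\<in>F. z \<in> Z" by blast
  have vM: "\<exists>Z\<in>M. z \<in> Z" if "z \<in> A" "z \<noteq> v" for z
    using v(2)[OF that] FM by blast
  \<comment> \<open>If \<open>Z\<close> and \<open>A\<close> shared two cut edges, only one edge of
    each cut could remain around \<open>A - Z\<close>, which is below three.\<close>
  have two: False if Z: "Z \<in> F" and fg: "f \<in> cut E A" "g \<in> cut E A" "f \<noteq> g" "f \<in> cut E Z" "g \<in> cut E Z" for Z f g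
  proof -
    have ZA: "Z \<subset> A" "card (cut E Z) = 3" using Z unfolding F_def by blast+
    have "cut E (A - Z) \<subseteq> (cut E A - {f, g}) \<union> (cut E Z - {f, g})"
    proof
      fix e assume "e \<in> cut E (A - Z)"
      then obtain a b where e: "e = {a, b}" "a \<in> A" "a \<notin> Z" "b \<notin> A \<or> b \<in> Z" "e \<in> E"
        by (metis (no_types, lifting) DiffD1 DiffD2 DiffI cutE)
      have "e \<notin> {f, g}"
      proof
        assume "e \<in> {f, g}"
        then have "e \<in> cut E A" "e \<in> cut E Z" using fg by auto
        then show False using e ZA(1) unfolding between_def by (auto simp: doubleton_eq_iff)
      qed
      moreover have "e \<in> cut E A \<or> e \<in> cut E Z"
        using e in_cutI[of a b E A] in_cutI[of b a E Z] by (auto simp: insert_commute)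
      ultimately show "e \<in> (cut E A - {f, g}) \<union> (cut E Z - {f, g})" by blast
    qed
    then have "card (cut E (A - Z)) \<le> card ((cut E A - {f, g}) \<union> (cut E Z - {f, g}))"
      by (rule card_mono[rotated]) (simp add: finite_between[OF dE])
    also have "\<dots> \<le> card (cut E A - {f, g}) + card (cut E Z - {f, g})" by (rule card_Un_le)
    also have "\<dots> = 2"
      using fg cardA ZA(2) by (simp add: card_Diff_subset)
    finally have "card (cut E (A - Z)) \<le> 2" .
    moreover have "card (cut E (A - Z)) \<ge> 3"
      by (rule cut_ge_3) (use ZA AV in \<open>auto simp: V_def\<close>)
    ultimately show False by simp
  qed
  \<comment> \<open>Here \<open>x\<close> is an end other than the exceptional vertex
    \<open>v\<close>; the remaining ends \<open>x'\<close> and \<open>x''\<close> get the extra edge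
    that produces \<open>K\<close>.\<close>
  have main: False
    if cutA': "cut E A = {{x, y}, {x', y'}, {x'', y''}}" and d: "distinct [{x, y}, {x', y'}, {x'', y''}]"
      and x: "x \<in> A" "x' \<in> A" "x'' \<in> A" "y \<notin> A" "y' \<notin> A" "y'' \<notin> A" "x' \<noteq> x''" "x \<noteq> v"
      and eq: "\<And>c. proper (induced E A) c \<Longrightarrow> c x' = c x''" for x y x' y' x'' y''
  proof -
    have es: "{x, y} \<in> E" "{x', y'} \<in> E" "{x'', y''} \<in> E" using cutA' unfolding between_def by blast+
    have yV: "y \<in> V" using es unfolding V_def by blast
    have "doubletons (insert {x', x''} (induced E A))"
      using dE x(7) doubletons_subset[OF dE induced_subset] unfolding doubletons_def by auto
    moreover have "\<not> colourable3 (insert {x', x''} (induced E A))"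
    proof
      assume "colourable3 (insert {x', x''} (induced E A))"
      then obtain c where c: "proper (insert {x', x''} (induced E A)) c" unfolding colourable3_def by blast
      then have "c x' \<noteq> c x''" unfolding proper_def by blast
      then show False using eq[OF proper_subset[OF c]] by auto
    qed
    ultimately obtain K where K: "K \<subseteq> insert {x', x''} (induced E A)" "critical K"
      by (rule critical_subset_exists)
    have KA: "e \<subseteq> A" if "e \<in> K" for e using that K(1) x unfolding induced_def by auto
    have KE: "e \<in> E" if "e \<in> K" "e \<noteq> {x', x''}" for e using that K(1) unfolding induced_def by auto
    have xK: "{x', x''} \<in> K"
    proof (rule ccontr)
      assume "{x', x''} \<notin> K"
      then have "K \<subseteq> induced E A" using K(1) by blast
      moreover obtain c where "proper (induced E A) c"
        using critical_induced_proper[OF crit] yV x(4) unfolding V_def by metis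
      ultimately have "colourable3 K" unfolding colourable3_def using proper_subset by metis
      then show False using K(2) unfolding critical_def by blast
    qed
    have small: "cut K Z = {}" if "cut K Z \<subseteq> B" "card B \<le> 2" "finite B" for Z B
    proof (rule critical_cut_less_3[OF K(2)])
      have "card (cut K Z) \<le> card B" using that by (intro card_mono)
      then show "card (cut K Z) < 3" using that(2) by simp
    qed
    have fZ: "finite (cut E Z)" for Z by (rule finite_between[OF dE])
    have ZM: "Z \<subset> A" "card (cut E Z) = 3" "Z \<in> F" if "Z \<in> M" for Z
      using that unfolding M_def F_def by blast+
    have inZ: "{p, q} \<in> cut E Z" if "Z \<in> M" "p \<in> Z" "{p, q} \<in> E" "q \<notin> A" for Z p q
      using in_cutI[OF that(3,2)] that(1,4) ZM(1) by blast
    have one: "\<not> (x \<in> Z \<and> x' \<in> Z)" "\<not> (x \<in> Z \<and> x'' \<in> Z)" "\<not> (x' \<in> Z \<and> x'' \<in> Z)" if "Z \<in> M" for Z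
      using two[OF ZM(3)[OF that], of "{x, y}" "{x', y'}"] two[OF ZM(3)[OF that], of "{x, y}" "{x'', y''}"]
        two[OF ZM(3)[OF that], of "{x', y'}" "{x'', y''}"] inZ[OF that] es d x(4-6)
      unfolding cutA' by auto
    have cutK: "cut K Z \<subseteq> cut E Z - N" if "\<not> (x' \<in> Z \<and> x'' \<notin> Z)" "\<not> (x'' \<in> Z \<and> x' \<notin> Z)" "N \<inter> K = {}" for Z N
    proof
      fix e assume e: "e \<in> cut K Z"
      then obtain a b where ab: "e = {a, b}" "a \<in> Z" "b \<notin> Z" "e \<in> K" by (rule cutE)
      then have "e \<noteq> {x', x''}" using that by (auto simp: doubleton_eq_iff)
      then have "e \<in> E" using KE ab by blast
      then show "e \<in> cut E Z - N" using ab that(3) in_cutI[of a b E Z] by blast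
    qed
    have cutK': "cut K Z \<subseteq> insert {x', x''} (cut E Z - N)" if "N \<inter> K = {}" for Z N
    proof
      fix e assume e: "e \<in> cut K Z"
      then obtain a b where ab: "e = {a, b}" "a \<in> Z" "b \<notin> Z" "e \<in> K" by (rule cutE)
      show "e \<in> insert {x', x''} (cut E Z - N)"
        using ab that KE[OF ab(4)] in_cutI[of a b E Z] by blast
    qed
    have out: "{p, q} \<notin> K" if "q \<notin> A" for p q using KA[of "{p, q}"] that by blast
    \<comment> \<open>The pieces none of whose cut edges lies in \<open>K\<close>. Without
      \<open>v\<close>, their union is going to be a side of a separation.\<close>
    define W where "W = \<Union>{Z \<in> M. cut E Z \<inter> K = {}}"
    have bad: "cut E Z \<inter> K = {}" if "cut K Z = {}" for Z
      using that unfolding between_def by blast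
    \<comment> \<open>The piece around \<open>x\<close> contains neither \<open>x'\<close> nor
      \<open>x''\<close>, so the extra edge does not cross its cut. The edge \<open>{x, y}\<close>
      leaves \<open>A\<close> and is missing from \<open>K\<close>; so at most two edges, hence
      none, remain.\<close>
    have xW: "x \<in> W"
    proof -
      obtain Z where Z: "Z \<in> M" "x \<in> Z" using vM[OF x(1,8)] by blast
      have "cut K Z \<subseteq> cut E Z - {{x, y}}"
        by (rule cutK) (use one[OF Z(1)] Z(2) out[OF x(4)] in auto)
      moreover have "card (cut E Z - {{x, y}}) \<le> 2"
        using inZ[OF Z es(1) x(4)] ZM(2)[OF Z(1)] fZ by simp
      ultimately have "cut K Z = {}" using small fZ by blast
      then show ?thesis using Z bad unfolding W_def by blast
    qed
    \<comment> \<open>Otherwise the extra edge alone would be a cut of \<open>K\<close>.\<close>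
    have crossing: "cut E Z \<inter> K \<noteq> {}" if Z: "Z \<in> M" "x' \<in> Z \<or> x'' \<in> Z" for Z
    proof
      assume e: "cut E Z \<inter> K = {}"
      have "{x', x''} \<in> cut K Z"
        using one(3)[OF Z(1)] Z(2) in_cutI[of x' x'' K Z] in_cutI[of x'' x' K Z] xK by (auto simp: insert_commute)
      moreover have "cut K Z \<subseteq> {{x', x''}}" using cutK'[of "cut E Z" Z] e by auto
      then have "cut K Z = {}" by (rule small) auto
      ultimately show False by blast
    qed
    then have x'W: "x' \<notin> W" "x'' \<notin> W" unfolding W_def by blast+
    \<comment> \<open>A piece \<open>Z'\<close> outside \<open>W\<close> that is adjacent to
      \<open>W\<close> has already lost the edge \<open>{z, z'}\<close> in \<open>K\<close>. Even
      with the extra edge it cannot afford to lose another one. As the edges from \<open>x'\<close>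
      and \<open>x''\<close> out of \<open>A\<close> are never in \<open>K\<close>, it contains
      neither of these ends, the extra edge does not cross its cut, and at most two edges are
      left.\<close>
    have closed: "z' = v" if z: "z \<in> W" "{z, z'} \<in> E" "z' \<in> A" "z' \<notin> W" for z z'
    proof (rule ccontr)
      assume "z' \<noteq> v"
      then obtain Z' where Z': "Z' \<in> M" "z' \<in> Z'" using vM[OF z(3)] by blast
      obtain Z where Z: "Z \<in> M" "cut E Z \<inter> K = {}" "z \<in> Z" using z(1) unfolding W_def by blast
      have "z' \<notin> Z" using z(4) Z unfolding W_def by blast
      then have "{z, z'} \<in> cut E Z" using in_cutI[OF z(2) Z(3)] by blast
      then have zK: "{z, z'} \<notin> K" using Z(2) by blast
      have "Z \<noteq> Z'" using \<open>z' \<notin> Z\<close> Z'(2) by blast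
      then have "z \<notin> Z'" using disj[OF Z(1) Z'(1)] Z(3) by blast
      then have zc: "{z, z'} \<in> cut E Z'"
        using in_cutI[of z' z E Z'] z(2) Z'(2) by (simp add: insert_commute)
      have "cut E Z' \<inter> K \<noteq> {}" using z(4) Z' unfolding W_def by blast
      then have ne: "cut K Z' \<noteq> {}" using bad by blast
      have zA: "z \<in> A" using Z ZM(1) by blast
      have "cut K Z' \<subseteq> insert {x', x''} (cut E Z' - {{z, z'}, f})" and "card (insert {x', x''} (cut E Z' - {{z, z'}, f})) \<le> 2"
        if f: "f \<in> cut E Z'" "f \<notin> K" "f \<noteq> {z, z'}" for f
      proof -
        show "cut K Z' \<subseteq> insert {x', x''} (cut E Z' - {{z, z'}, f})"
          by (rule cutK') (use f zK in auto)
        have "card (cut E Z' - {{z, z'}, f}) = 1"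
          using f zc ZM(2)[OF Z'(1)] by (simp add: card_Diff_subset)
        then show "card (insert {x', x''} (cut E Z' - {{z, z'}, f})) \<le> 2"
          using fZ by (simp add: card_insert_if)
      qed
      then have nof: "f \<in> K \<or> f = {z, z'}" if "f \<in> cut E Z'" for f
        using small ne fZ that by (metis finite_Diff finite_insert)
      have "x' \<notin> Z'"
      proof
        assume "x' \<in> Z'"
        then have "{x', y'} = {z, z'}" using nof[OF inZ[OF Z'(1) _ es(2) x(5)]] out[OF x(5)] by blast
        then show False using x(5) zA z(3) by (auto simp: doubleton_eq_iff)
      qed
      moreover have "x'' \<notin> Z'"
      proof
        assume "x'' \<in> Z'"
        then have "{x'', y''} = {z, z'}" using nof[OF inZ[OF Z'(1) _ es(3) x(6)]] out[OF x(6)] by blast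
        then show False using x(6) zA z(3) by (auto simp: doubleton_eq_iff)
      qed
      ultimately have "cut K Z' \<subseteq> cut E Z' - {{z, z'}}"
        by (intro cutK) (use zK in auto)
      moreover have "card (cut E Z' - {{z, z'}}) \<le> 2" using zc ZM(2)[OF Z'(1)] by simp
      ultimately show False using small ne fZ by blast
    qed
    have WA: "W \<subseteq> A" unfolding W_def using ZM(1) by blast
    have "between E (W - {v}) (V - {v} - W) \<subseteq> {{x, y}}"
    proof
      fix e assume "e \<in> between E (W - {v}) (V - {v} - W)"
      then obtain a b where e: "e \<in> E" "e = {a, b}" "a \<in> W" "a \<noteq> v" "b \<in> V" "b \<noteq> v" "b \<notin> W"
        unfolding between_def by blast
      have bA: "b \<notin> A" using closed[of a b] e by auto
      have aA: "a \<in> A" using e(3) WA by (rule subsetD[rotated])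
      have "e \<in> cut E A" using e(1,2) aA bA in_cutI[of a b E A] by simp
      then have "{a, b} = {x, y} \<or> {a, b} = {x', y'} \<or> {a, b} = {x'', y''}" using cutA' e(2) by simp
      moreover have "a \<noteq> x'" "a \<noteq> x''" "a \<noteq> y'" "a \<noteq> y''" using e(3) x'W aA x(5,6) by metis+
      ultimately show "e \<in> {{x, y}}" using e(2) by (auto simp: doubleton_eq_iff)
    qed
    then have "card (between E (W - {v}) (V - {v} - W)) \<le> 1" using card_mono[of "{{x, y}}"] by fastforce
    moreover have "x \<in> W - {v}" using xW x(8) by blast
    moreover have "y \<in> V - {v} - W" using yV x(4) v(1) WA by blast
    ultimately have "separation E v (W - {v}) (V - {v} - W)"
      unfolding separation_def V_def[symmetric] using v(1) AV(1) WA by blast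
    then show False using nosep by blast
  qed
  \<comment> \<open>At most one of the three distinct ends is \<open>v\<close>, so \<open>x1\<close>
    or \<open>x2\<close> can play the part of \<open>x\<close>.\<close>
  show False
  proof (cases "x1 = v")
    case False
    show False
      by (rule main[OF cutA dist xA yA xne(3) False]) (use mono in blast)
  next
    case True
    have "cut E A = {{x2, y2}, {x1, y1}, {x3, y3}}" using cutA by blast
    moreover have "distinct [{x2, y2}, {x1, y1}, {x3, y3}]" using dist by auto
    moreover have "x2 \<noteq> v" using True xne by blast
    ultimately show False
      using main[of x2 y2 x1 y1 x3 y3] xA yA xne mono by metis
  qed
qed

text \<open>The monochromatic side must be a single vertex. It may be either side of the cut, hence
  the two outcomes.\<close>

lemma cut_trivial:
  assumes "card (cut E S) = 3"
  obtains x where "\<Union>E \<inter> S = {x}" | x where "\<Union>E - S = {x}"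
proof (rule ccontr)
  note res = that
  assume n: "\<not> thesis"
  obtain T a1 b1 a2 b2 a3 b3 where T: "T = S \<or> T = - S"
    "cut E T = {{a1, b1}, {a2, b2}, {a3, b3}}" "distinct [{a1, b1}, {a2, b2}, {a3, b3}]"
    "a1 \<in> T" "a2 \<in> T" "a3 \<in> T" "b1 \<notin> T" "b2 \<notin> T" "b3 \<notin> T"
    "\<forall>c. proper (induced E T) c \<longrightarrow> c a1 = c a2 \<and> c a2 = c a3"
    by (rule critical_cut_monochromatic[OF crit assms])
  have es: "{a1, b1} \<in> E" "{a2, b2} \<in> E" "{a3, b3} \<in> E" using T(2) unfolding between_def by blast+
  show False
  proof (rule no_monochromatic_cut[of "\<Union>E \<inter> T" a1 b1 a2 b2 a3 b3])
    show "cut E (\<Union>E \<inter> T) = {{a1, b1}, {a2, b2}, {a3, b3}}" using T(2) cut_Int[of E "\<Union>E" T] by simp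
    have "induced E (\<Union>E \<inter> T) = induced E T" unfolding induced_def by blast
    then show "c a1 = c a2 \<and> c a2 = c a3" if "proper (induced E (\<Union>E \<inter> T)) c" for c
      using that T(10) by simp
    show "\<Union>E \<inter> T \<noteq> {x}" for x
    proof
      assume x: "\<Union>E \<inter> T = {x}"
      show False using T(1)
      proof
        assume "T = S"
        then show False using x n res(1)[of x] by simp
      next
        assume "T = - S"
        then show False using x n res(2)[of x] by (simp add: Diff_eq)
      qed
    qed
    show "\<Union>E \<inter> T \<noteq> \<Union>E" using es T(7) by blast
    show "a1 \<in> \<Union>E \<inter> T" "a2 \<in> \<Union>E \<inter> T" "a3 \<in> \<Union>E \<inter> T" using es T(4-6) by blast+
  qed (use T(3,7-9) in simp_all)
qed

end

section \<open>Odd wheels\<close>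

definition nbrs :: "'a set set \<Rightarrow> 'a \<Rightarrow> 'a set" where
  "nbrs E x = {y. {x, y} \<in> E}"

lemma nbrs_sym: "y \<in> nbrs E x \<longleftrightarrow> x \<in> nbrs E y"
  unfolding nbrs_def by (simp add: insert_commute)

lemma nbrs_subset: "nbrs E x \<subseteq> \<Union>E"
  unfolding nbrs_def by auto

lemma nbrs_irrefl: "doubletons E \<Longrightarrow> x \<notin> nbrs E x"
  unfolding nbrs_def using doubletons_neq[of E x x] by auto

lemma finite_nbrs: "doubletons E \<Longrightarrow> finite (nbrs E x)"
  using doubletons_finite_Union[of E] nbrs_subset[of E x] finite_subset by metis

lemma card_nbrs:
  assumes "doubletons E"
  shows "card (cut E {x}) = card (nbrs E x)"
proof -
  have "cut E {x} = (\<lambda>y. {x, y}) ` nbrs E x"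
    using doubletons_neq[OF assms, of x] unfolding between_def nbrs_def by auto
  moreover have "inj_on (\<lambda>y. {x, y}) (nbrs E x)"
    by (auto simp: inj_on_def doubleton_eq_iff)
  ultimately show ?thesis by (simp add: card_image)
qed

text \<open>One greedy step: \<open>R\<close> is what remains uncoloured after \<open>w\<close>, so
  only the neighbours of \<open>w\<close> outside \<open>R\<close> restrict its colour, and a third
  colour is free.\<close>

lemma proper_extend:
  assumes dE: "doubletons E" and c: "proper (induced E (- insert w R)) c"
    and card: "card (c ` (nbrs E w - R)) \<le> 2"
  obtains k where "proper (induced E (- R)) (c(w := k))"
proof -
  have "\<not> {..<3} \<subseteq> c ` (nbrs E w - R)"
  proof
    assume "{..<3::nat} \<subseteq> c ` (nbrs E w - R)"
    then have "card {..<3::nat} \<le> card (c ` (nbrs E w - R))"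
      by (rule card_mono[rotated]) (simp add: finite_nbrs[OF dE])
    then show False using card by simp
  qed
  then obtain k where k: "k < 3" "k \<notin> c ` (nbrs E w - R)" by auto
  have kn: "c z \<noteq> k" if "{w, z} \<in> E" "z \<notin> R" for z
    using k(2) that unfolding nbrs_def by auto
  have "proper (induced E (- R)) (c(w := k))"
    unfolding proper_def
  proof (intro conjI allI impI)
    show "(c(w := k)) x < 3" for x using c k(1) unfolding proper_def by simp
    fix x y assume "{x, y} \<in> induced E (- R)"
    then have e: "{x, y} \<in> E" "x \<notin> R" "y \<notin> R" unfolding induced_def by auto
    then have ne: "x \<noteq> y" using doubletons_neq[OF dE] by blast
    show "(c(w := k)) x \<noteq> (c(w := k)) y"
    proof (cases "x = w \<or> y = w")
      case True
      then show ?thesis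
      proof
        assume "x = w"
        then show ?thesis using kn[of y] e ne by auto
      next
        assume "y = w"
        then have "{w, x} \<in> E" using e(1) by (simp add: insert_commute)
        then show ?thesis using kn[of x] e(2) ne \<open>y = w\<close> by auto
      qed
    next
      case False
      then have "{x, y} \<in> induced E (- insert w R)" using e unfolding induced_def by auto
      then show ?thesis using c False unfolding proper_def by simp
    qed
  qed
  then show ?thesis by (rule that)
qed

section \<open>Paths and cycles described by indices\<close>

lemma path_edges_nth: "path_edges xs = {{xs ! i, xs ! Suc i} | i. Suc i < length xs}"
proof (induction xs rule: induct_list012)
  case (3 x y zs)
  have "{{(x # y # zs) ! i, (x # y # zs) ! Suc i} | i. Suc i < length (x # y # zs)} =
      insert {x, y} {{(y # zs) ! i, (y # zs) ! Suc i} | i. Suc i < length (y # zs)}" (is "?L = ?R")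
  proof
    show "?L \<subseteq> ?R"
    proof
      fix e assume "e \<in> ?L"
      then obtain i where i: "e = {(x # y # zs) ! i, (x # y # zs) ! Suc i}" "Suc i < length (x # y # zs)" by auto
      then show "e \<in> ?R" by (cases i) auto
    qed
    show "?R \<subseteq> ?L"
    proof
      fix e assume "e \<in> ?R"
      then consider "e = {x, y}" | i where "e = {(y # zs) ! i, (y # zs) ! Suc i}" "Suc i < length (y # zs)" by auto
      then show "e \<in> ?L"
      proof cases
        case 1 then show ?thesis by (intro CollectI exI[of _ 0]) simp
      next
        case 2 then show ?thesis by (intro CollectI exI[of _ "Suc i"]) simp
      qed
    qed
  qed
  then show ?case using 3 by simp
qed auto

lemma cycle_edges_nth:
  assumes "length xs \<ge> 3"
  shows "insert {last xs, hd xs} (path_edges xs) = {{xs ! i, xs ! (Suc i mod length xs)} | i. i < length xs}"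
    (is "?L = ?R")
proof
  have ne: "xs \<noteq> []" using assms by auto
  have lh: "last xs = xs ! (length xs - 1)" "hd xs = xs ! 0"
    using ne by (simp_all add: last_conv_nth hd_conv_nth)
  show "?L \<subseteq> ?R"
  proof
    fix e assume "e \<in> ?L"
    then consider "e = {last xs, hd xs}" | i where "e = {xs ! i, xs ! Suc i}" "Suc i < length xs"
      unfolding path_edges_nth by blast
    then show "e \<in> ?R"
    proof cases
      case 1
      have "Suc (length xs - 1) = length xs" using assms by simp
      then have "Suc (length xs - 1) mod length xs = 0" by (metis mod_self)
      then have "e = {xs ! (length xs - 1), xs ! (Suc (length xs - 1) mod length xs)}"
        using 1 lh by (simp only:)
      moreover have "length xs - 1 < length xs" using assms by simp
      ultimately show ?thesis by blast
    next
      case 2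
      then show ?thesis by (intro CollectI exI[of _ i]) simp
    qed
  qed
  show "?R \<subseteq> ?L"
  proof
    fix e assume "e \<in> ?R"
    then obtain i where i: "e = {xs ! i, xs ! (Suc i mod length xs)}" "i < length xs" by blast
    show "e \<in> ?L"
    proof (cases "Suc i = length xs")
      case True
      then have "i = length xs - 1" by simp
      then show ?thesis using i True lh by simp
    next
      case False
      then have "Suc i < length xs" using i by simp
      then show ?thesis using i unfolding path_edges_nth by auto
    qed
  qed
qed

context no_separation
begin

text \<open>Two vertices are separated by a three-edge cut, and this cut isolates one of them. So at
  most one vertex has a degree other than three.\<close>

lemma degree_3:
  assumes ne: "E \<noteq> {}"
  obtains h where "h \<in> \<Union>E" "\<And>x. x \<in> \<Union>E \<Longrightarrow> x \<noteq> h \<Longrightarrow> card (nbrs E x) = 3"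
proof -
  have "\<exists>h\<in>\<Union>E. \<forall>x\<in>\<Union>E. x \<noteq> h \<longrightarrow> card (nbrs E x) = 3"
  proof (rule ccontr)
    assume n: "\<not> ?thesis"
    obtain e where e: "e \<in> E" using ne by blast
    then have "e \<noteq> {}" using dE unfolding doubletons_def by auto
    then obtain h0 where "h0 \<in> \<Union>E" using e by blast
    then obtain h where h: "h \<in> \<Union>E" "card (nbrs E h) \<noteq> 3" using n by meson
    then obtain x where x: "x \<in> \<Union>E" "h \<noteq> x" "card (nbrs E x) \<noteq> 3" using n by metis
    obtain S where S: "h \<in> S" "x \<notin> S" "card (cut E S) \<le> 3"
      using s3 h(1) x(1,2) unfolding separable3_def by meson
    then have cS: "card (cut E S) = 3" using critical_cut_ge_3[OF crit h(1) S(1) x(1) S(2)] by simp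
    from cut_trivial[OF cS] show False
    proof cases
      case (1 z)
      then have "z = h" using h(1) S(1) by auto
      then have "card (cut E {h}) = 3" using cS cut_Int[of E "\<Union>E" S] 1 by simp
      then show False using h(2) card_nbrs[OF dE] by simp
    next
      case (2 z)
      then have "z = x" using x(1) S(2) by auto
      then have "card (cut E {x}) = 3" using cS cut_Diff[of E "\<Union>E" S] 2 by simp
      then show False using x(3) card_nbrs[OF dE] by simp
    qed
  qed
  then show ?thesis using that by blast
qed

text \<open>Gallai's argument: if \<open>x\<close> sees \<open>h\<close> and its neighbour \<open>y\<close> does not, give \<open>h\<close> and
  \<open>y\<close> the same colour and colour the other vertices greedily towards \<open>x\<close>. Below, \<open>R\<close> is the
  set of vertices that are still to be coloured.\<close>

lemma all_adjacent_to_hub_step: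
  assumes h: "h \<in> \<Union>E" and deg: "\<And>x. x \<in> \<Union>E \<Longrightarrow> x \<noteq> h \<Longrightarrow> card (nbrs E x) = 3"
    and x: "x \<in> nbrs E h" and y: "y \<in> nbrs E x" "y \<noteq> h" "y \<notin> nbrs E h"
  shows False
proof -
  define U where "U = \<Union>E - {h, y}"
  have xV: "x \<in> \<Union>E" "y \<in> \<Union>E" using x y nbrs_subset[of E h] nbrs_subset[of E x] by blast+
  have xh: "x \<noteq> h" using x nbrs_irrefl[OF dE] by metis
  have xy: "x \<noteq> y" using y(1) nbrs_irrefl[OF dE] by metis
  have xU: "x \<in> U" unfolding U_def using xV xh xy by simp
  \<comment> \<open>For a good \<open>R\<close>, the vertices outside \<open>R\<close> already
    forbid a common colour of \<open>h\<close> and \<open>y\<close>. Goodness spreads from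
    \<open>{x}\<close> against the greedy order.\<close>
  define good where "good R \<longleftrightarrow> (\<forall>c. proper (induced E (- R)) c \<longrightarrow> c h \<noteq> c y)" for R
  have good_x: "good {x}"
    unfolding good_def
  proof (intro allI impI notI)
    fix c assume c: "proper (induced E (- {x})) c" and eq: "c h = c y"
    have "h \<in> nbrs E x" using x nbrs_sym[of h E x] by simp
    then have "c ` nbrs E x = c ` (nbrs E x - {h})" using y(1,2) eq by (auto simp: image_iff)
    then have "card (c ` nbrs E x) \<le> card (nbrs E x - {h})"
      using card_image_le[of "nbrs E x - {h}" c] finite_nbrs[OF dE] by simp
    also have "\<dots> = 2" using deg[OF xV(1) xh] \<open>h \<in> nbrs E x\<close> by simp
    finally obtain k where "proper (induced E (- {})) (c(x := k))"
      using proper_extend[OF dE, of x "{}" c] c by auto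
    moreover have "induced E (- {}) = E" unfolding induced_def by auto
    ultimately show False using crit unfolding critical_def colourable3_def by auto
  qed
  have good_step: "good (insert w R)" if R: "good R" "w \<notin> R" "w \<in> U" "r \<in> R" "r \<in> nbrs E w" for w R r
    unfolding good_def
  proof (intro allI impI notI)
    fix c assume c: "proper (induced E (- insert w R)) c" and eq: "c h = c y"
    have w: "w \<in> \<Union>E" "w \<noteq> h" "w \<noteq> y" using R(3) unfolding U_def by auto
    have "card (c ` (nbrs E w - R)) \<le> card (nbrs E w - R)"
      by (rule card_image_le) (simp add: finite_nbrs[OF dE])
    also have "\<dots> \<le> card (nbrs E w - {r})"
      by (rule card_mono) (use R(4) finite_nbrs[OF dE] in auto)
    also have "\<dots> = 2" using deg[OF w(1,2)] R(5) by simp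
    finally obtain k where "proper (induced E (- R)) (c(w := k))"
      using proper_extend[OF dE c] by blast
    then have "(c(w := k)) h \<noteq> (c(w := k)) y" using R(1) unfolding good_def by blast
    then show False using eq w by simp
  qed
  have finU: "finite U" unfolding U_def using doubletons_finite_Union[OF dE] by simp
  \<comment> \<open>A maximal good set replaces an explicit colouring order. It is closed under
    neighbours in \<open>U\<close>, because a vertex with a neighbour still uncoloured sees at most
    two colours.\<close>
  define G where "G = {R. R \<subseteq> U \<and> x \<in> R \<and> good R}"
  have "finite G" unfolding G_def using finU by simp
  moreover have "{x} \<in> G" unfolding G_def using xU good_x by simp
  ultimately obtain R where R: "R \<in> G" "\<And>R'. R' \<in> G \<Longrightarrow> R \<subseteq> R' \<Longrightarrow> R = R'"
    using finite_has_maximal[of G] by auto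
  have R': "R \<subseteq> U" "x \<in> R" "good R" using R(1) unfolding G_def by blast+
  have noedge: "w \<notin> nbrs E r" if "r \<in> R" "w \<in> U - R" for r w
  proof
    assume "w \<in> nbrs E r"
    then have "r \<in> nbrs E w" using nbrs_sym[of w E r] by simp
    then have "good (insert w R)" using good_step[OF R'(3), of w r] that by blast
    then have "insert w R \<in> G" unfolding G_def using R' that by blast
    then have "R = insert w R" using R(2) by blast
    then show False using that by blast
  qed
  have hy: "{h, y} \<notin> E" using y(3) unfolding nbrs_def by simp
  \<comment> \<open>Outside \<open>U\<close> only the nonadjacent vertices \<open>h\<close> and
    \<open>y\<close> remain, and they may share a colour.\<close>
  have "R \<noteq> U"
  proof
    assume "R = U"
    have "proper (induced E (- U)) (\<lambda>_. 0)"
      unfolding proper_def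
    proof (intro conjI allI impI)
      fix a b assume "{a, b} \<in> induced E (- U)"
      then have e: "{a, b} \<in> E" "a \<notin> U" "b \<notin> U" unfolding induced_def by auto
      then have "a \<in> \<Union>E" "b \<in> \<Union>E" by auto
      then have "a = h \<or> a = y" "b = h \<or> b = y" using e unfolding U_def by auto
      moreover have "a \<noteq> b" using doubletons_neq[OF dE e(1)] .
      moreover have "{y, h} \<notin> E" using hy by (simp add: insert_commute)
      ultimately show "(0::nat) \<noteq> 0" using e(1) hy by auto
    qed simp
    then show False using R'(3) \<open>R = U\<close> unfolding good_def by blast
  qed
  then have UR: "U - R \<noteq> {}" using R'(1) by blast
  have main: False if PQ: "P \<noteq> {}" "Q \<noteq> {}" "P \<inter> Q = {}" "P \<union> Q = U"
      and ne: "\<And>p q. p \<in> P \<Longrightarrow> q \<in> Q \<Longrightarrow> q \<notin> nbrs E p" and c: "card (nbrs E y \<inter> Q) \<le> 1" for P Q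
  proof -
    have "between E (insert y P) Q \<subseteq> (\<lambda>q. {y, q}) ` (nbrs E y \<inter> Q)"
    proof
      fix e assume "e \<in> between E (insert y P) Q"
      then obtain a b where e: "e \<in> E" "e = {a, b}" "a \<in> insert y P" "b \<in> Q" unfolding between_def by blast
      then have "b \<in> nbrs E a" unfolding nbrs_def by simp
      then have "a = y" using ne[of a b] e(3,4) by blast
      then show "e \<in> (\<lambda>q. {y, q}) ` (nbrs E y \<inter> Q)" using e \<open>b \<in> nbrs E a\<close> by blast
    qed
    then have "card (between E (insert y P) Q) \<le> card ((\<lambda>q. {y, q}) ` (nbrs E y \<inter> Q))"
      by (rule card_mono[rotated]) (simp add: finite_nbrs[OF dE])
    also have "\<dots> \<le> card (nbrs E y \<inter> Q)" by (rule card_image_le) (simp add: finite_nbrs[OF dE])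
    finally have "card (between E (insert y P) Q) \<le> 1" using c by simp
    moreover have "y \<notin> U" unfolding U_def by simp
    moreover have "insert y (P \<union> Q) = \<Union>E - {h}" using PQ(4) xV(2) y(2) unfolding U_def by auto
    ultimately have "separation E h (insert y P) Q"
      unfolding separation_def using h PQ by auto
    then show False using nosep by blast
  qed
  \<comment> \<open>As \<open>y\<close> has degree three, it sends at most one edge to
    \<open>R\<close> or at most one to \<open>U - R\<close>. Placed with the other part, it yields a
    separation at \<open>h\<close>.\<close>
  have "card (nbrs E y \<inter> R) + card (nbrs E y \<inter> (U - R)) = card (nbrs E y \<inter> R \<union> nbrs E y \<inter> (U - R))"
    by (rule card_Un_disjoint[symmetric]) (auto simp: finite_nbrs[OF dE])
  also have "\<dots> \<le> card (nbrs E y)"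
    by (rule card_mono[OF finite_nbrs[OF dE]]) auto
  also have "\<dots> = 3" using deg[OF xV(2) y(2)] .
  finally have "card (nbrs E y \<inter> R) \<le> 1 \<or> card (nbrs E y \<inter> (U - R)) \<le> 1" by linarith
  then show False
  proof
    assume "card (nbrs E y \<inter> (U - R)) \<le> 1"
    then show False using main[of R "U - R"] R' UR noedge by blast
  next
    assume "card (nbrs E y \<inter> R) \<le> 1"
    moreover have "q \<notin> nbrs E p" if "p \<in> U - R" "q \<in> R" for p q
      using noedge[OF that(2,1)] nbrs_sym[of q E p] by simp
    ultimately show False using main[of "U - R" R] R' UR by blast
  qed
qed

text \<open>By the previous lemma no edge leads from the neighbours of \<open>h\<close> to a further
  vertex, so a further vertex would make \<open>h\<close> a cut-vertex. The rim is then
  2-regular.\<close>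

lemma hub_exists:
  assumes "E \<noteq> {}"
  obtains h where "h \<in> \<Union>E" "nbrs E h = \<Union>E - {h}"
    "\<And>x. x \<in> \<Union>E \<Longrightarrow> x \<noteq> h \<Longrightarrow> card (nbrs E x - {h}) = 2"
proof -
  obtain h where h: "h \<in> \<Union>E" and deg: "\<And>x. x \<in> \<Union>E \<Longrightarrow> x \<noteq> h \<Longrightarrow> card (nbrs E x) = 3"
    by (rule degree_3[OF assms]) blast
  have sub: "nbrs E h \<subseteq> \<Union>E - {h}" using nbrs_subset[of E h] nbrs_irrefl[OF dE, of h] by blast
  have ne: "nbrs E h \<noteq> {}"
  proof -
    obtain e where e: "e \<in> E" "h \<in> e" using h by blast
    then obtain a b where "e = {a, b}" using doubletonsE[OF dE] by metis
    then have "a \<in> nbrs E h \<or> b \<in> nbrs E h" using e unfolding nbrs_def by (auto simp: insert_commute)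
    then show ?thesis by blast
  qed
  have eq: "nbrs E h = \<Union>E - {h}"
  proof (rule ccontr)
    assume n: "nbrs E h \<noteq> \<Union>E - {h}"
    have "between E (nbrs E h) (\<Union>E - {h} - nbrs E h) = {}"
    proof (rule ccontr)
      assume "between E (nbrs E h) (\<Union>E - {h} - nbrs E h) \<noteq> {}"
      then obtain a b where ab: "{a, b} \<in> E" "a \<in> nbrs E h" "b \<noteq> h" "b \<notin> nbrs E h"
        unfolding between_def by auto
      then have "b \<in> nbrs E a" unfolding nbrs_def by simp
      then show False using all_adjacent_to_hub_step[OF h deg ab(2) _ ab(3,4)] by blast
    qed
    then have "separation E h (nbrs E h) (\<Union>E - {h} - nbrs E h)"
      unfolding separation_def using h ne n sub by auto
    then show False using nosep by blast
  qed
  have "card (nbrs E x - {h}) = 2" if "x \<in> \<Union>E" "x \<noteq> h" for x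
  proof -
    have "h \<in> nbrs E x" using eq that nbrs_sym[of h E x] by simp
    then show ?thesis using deg[OF that] by simp
  qed
  then show ?thesis using that h eq by blast
qed

text \<open>The rim is 2-regular, so a longest path in it closes up to a cycle. Without a separation
  this cycle is the whole rim, and an even rim would leave the graph 3-colourable.\<close>

lemma odd_wheel:
  assumes Ene: "E \<noteq> {}"
  shows "odd_wheel (SGraph (\<Union>E) E)"
proof -
  define V where "V = \<Union>E"
  obtain h where h: "h \<in> V" "nbrs E h = V - {h}" and deg: "\<And>x. x \<in> V \<Longrightarrow> x \<noteq> h \<Longrightarrow> card (nbrs E x - {h}) = 2"
    using hub_exists[OF Ene] unfolding V_def by metis
  define N where "N x = nbrs E x - {h}" for x
  have finV: "finite V" unfolding V_def by (rule doubletons_finite_Union[OF dE])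
  have N2: "card (N x) = 2" if "x \<in> V - {h}" for x using deg that unfolding N_def by blast
  have NV: "N x \<subseteq> V - {h}" for x using nbrs_subset[of E x] unfolding N_def V_def by auto
  have Nsym: "y \<in> N x" if "x \<in> N y" "y \<noteq> h" for x y
    using that nbrs_sym[of x E y] unfolding N_def by simp
  have NE: "{x, y} \<in> E" if "y \<in> N x" for x y using that unfolding N_def nbrs_def by simp
  have Nirr: "x \<notin> N x" for x using nbrs_irrefl[OF dE] unfolding N_def by simp
  define good where "good p \<longleftrightarrow> p \<noteq> [] \<and> distinct p \<and> set p \<subseteq> V - {h} \<and> (\<forall>i. Suc i < length p \<longrightarrow> p ! Suc i \<in> N (p ! i))" for p
  have len: "length p \<le> card V" if "good p" for p
  proof -
    have "length p = card (set p)" using that distinct_card unfolding good_def by metis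
    also have "\<dots> \<le> card V" using that finV unfolding good_def by (intro card_mono) auto
    finally show ?thesis .
  qed
  have "V - {h} \<noteq> {}"
  proof
    assume "V - {h} = {}"
    then have "V \<subseteq> {h}" by auto
    moreover obtain e where "e \<in> E" using Ene by blast
    ultimately have "e \<subseteq> {h}" unfolding V_def by auto
    then have "card e \<le> card {h}" by (intro card_mono) auto
    then show False using dE \<open>e \<in> E\<close> unfolding doubletons_def by auto
  qed
  then obtain x0 where "x0 \<in> V - {h}" by blast
  then have "good [x0]" unfolding good_def by simp
  moreover have "\<forall>q. good q \<longrightarrow> length q < Suc (card V)" using len by (simp add: less_Suc_eq_le)
  ultimately have "\<exists>p. good p \<and> (\<forall>q. good q \<longrightarrow> length q \<le> length p)"
    by (rule ex_has_greatest_nat)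
  then obtain p where p: "good p" and pmax: "\<And>q. good q \<Longrightarrow> length q \<le> length p"
    by metis
  define n where "n = length p"
  have pd: "distinct p" "set p \<subseteq> V - {h}" "p \<noteq> []" and pN: "\<And>i. Suc i < n \<Longrightarrow> p ! Suc i \<in> N (p ! i)"
    using p unfolding good_def n_def by blast+
  have n0: "n > 0" using pd(3) unfolding n_def by simp
  have pV: "p ! i \<in> V - {h}" if "i < n" for i using pd(2) that nth_mem unfolding n_def by blast
  have pinj: "p ! i = p ! j \<longleftrightarrow> i = j" if "i < n" "j < n" for i j
    using nth_eq_iff_index_eq[OF pd(1)] that unfolding n_def by simp
  have pN': "p ! i \<in> N (p ! Suc i)" if "Suc i < n" for i
    using Nsym[OF pN[OF that]] pV[of i] that by simp
  \<comment> \<open>Otherwise the longest path could be prolonged.\<close>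
  have last: "N (p ! (n - 1)) \<subseteq> set p"
  proof (rule ccontr)
    assume "\<not> ?thesis"
    then obtain z where z: "z \<in> N (p ! (n - 1))" "z \<notin> set p" by blast
    have "good (p @ [z])"
      unfolding good_def
    proof (intro conjI allI impI)
      show "set (p @ [z]) \<subseteq> V - {h}" using pd(2) z(1) NV by auto
      fix i assume i: "Suc i < length (p @ [z])"
      show "(p @ [z]) ! Suc i \<in> N ((p @ [z]) ! i)"
      proof (cases "Suc i < n")
        case True
        then show ?thesis using pN[OF True] unfolding n_def by (simp add: nth_append)
      next
        case False
        then have "i = n - 1" "n = Suc i" using i unfolding n_def by auto
        then show ?thesis using z(1) unfolding n_def by (simp add: nth_append)
      qed
    qed (use pd z in auto)
    then show False using pmax[of "p @ [z]"] by simp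
  qed
  obtain a b where ab: "N (p ! (n - 1)) = {a, b}" "a \<noteq> b"
    using N2[OF pV[of "n - 1"]] n0 by (auto simp: card_2_iff)
  obtain i j where ij: "p ! i = a" "p ! j = b" "i < n" "j < n"
    using last ab(1) unfolding n_def by (metis in_set_conv_nth insert_subset)
  have nbr_idx: "k = i \<or> k = j" if "p ! k \<in> N (p ! (n - 1))" "k < n" for k
    using that ab(1) ij pinj by auto
  have inN: "p ! i \<in> N (p ! (n - 1))" "p ! j \<in> N (p ! (n - 1))" using ij ab(1) by auto
  have ineq: "i \<noteq> n - 1" "j \<noteq> n - 1" "i \<noteq> j" using inN Nirr ij ab(2) by metis+
  have n3: "n \<ge> 3" using ineq ij by linarith
  have "n - 2 = i \<or> n - 2 = j"
  proof (rule nbr_idx)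
    show "p ! (n - 2) \<in> N (p ! (n - 1))" using pN'[of "n - 2"] n3 by (simp add: numeral_2_eq_2 Suc_diff_Suc)
  qed (use n3 in simp)
  \<comment> \<open>One of the two rim neighbours of the last vertex is its predecessor, at index
    \<open>n - 2\<close>; the other one lies further back.\<close>
  then have "\<exists>k<n - 2. p ! k \<in> N (p ! (n - 1))"
  proof
    assume "n - 2 = i"
    then have "j < n - 2" using ineq ij(4) by linarith
    then show ?thesis using inN(2) by blast
  next
    assume "n - 2 = j"
    then have "i < n - 2" using ineq ij(3) by linarith
    then show ?thesis using inN(1) by blast
  qed
  then obtain k where k: "k < n - 2" "p ! k \<in> N (p ! (n - 1))" by blast
  \<comment> \<open>An inner vertex of the path already has two path neighbours, and the last vertex
    would be a third one; \<open>k < n - 2\<close> makes it differ from the successor.\<close>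
  have "k = 0"
  proof (rule ccontr)
    assume k0: "k \<noteq> 0"
    have kn: "k < n" using k n3 by simp
    have "p ! (n - 1) \<in> N (p ! k)" using Nsym[OF k(2)] pV[of "n - 1"] n0 by simp
    moreover have "p ! Suc k \<in> N (p ! k)" using pN[of k] k(1) by simp
    moreover have "p ! (k - 1) \<in> N (p ! k)" using pN'[of "k - 1"] k0 kn by simp
    ultimately have "{p ! (n - 1), p ! Suc k, p ! (k - 1)} \<subseteq> N (p ! k)" by simp
    then have "card {p ! (n - 1), p ! Suc k, p ! (k - 1)} \<le> 2"
      using N2[OF pV[OF kn]] card_mono[of "N (p ! k)"] card.infinite by (metis zero_neq_numeral)
    moreover have "card {p ! (n - 1), p ! Suc k, p ! (k - 1)} = 3"
    proof -
      have "n - 1 < n" "Suc k < n" "k - 1 < n" "n - 1 \<noteq> Suc k" "n - 1 \<noteq> k - 1" "Suc k \<noteq> k - 1"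
        using k(1) kn k0 by linarith+
      then have "p ! (n - 1) \<noteq> p ! Suc k" "p ! (n - 1) \<noteq> p ! (k - 1)" "p ! Suc k \<noteq> p ! (k - 1)"
        using pinj by blast+
      then show ?thesis by simp
    qed
    ultimately show False by simp
  qed
  then have close: "p ! 0 \<in> N (p ! (n - 1))" using k(2) by simp
  \<comment> \<open>Successor and predecessor around the closed cycle; they differ because
    \<open>n \<ge> 3\<close>, so they are all rim neighbours.\<close>
  define s where "s i = Suc i mod n" for i
  define r where "r i = (if i = 0 then n - 1 else i - 1)" for i
  have sN: "p ! s i \<in> N (p ! i)" if "i < n" for i
  proof (cases "Suc i < n")
    case True then show ?thesis using pN[of i] unfolding s_def by simp
  next
    case False
    then have "i = n - 1" "Suc i = n" using that by auto
    then show ?thesis using close unfolding s_def by simp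
  qed
  have rN: "p ! r i \<in> N (p ! i)" if "i < n" for i
  proof (cases "i = 0")
    case True
    then show ?thesis using Nsym[OF close] pV[of "n - 1"] n0 unfolding r_def by simp
  next
    case False
    then show ?thesis using pN'[of "i - 1"] that unfolding r_def by simp
  qed
  have sr: "s (r i) = i" "r i < n" "s i < n" "s i \<noteq> r i" if "i < n" for i
  proof -
    show "s (r i) = i" "r i < n" "s i < n" using that n3 unfolding s_def r_def by auto
    show "s i \<noteq> r i"
    proof (cases "Suc i < n")
      case True then show ?thesis using n3 unfolding s_def r_def by auto
    next
      case False
      then have "Suc i = n" using that by simp
      then show ?thesis using n3 unfolding s_def r_def by auto
    qed
  qed
  have Neq: "N (p ! i) = {p ! s i, p ! r i}" if "i < n" for i
  proof -
    have "card {p ! s i, p ! r i} = 2" using pinj[of "s i" "r i"] sr[OF that] by simp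
    moreover have "finite (N (p ! i))" using NV finV finite_subset by (metis finite_Diff)
    ultimately show ?thesis
      using card_subset_eq[of "N (p ! i)" "{p ! s i, p ! r i}"] sN[OF that] rN[OF that] N2[OF pV[OF that]] by auto
  qed
  \<comment> \<open>A missed vertex would lie beyond \<open>h\<close> only, giving a separation
    without any crossing edge.\<close>
  have all: "set p = V - {h}"
  proof (rule ccontr)
    assume ne: "set p \<noteq> V - {h}"
    have "between E (set p) (V - {h} - set p) = {}"
    proof (rule ccontr)
      assume "between E (set p) (V - {h} - set p) \<noteq> {}"
      then obtain a b where e: "{a, b} \<in> E" "a \<in> set p" "b \<noteq> h" "b \<notin> set p"
        unfolding between_def by auto
      then obtain i where i: "i < n" "a = p ! i" unfolding n_def by (metis in_set_conv_nth)
      have "b \<in> N (p ! i)" using e i unfolding N_def nbrs_def by simp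
      then have "b = p ! s i \<or> b = p ! r i" using Neq[OF i(1)] by simp
      then show False using e(4) sr[OF i(1)] nth_mem unfolding n_def by metis
    qed
    then have "separation E h (set p) (V - {h} - set p)"
      unfolding separation_def V_def[symmetric] using h(1) pd ne by auto
    then show False using nosep by blast
  qed
  define C where "C = insert {last p, hd p} (path_edges p)"
  have C: "C = {{p ! i, p ! s i} | i. i < n}"
    unfolding C_def s_def n_def using cycle_edges_nth[of p] n3 unfolding n_def by simp
  have E_eq: "E = C \<union> {{h, x} | x. x \<in> set p}"
  proof
    show "C \<union> {{h, x} | x. x \<in> set p} \<subseteq> E"
    proof
      fix e assume "e \<in> C \<union> {{h, x} | x. x \<in> set p}"
      then consider i where "e = {p ! i, p ! s i}" "i < n" | x where "e = {h, x}" "x \<in> set p"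
        unfolding C by blast
      then show "e \<in> E"
      proof cases
        case 1 then show ?thesis using NE[OF sN] by simp
      next
        case 2
        then have "x \<in> nbrs E h" using h(2) all by simp
        then show ?thesis using 2 unfolding nbrs_def by simp
      qed
    qed
    show "E \<subseteq> C \<union> {{h, x} | x. x \<in> set p}"
    proof
      fix e assume e: "e \<in> E"
      then obtain a b where ab: "e = {a, b}" "a \<noteq> b" by (rule doubletonsE[OF dE])
      then have abV: "a \<in> V" "b \<in> V" using e unfolding V_def by auto
      consider "a = h" | "b = h" | "a \<noteq> h" "b \<noteq> h" by blast
      then show "e \<in> C \<union> {{h, x} | x. x \<in> set p}"
      proof cases
        case 1
        then have "b \<in> set p" using abV ab(2) all by simp
        then show ?thesis using ab(1) 1 by blast
      next
        case 2
        then have "a \<in> set p" using abV ab(2) all by simp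
        moreover have "e = {h, a}" using ab(1) 2 by (simp add: insert_commute)
        ultimately show ?thesis by blast
      next
        case 3
        then have "a \<in> set p" using abV all by simp
        then obtain i where i: "i < n" "a = p ! i" unfolding n_def by (metis in_set_conv_nth)
        have "b \<in> N (p ! i)" using 3 e ab(1) i(2) unfolding N_def nbrs_def by simp
        then have "b = p ! s i \<or> b = p ! r i" using Neq[OF i(1)] by simp
        then have "e \<in> C"
        proof
          assume "b = p ! s i"
          then show ?thesis unfolding C using i ab(1) by blast
        next
          assume b: "b = p ! r i"
          have "e = {p ! r i, p ! s (r i)}" using ab(1) i b sr(1)[OF i(1)] by (simp add: insert_commute)
          then show ?thesis unfolding C using sr(2)[OF i(1)] by blast
        qed
        then show ?thesis by blast
      qed
    qed
  qed
  have "odd n"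
  proof (rule ccontr)
    assume ev: "\<not> odd n"
    \<comment> \<open>An even rim is coloured by the parity of the position and the hub by 2;
      \<open>mod 2\<close> also keeps the bound off the graph, where \<open>idx\<close> is
      arbitrary.\<close>
    define idx where "idx = the_inv_into {..<n} (nth p)"
    have inj: "inj_on (nth p) {..<n}" using pinj by (auto simp: inj_on_def)
    have idx: "idx (p ! i) = i" if "i < n" for i
      unfolding idx_def using the_inv_into_f_f[OF inj] that by simp
    define c where "c z = (if z = h then 2 else idx z mod 2)" for z
    have ch: "c (p ! i) = i mod 2" if "i < n" for i
      using pV[OF that] idx[OF that] unfolding c_def by simp
    have less: "c z < 3" for z unfolding c_def by auto
    have "c a \<noteq> c b" if e: "{a, b} \<in> E" for a b
    proof -
      have "{a, b} \<in> C \<union> {{h, x} | x. x \<in> set p}" using e E_eq by metis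
      then consider i where "{a, b} = {p ! i, p ! s i}" "i < n" | x where "{a, b} = {h, x}" "x \<in> set p"
        unfolding C by blast
      then show ?thesis
      proof cases
        case (1 i)
        have "(Suc i mod n) mod 2 \<noteq> i mod 2"
        proof (cases "Suc i = n")
          case True
          then have "i mod 2 = 1" using ev by presburger
          moreover have "Suc i mod n = 0" using True by simp
          ultimately show ?thesis by simp
        next
          case False
          then show ?thesis using 1(2) by (simp add: mod_Suc)
        qed
        then have "c (p ! i) \<noteq> c (p ! s i)" using ch[OF 1(2)] ch[OF sr(3)[OF 1(2)]] unfolding s_def by simp
        then show ?thesis using 1(1) by (metis doubleton_eq_iff)
      next
        case (2 x)
        then have "x \<noteq> h" using pd(2) by blast
        then have "c x \<noteq> c h" unfolding c_def by simp
        then show ?thesis using 2(1) by (metis doubleton_eq_iff)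
      qed
    qed
    then have "proper E c" unfolding proper_def using less by blast
    then show False using crit unfolding critical_def colourable3_def by blast
  qed
  moreover define CG where "CG = SGraph (set p) C"
  moreover have "cycle_graph n CG"
    unfolding cycle_graph_def CG_def C_def using n3 pd(1) by (intro exI[of _ p]) (simp add: n_def)
  moreover have "\<Union>E = insert h (set p)" using all h(1) unfolding V_def by auto
  then have "SGraph (\<Union>E) E = SGraph (insert h (verts CG)) (edges CG \<union> {{h, x} | x. x \<in> verts CG})"
    using E_eq unfolding CG_def by simp
  moreover have "h \<notin> verts CG" unfolding CG_def using all by simp
  ultimately show ?thesis unfolding odd_wheel_def by blast
qed

end

section \<open>Critical graphs as Haj\'os joins of odd wheels\<close>

lemma path_edges_map: "path_edges (map f xs) = (\<lambda>e. f ` e) ` path_edges xs"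
  by (induction xs rule: induct_list012) auto

lemma odd_wheelE:
  assumes "odd_wheel W"
  obtains xs h where "length xs \<ge> 3" "odd (length xs)" "distinct xs" "h \<notin> set xs"
    "verts W = insert h (set xs)"
    "edges W = insert {last xs, hd xs} (path_edges xs) \<union> {{h, x} | x. x \<in> set xs}"
proof -
  obtain C n h where C: "cycle_graph n C" "odd n" "h \<notin> verts C"
    "W = SGraph (insert h (verts C)) (edges C \<union> {{h, x} | x. x \<in> verts C})"
    using assms unfolding odd_wheel_def by blast
  obtain xs where xs: "n \<ge> 3" "length xs = n" "distinct xs" "verts C = set xs"
    "edges C = insert {last xs, hd xs} (path_edges xs)"
    using C(1) unfolding cycle_graph_def by blast
  show ?thesis by (rule that[of xs h]) (use xs C in simp_all)
qed

lemma odd_wheelI: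
  assumes "length xs \<ge> 3" "odd (length xs)" "distinct xs" "h \<notin> set xs"
    "verts W = insert h (set xs)"
    "edges W = insert {last xs, hd xs} (path_edges xs) \<union> {{h, x} | x. x \<in> set xs}"
  shows "odd_wheel W"
proof -
  define C where "C = SGraph (set xs) (insert {last xs, hd xs} (path_edges xs))"
  have "cycle_graph (length xs) C" using assms(1,3) unfolding cycle_graph_def C_def by auto
  moreover have "W = SGraph (insert h (verts C)) (edges C \<union> {{h, x} | x. x \<in> verts C})"
    using assms(5,6) unfolding C_def by (cases W) simp
  moreover have "h \<notin> verts C" using assms(4) unfolding C_def by simp
  ultimately show ?thesis unfolding odd_wheel_def using assms(2) by blast
qed

lemma odd_wheel_image:
  assumes W: "odd_wheel W" and inj: "inj_on f (verts W)"
  shows "odd_wheel (SGraph (f ` verts W) ((`) f ` edges W))"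
proof -
  obtain xs h where xs: "length xs \<ge> 3" "odd (length xs)" "distinct xs" "h \<notin> set xs"
    "verts W = insert h (set xs)"
    "edges W = insert {last xs, hd xs} (path_edges xs) \<union> {{h, x} | x. x \<in> set xs}"
    using W by (rule odd_wheelE)
  have ne: "xs \<noteq> []" using xs(1) by auto
  show ?thesis
  proof (rule odd_wheelI[of "map f xs" "f h"])
    show "distinct (map f xs)" using xs(3,5) inj by (auto simp: distinct_map inj_on_def)
    show "f h \<notin> set (map f xs)" using xs(4,5) inj by (auto simp: inj_on_def)
    have "(`) f ` {{h, x} | x. x \<in> set xs} = {{f h, y} | y. y \<in> set (map f xs)}"
    proof -
      have "(`) f ` {{h, x} | x. x \<in> S} = {{f h, y} | y. y \<in> f ` S}" for S
      proof -
        have "{{h, x} | x. x \<in> S} = (\<lambda>x. {h, x}) ` S" "{{f h, y} | y. y \<in> f ` S} = (\<lambda>y. {f h, y}) ` f ` S"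
          by blast+
        then show ?thesis by (simp add: image_image)
      qed
      then show ?thesis by simp
    qed
    then show "edges (SGraph (f ` verts W) ((`) f ` edges W)) =
        insert {last (map f xs), hd (map f xs)} (path_edges (map f xs)) \<union> {{f h, x} | x. x \<in> set (map f xs)}"
      using ne by (simp add: xs(6) path_edges_map image_Un last_map hd_map)
  qed (use xs in auto)
qed

lemma odd_wheel_simple:
  assumes "odd_wheel W"
  shows "simple_graph W"
proof -
  obtain xs h where xs: "length xs \<ge> 3" "odd (length xs)" "distinct xs" "h \<notin> set xs"
    "verts W = insert h (set xs)"
    "edges W = insert {last xs, hd xs} (path_edges xs) \<union> {{h, x} | x. x \<in> set xs}"
    using assms by (rule odd_wheelE)
  have C: "insert {last xs, hd xs} (path_edges xs) = {{xs ! i, xs ! (Suc i mod length xs)} | i. i < length xs}"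
    by (rule cycle_edges_nth[OF xs(1)])
  show ?thesis
    unfolding simple_graph_def
  proof (intro conjI ballI)
    fix e assume "e \<in> edges W"
    then consider i where "e = {xs ! i, xs ! (Suc i mod length xs)}" "i < length xs" | x where "e = {h, x}" "x \<in> set xs"
      unfolding xs(6) C by blast
    then have "e \<subseteq> verts W \<and> card e = 2"
    proof cases
      case (1 i)
      have j: "Suc i mod length xs < length xs" "Suc i mod length xs \<noteq> i"
        using 1(2) xs(1) by (auto simp: mod_Suc)
      then have "xs ! i \<noteq> xs ! (Suc i mod length xs)" using nth_eq_iff_index_eq[OF xs(3) 1(2) j(1)] by simp
      then show ?thesis using 1 j xs(5) by simp
    next
      case (2 x)
      then have "h \<noteq> x" using xs(4) by blast
      then show ?thesis using 2 xs(5) by simp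
    qed
    then show "e \<subseteq> verts W" "card e = 2" by blast+
  qed (simp add: xs(5))
qed

lemma hajos_join_verts:
  "verts (hajos_join H (u1, v1) W (u2, v2)) = verts H \<union> (\<lambda>x. if x = u2 then u1 else x) ` verts W"
  unfolding hajos_join_def by (simp add: Let_def)

lemma hajos_join_edges:
  "edges (hajos_join H (u1, v1) W (u2, v2)) =
    (edges H - {{u1, v1}}) \<union> (\<lambda>e. (\<lambda>x. if x = u2 then u1 else x) ` e) ` (edges W - {{u2, v2}}) \<union> {{v1, v2}}"
  unfolding hajos_join_def by (simp add: Let_def)

lemma simple_graph_edge:
  assumes "simple_graph G" "{a, b} \<in> edges G"
  shows "a \<in> verts G" "b \<in> verts G" "a \<noteq> b"
  using assms doubletons_neq[OF simple_graph_doubletons] unfolding simple_graph_def by auto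

lemma hajos_wheel_sequence_simple: "hajos_wheel_sequence H \<Longrightarrow> simple_graph H"
proof (induction rule: hajos_wheel_sequence.induct)
  case (wheel W)
  then show ?case by (rule odd_wheel_simple)
next
  case (join H W u1 v1 u2 v2)
  have W: "simple_graph W" using join.hyps(2) by (rule odd_wheel_simple)
  note u = simple_graph_edge[OF join.IH join.hyps(4)] and w = simple_graph_edge[OF W join.hyps(5)]
  define r where "r = (\<lambda>x. if x = u2 then u1 else x)"
  \<comment> \<open>By disjointness the identification is injective on the wheel, so its edges keep
    two ends.\<close>
  have "u1 \<notin> verts W" using u(1) join.hyps(3) by blast
  then have inj: "inj_on r (verts W)" unfolding r_def inj_on_def by auto
  have V: "verts (hajos_join H (u1, v1) W (u2, v2)) = verts H \<union> r ` verts W"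
    unfolding hajos_join_verts r_def ..
  have E: "edges (hajos_join H (u1, v1) W (u2, v2)) =
    (edges H - {{u1, v1}}) \<union> (\<lambda>e. r ` e) ` (edges W - {{u2, v2}}) \<union> {{v1, v2}}"
    unfolding hajos_join_edges r_def ..
  have "r v2 = v2" using w(3) unfolding r_def by simp
  then have v2: "v2 \<in> r ` verts W" using w(2) by force
  show ?case
    unfolding simple_graph_def V
  proof (intro conjI ballI)
    show "finite (verts H \<union> r ` verts W)" using join.IH W unfolding simple_graph_def by simp
    fix e assume "e \<in> edges (hajos_join H (u1, v1) W (u2, v2))"
    then consider "e \<in> edges H" | f where "f \<in> edges W" "e = r ` f" | "e = {v1, v2}" unfolding E by blast
    then have "e \<subseteq> verts H \<union> r ` verts W \<and> card e = 2"
    proof cases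
      case 1
      then show ?thesis using join.IH unfolding simple_graph_def by blast
    next
      case (2 f)
      then have f: "f \<subseteq> verts W" "card f = 2" using W unfolding simple_graph_def by blast+
      then have "card (r ` f) = 2" using card_image inj_on_subset[OF inj] by metis
      then show ?thesis using f 2(2) by blast
    next
      case 3
      have "v1 \<noteq> v2" using u(2) w(2) join.hyps(3) by blast
      then show ?thesis using 3 u(2) v2 by simp
    qed
    then show "e \<subseteq> verts H \<union> r ` verts W" "card e = 2" by blast+
  qed
qed

text \<open>Sequences of joins live on natural numbers and need a wheel disjoint from the current
  graph; \<open>B\<close> will be the vertex set of that graph.\<close>

lemma odd_wheel_copy:
  fixes B :: "nat set"
  assumes W: "odd_wheel W" and "finite B"
  obtains H g where "odd_wheel H" "verts H \<inter> B = {}" "bij_betw g (verts H) (verts W)"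
    "edges W = (`) g ` edges H"
proof -
  have sW: "simple_graph W" using W by (rule odd_wheel_simple)
  then have "finite (verts W)" unfolding simple_graph_def by blast
  then obtain f0 :: "'a \<Rightarrow> nat" where f0: "inj_on f0 (verts W)"
    using finite_imp_inj_to_nat_seg by metis
  \<comment> \<open>The shift moves the copy beyond every element of \<open>B\<close>; the inserted
    0 covers an empty \<open>B\<close>.\<close>
  define f where "f x = f0 x + Suc (Max (insert 0 B))" for x
  have inj: "inj_on f (verts W)" using f0 unfolding f_def inj_on_def by simp
  define H where "H = SGraph (f ` verts W) ((`) f ` edges W)"
  define g where "g = inv_into (verts W) f"
  have "odd_wheel H" unfolding H_def by (rule odd_wheel_image[OF W inj])
  moreover have "verts H \<inter> B = {}"
  proof -
    have "f x \<notin> B" for x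
    proof
      assume "f x \<in> B"
      then have "f x \<le> Max (insert 0 B)" using assms(2) by simp
      then show False unfolding f_def by simp
    qed
    then show ?thesis unfolding H_def by auto
  qed
  moreover have "bij_betw g (verts H) (verts W)"
    unfolding g_def H_def using inj by (simp add: bij_betw_inv_into inj_on_imp_bij_betw)
  moreover have "edges W = (`) g ` edges H"
  proof -
    have "g ` f ` e = e" if "e \<in> edges W" for e
      using that sW inj unfolding g_def simple_graph_def by (simp add: inv_into_image_cancel)
    then show ?thesis unfolding H_def by (auto simp: image_image)
  qed
  ultimately show ?thesis by (rule that)
qed

text \<open>The edge is lifted together with its orientation, because a Hajos join depends on which
  end is identified.\<close>

lemma iso_edge:
  assumes H: "simple_graph H" and inj: "inj_on f (verts H)" and e: "{a, b} \<in> (`) f ` edges H"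
  obtains p q where "{p, q} \<in> edges H" "f p = a" "f q = b"
proof -
  obtain e where e: "e \<in> edges H" "{a, b} = f ` e" using e by auto
  have "a \<in> f ` e" "b \<in> f ` e" using e(2)[symmetric] by simp_all
  then obtain p q where pq: "p \<in> e" "q \<in> e" "f p = a" "f q = b" by auto
  have sub: "e \<subseteq> verts H" using H e(1) unfolding simple_graph_def by blast
  have "z = p \<or> z = q" if "z \<in> e" for z
  proof -
    have "f z \<in> {a, b}" using that e(2) by simp
    then have "f z = f p \<or> f z = f q" using pq(3,4) by simp
    then show ?thesis using inj sub that pq(1,2) unfolding inj_on_def by blast
  qed
  then have "e = {p, q}" using pq(1,2) by blast
  then show ?thesis using that e(1) pq(3,4) by simp
qed

lemma image_edges_Diff:
  assumes H: "simple_graph H" and inj: "inj_on f (verts H)" and e: "{p, q} \<in> edges H"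
  shows "(`) f ` (edges H - {{p, q}}) = (`) f ` edges H - {{f p, f q}}"
proof -
  have "\<Union>(edges H) \<subseteq> verts H" using H unfolding simple_graph_def by blast
  then have "inj_on ((`) f) (edges H)" using inj_on_subset[OF inj] inj_on_image by blast
  then have "(`) f ` (edges H - {{p, q}}) = (`) f ` edges H - (`) f ` {{p, q}}"
    using e by (intro inj_on_image_set_diff) auto
  then show ?thesis by simp
qed

text \<open>The half on \<open>P\<close> has to be the wheel, since each step of a sequence adds a
  wheel; the half on \<open>Q\<close> provides the sequence built so far. Undoing the split is the
  join at the lifts of \<open>(u, v2)\<close> and \<open>(u, v1)\<close>.\<close>

lemma obtainable_hajos_join:
  fixes E :: "'a set set"
  assumes crit: "critical E" and sep: "separation E u P Q"
    and b: "between E P Q = {{v1, v2}}" "v1 \<in> P" "v2 \<in> Q"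
    and wheel: "odd_wheel (SGraph (insert u P) (insert {u, v1} (induced E (insert u P))))"
    and obt: "obtainable_from_odd_wheels (SGraph (insert u Q) (insert {u, v2} (induced E (insert u Q))))"
  shows "obtainable_from_odd_wheels (SGraph (\<Union>E) E)"
proof -
  have dE: "doubletons E" using crit by (rule critical_doubletons)
  have PQ: "P \<inter> Q = {}" "P \<union> Q = \<Union>E - {u}" "u \<in> \<Union>E" using sep unfolding separation_def by blast+
  have b': "between E Q P = {{v2, v1}}" using b(1) by (simp add: between_commute[of E Q] insert_commute)
  define E1 where "E1 = insert {u, v1} (induced E (insert u P))"
  define E2 where "E2 = insert {u, v2} (induced E (insert u Q))"
  have n1: "{u, v1} \<notin> E" and n2: "{u, v2} \<notin> E"
    using separation_no_edge(1)[OF crit sep b]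
      separation_no_edge(1)[OF crit separation_commute[OF sep] b' b(3,2)] by blast+
  have E1: "E1 - {{u, v1}} = induced E (insert u P)" and E2: "E2 - {{u, v2}} = induced E (insert u Q)"
    using n1 n2 unfolding E1_def E2_def induced_def by auto
  obtain H f where H: "hajos_wheel_sequence H" "bij_betw f (verts H) (insert u Q)" "E2 = (`) f ` edges H"
    using obt unfolding obtainable_from_odd_wheels_def graph_iso_def E2_def by auto
  have sH: "simple_graph H" using H(1) by (rule hajos_wheel_sequence_simple)
  then have "finite (verts H)" unfolding simple_graph_def by blast
  then obtain W g where W: "odd_wheel W" "verts W \<inter> verts H = {}" "bij_betw g (verts W) (insert u P)"
    "E1 = (`) g ` edges W"
    by (rule odd_wheel_copy[OF wheel[folded E1_def], unfolded sgraph.sel])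
  have sW: "simple_graph W" using W(1) by (rule odd_wheel_simple)
  have injf: "inj_on f (verts H)" and injg: "inj_on g (verts W)" using H(2) W(3) unfolding bij_betw_def by blast+
  have "{u, v2} \<in> (`) f ` edges H" unfolding H(3)[symmetric] E2_def by simp
  then obtain p q where pq: "{p, q} \<in> edges H" "f p = u" "f q = v2" by (rule iso_edge[OF sH injf])
  have "{u, v1} \<in> (`) g ` edges W" unfolding W(4)[symmetric] E1_def by simp
  then obtain s t where st: "{s, t} \<in> edges W" "g s = u" "g t = v1" by (rule iso_edge[OF sW injg])
  note pH = simple_graph_edge[OF sH pq(1)] and sW' = simple_graph_edge[OF sW st(1)]
  define J where "J = hajos_join H (p, q) W (s, t)"
  have J: "hajos_wheel_sequence J"
    unfolding J_def by (rule hajos_wheel_sequence.join[OF H(1) W(1) _ pq(1) st(1)]) (use W(2) in blast)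
  define r where "r = (\<lambda>x. if x = s then p else x)"
  \<comment> \<open>The identified vertex keeps its name \<open>p\<close> from \<open>H\<close>, so
    \<open>f\<close> takes precedence; it agrees there with \<open>g s\<close>, as both are
    \<open>u\<close>.\<close>
  define F where "F x = (if x \<in> verts H then f x else g x)" for x
  have rW: "r ` verts W \<union> verts H = verts H \<union> (verts W - {s})"
    using pH(1) unfolding r_def by auto
  have vJ: "verts J = verts H \<union> (verts W - {s})"
    unfolding J_def hajos_join_verts r_def[symmetric] using rW by blast
  have "bij_betw F (verts H \<union> (verts W - {s})) (insert u Q \<union> P)"
  proof (rule bij_betw_combine)
    show "bij_betw F (verts H) (insert u Q)"
      using H(2) by (rule bij_betw_cong[THEN iffD1, rotated]) (simp add: F_def)
    have "bij_betw g (verts W - {s}) (insert u P - {g s})"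
      using W(3) sW'(1) by (intro bij_betw_DiffI) (auto simp: bij_betw_def)
    moreover have "insert u P - {g s} = P" using st(2) PQ(2) by auto
    ultimately show "bij_betw F (verts W - {s}) P"
      by (intro bij_betw_cong[THEN iffD1, of _ g F]) (use W(2) in \<open>auto simp: F_def\<close>)
    show "insert u Q \<inter> P = {}" using PQ by blast
  qed
  moreover have "insert u Q \<union> P = \<Union>E" using PQ(2,3) by auto
  ultimately have bij: "bij_betw F (verts J) (\<Union>E)" unfolding vJ by simp
  have "(`) F ` edges J = E"
  proof -
    have 1: "(`) F ` (edges H - {{p, q}}) = induced E (insert u Q)"
    proof -
      have Ff: "F ` e = f ` e" if "e \<in> edges H" for e
      proof (rule image_cong[OF refl])
        fix x assume "x \<in> e"
        then show "F x = f x" using that sH unfolding simple_graph_def F_def by auto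
      qed
      then have "(`) F ` (edges H - {{p, q}}) = (`) f ` (edges H - {{p, q}})"
        by (rule image_cong[OF refl]) (use Ff in simp)
      then show ?thesis unfolding image_edges_Diff[OF sH injf pq(1)] H(3)[symmetric] pq(2,3) E2 .
    qed
    have 2: "(`) F ` (`) r ` (edges W - {{s, t}}) = induced E (insert u P)"
    proof -
      have Fg: "F ` r ` e = g ` e" if "e \<in> edges W" for e
      proof -
        have "F (r x) = g x" if "x \<in> e" for x
        proof -
          have "x \<in> verts W" using that \<open>e \<in> edges W\<close> sW unfolding simple_graph_def by blast
          then have "x \<notin> verts H" using W(2) by blast
          then show ?thesis using pH(1) pq(2) st(2) unfolding F_def r_def by simp
        qed
        then show ?thesis unfolding image_image by (intro image_cong) auto
      qed
      then have "(`) F ` (`) r ` (edges W - {{s, t}}) = (`) g ` (edges W - {{s, t}})"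
        unfolding image_image[of "(`) F"] by (rule image_cong[OF refl]) (use Fg in simp)
      then show ?thesis unfolding image_edges_Diff[OF sW injg st(1)] W(4)[symmetric] st(2,3) E1 .
    qed
    have "t \<notin> verts H" using sW'(2) W(2) by blast
    then have 3: "F ` {q, t} = {v1, v2}" using pH(2) pq(3) st(3) unfolding F_def by auto
    have "(`) F ` edges J = induced E (insert u Q) \<union> induced E (insert u P) \<union> {{v1, v2}}"
      unfolding J_def hajos_join_edges r_def[symmetric] image_Un 1 2 using 3 by simp
    also have "\<dots> = E" using separation_union[OF sep dE b(1)] by (simp add: Un_commute)
    finally show ?thesis .
  qed
  then have "graph_iso J (SGraph (\<Union>E) E)"
    unfolding graph_iso_def using bij by (intro exI[of _ F]) simp
  then show ?thesis unfolding obtainable_from_odd_wheels_def using J by blast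
qed

lemma obtainable_odd_wheel:
  fixes W :: "'a sgraph"
  assumes "odd_wheel W"
  shows "obtainable_from_odd_wheels W"
proof -
  obtain H g where "odd_wheel H" "verts H \<inter> {} = {}" "bij_betw g (verts H) (verts W)"
    "edges W = (`) g ` edges (H :: nat sgraph)"
    by (rule odd_wheel_copy[OF assms finite.emptyI])
  then show ?thesis
    unfolding obtainable_from_odd_wheels_def graph_iso_def using hajos_wheel_sequence.wheel by blast
qed

lemma critical_not_empty: "critical E \<Longrightarrow> E \<noteq> {}"
proof
  assume "critical E" "E = {}"
  moreover have "proper {} (\<lambda>_. 0)" unfolding proper_def by simp
  ultimately show False unfolding critical_def colourable3_def by blast
qed

text \<open>Splitting off the smallest possible side of a separation leaves a graph without
  separations, that is, an odd wheel.\<close>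

lemma critical_obtainable:
  assumes "critical E" "separable3 E"
  shows "obtainable_from_odd_wheels (SGraph (\<Union>E) E)"
  using assms
proof (induction "card (\<Union>E)" arbitrary: E rule: less_induct)
  case less
  note crit = less.prems(1) and s3 = less.prems(2)
  have dE: "doubletons E" using crit by (rule critical_doubletons)
  show ?case
  proof (cases "\<exists>u P Q. separation E u P Q")
    case False
    then interpret no_separation E using crit s3 by unfold_locales auto
    show ?thesis by (rule obtainable_odd_wheel[OF odd_wheel[OF critical_not_empty[OF crit]]])
  next
    case True
    define sz where "sz n \<longleftrightarrow> (\<exists>u P Q. separation E u P Q \<and> card P = n)" for n
    have "\<exists>n. sz n" using True unfolding sz_def by blast
    then have "sz (Least sz)" by (rule LeastI_ex)
    then obtain u P Q where sep: "separation E u P Q" "card P = Least sz" unfolding sz_def by blast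
    have min: "card P \<le> card P'" if "separation E u' P' Q'" for u' P' Q'
    proof -
      have "sz (card P')" using that unfolding sz_def by blast
      then show ?thesis unfolding sep(2) by (rule Least_le)
    qed
    have PQ: "P \<inter> Q = {}" "P \<union> Q = \<Union>E - {u}" "u \<in> \<Union>E" "P \<noteq> {}"
      using sep(1) unfolding separation_def by blast+
    have finV: "finite (\<Union>E)" by (rule doubletons_finite_Union[OF dE])
    have PV: "P \<subseteq> \<Union>E" using PQ(2) by auto
    then have finP: "finite P" using finV finite_subset by blast
    obtain v1 v2 where b: "between E P Q = {{v1, v2}}" "v1 \<in> P" "v2 \<in> Q"
      by (rule separation_edge[OF crit sep(1)])
    have b': "between E Q P = {{v2, v1}}" using b(1) by (simp add: between_commute[of E Q] insert_commute)
    note sep' = separation_commute[OF sep(1)]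
    define E1 where "E1 = insert {u, v1} (induced E (insert u P))"
    define E2 where "E2 = insert {u, v2} (induced E (insert u Q))"
    have U: "\<Union>E1 = insert u P" "\<Union>E2 = insert u Q"
      unfolding E1_def E2_def
      by (rule separation_Union[OF sep(1) b dE], rule separation_Union[OF sep' b' b(3,2) dE])
    have c1: "critical E1" "separable3 E1"
      unfolding E1_def
      by (rule separation_critical[OF crit sep(1) b], rule separation_separable3[OF crit sep(1) b s3])
    have c2: "critical E2" "separable3 E2"
      unfolding E2_def
      by (rule separation_critical[OF crit sep' b' b(3,2)], rule separation_separable3[OF crit sep' b' b(3,2) s3])
    \<comment> \<open>A separation of this half would give one of \<open>E\<close> with a side
      strictly inside \<open>P\<close>, against minimality.\<close>
    have "\<not> separation E1 u' P' Q'" for u' P' Q'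
    proof
      assume "separation E1 u' P' Q'"
      then obtain u'' P'' Q'' where "separation E u'' P'' Q''" "P'' \<subset> P"
        unfolding E1_def by (rule separation_refine[OF crit sep(1) b])
      then show False using min[of u'' P'' Q''] psubset_card_mono[OF finP, of P''] by simp
    qed
    then interpret W: no_separation E1 using c1 by unfold_locales auto
    have "odd_wheel (SGraph (\<Union>E1) E1)" by (rule W.odd_wheel[OF critical_not_empty[OF c1(1)]])
    \<comment> \<open>The other half misses \<open>v1\<close>, so it has fewer vertices and the
      induction hypothesis supplies the graph to which the wheel is joined.\<close>
    moreover have "obtainable_from_odd_wheels (SGraph (\<Union>E2) E2)"
    proof (rule less.hyps[OF _ c2])
      have "v1 \<in> \<Union>E" "v1 \<notin> insert u Q" using b(2) PQ by blast+
      moreover have "insert u Q \<subseteq> \<Union>E" using PQ(2,3) by auto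
      ultimately have "insert u Q \<subset> \<Union>E" by blast
      then show "card (\<Union>E2) < card (\<Union>E)" unfolding U using psubset_card_mono[OF finV] by blast
    qed
    ultimately show ?thesis
      using obtainable_hajos_join[OF crit sep(1) b] unfolding U unfolding E1_def E2_def by blast
  qed
qed

section \<open>Obtainable graphs are not 3-colourable\<close>

text \<open>The rim avoids the colour of the hub and so alternates between two colours. As its
  length is odd, the adjacent first and last rim vertices agree.\<close>

lemma odd_wheel_not_colourable:
  assumes "odd_wheel W"
  shows "\<not> colourable3 (edges W)"
proof
  assume "colourable3 (edges W)"
  then obtain c where c: "proper (edges W) c" unfolding colourable3_def by blast
  obtain xs h where xs: "length xs \<ge> 3" "odd (length xs)" "distinct xs" "h \<notin> set xs"
    "verts W = insert h (set xs)"
    "edges W = insert {last xs, hd xs} (path_edges xs) \<union> {{h, x} | x. x \<in> set xs}"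
    using assms by (rule odd_wheelE)
  define n where "n = length xs"
  have less: "c x < 3" for x using c unfolding proper_def by blast
  have col: "c x \<noteq> c y" if "{x, y} \<in> edges W" for x y using c that unfolding proper_def by blast
  have hub: "c (xs ! i) \<noteq> c h" if "i < n" for i
  proof -
    have "{h, xs ! i} \<in> edges W" using that nth_mem unfolding n_def xs(6) by blast
    then show ?thesis using col by fastforce
  qed
  have step: "c (xs ! i) \<noteq> c (xs ! Suc i)" if "Suc i < n" for i
  proof (rule col)
    have "{xs ! i, xs ! Suc i} \<in> path_edges xs" using that unfolding path_edges_nth n_def by blast
    then show "{xs ! i, xs ! Suc i} \<in> edges W" unfolding xs(6) by blast
  qed
  have two: "b = c0" if "a < 3" "b < 3" "c0 < 3" "d < 3" "a \<noteq> c0" "b \<noteq> a" "a \<noteq> d" "b \<noteq> d" "c0 \<noteq> d" for a b c0 d :: nat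
    using that by linarith
  have alt: "i < n \<Longrightarrow> c (xs ! i) = c (xs ! 0) \<longleftrightarrow> even i" for i
  proof (induction i)
    case (Suc i)
    then have IH: "c (xs ! i) = c (xs ! 0) \<longleftrightarrow> even i" by simp
    have i: "i < n" "0 < n" using Suc.prems by auto
    show ?case
    proof (cases "even i")
      case True
      then show ?thesis using IH step[OF Suc.prems] by simp
    next
      case False
      then have "c (xs ! Suc i) = c (xs ! 0)"
        using two[OF less less less less _ step[OF Suc.prems, symmetric] hub[OF i(1)] hub[OF Suc.prems] hub[OF i(2)]] IH
        by blast
      then show ?thesis using False by simp
    qed
  qed simp
  have "xs \<noteq> []" using xs(1) by auto
  then have "last xs = xs ! (n - 1)" "hd xs = xs ! 0"
    unfolding n_def by (simp_all add: last_conv_nth hd_conv_nth)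
  moreover have "c (last xs) \<noteq> c (hd xs)" by (rule col) (simp add: xs(6))
  moreover have "even (n - 1)" "n - 1 < n" using xs(1,2) unfolding n_def by simp_all
  ultimately show False using alt[of "n - 1"] by simp
qed

lemma hajos_wheel_sequence_not_colourable:
  "hajos_wheel_sequence H \<Longrightarrow> \<not> colourable3 (edges H)"
proof (induction rule: hajos_wheel_sequence.induct)
  case (wheel W)
  then show ?case by (rule odd_wheel_not_colourable)
next
  case (join H W u1 v1 u2 v2)
  show ?case
  proof
    assume "colourable3 (edges (hajos_join H (u1, v1) W (u2, v2)))"
    then obtain c where c: "proper (edges (hajos_join H (u1, v1) W (u2, v2))) c" unfolding colourable3_def by blast
    define r where "r = (\<lambda>x. if x = u2 then u1 else x)"
    have E: "edges (hajos_join H (u1, v1) W (u2, v2)) =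
      (edges H - {{u1, v1}}) \<union> (\<lambda>e. r ` e) ` (edges W - {{u2, v2}}) \<union> {{v1, v2}}"
      unfolding hajos_join_edges r_def ..
    \<comment> \<open>A colouring that respects all edges except possibly one must fail at that
      edge. For the wheel this is applied to \<open>c\<close> pulled back along
      \<open>r\<close>.\<close>
    have force: "d u = d v" if "\<not> colourable3 F" "\<And>x. d x < 3" "\<And>x y. {x, y} \<in> F - {{u, v}} \<Longrightarrow> d x \<noteq> d y"
      for F :: "nat set set" and u v and d :: "nat \<Rightarrow> nat"
    proof (rule ccontr)
      assume n: "d u \<noteq> d v"
      have "d x \<noteq> d y" if e: "{x, y} \<in> F" for x y
      proof (cases "{x, y} = {u, v}")
        case True
        then show ?thesis using n by (metis doubleton_eq_iff)
      next
        case False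
        then show ?thesis using e \<open>\<And>x y. {x, y} \<in> F - {{u, v}} \<Longrightarrow> d x \<noteq> d y\<close> by blast
      qed
      then have "proper F d" unfolding proper_def using that(2) by blast
      then show False using that(1) unfolding colourable3_def by blast
    qed
    have less: "c x < 3" for x using c unfolding proper_def by blast
    have col: "c x \<noteq> c y" if "{x, y} \<in> edges (hajos_join H (u1, v1) W (u2, v2))" for x y
      using c that unfolding proper_def by blast
    have "c u1 = c v1"
      by (rule force[OF join.IH less], rule col) (simp add: E)
    moreover have "c (r u2) = c (r v2)"
    proof (rule force[OF odd_wheel_not_colourable[OF join.hyps(2)], of "\<lambda>x. c (r x)"])
      fix x y assume "{x, y} \<in> edges W - {{u2, v2}}"
      then have "r ` {x, y} \<in> edges (hajos_join H (u1, v1) W (u2, v2))" unfolding E by blast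
      then show "c (r x) \<noteq> c (r y)" by (intro col) simp
    qed (rule less)
    moreover have "u2 \<noteq> v2"
      by (rule simple_graph_edge(3)[OF odd_wheel_simple[OF join.hyps(2)] join.hyps(5)])
    moreover have "c v1 \<noteq> c v2" by (rule col) (simp add: E)
    ultimately show False unfolding r_def by simp
  qed
qed

lemma obtainable_not_colourable:
  assumes "obtainable_from_odd_wheels B"
  shows "\<not> colourable3 (edges B)"
proof
  assume "colourable3 (edges B)"
  then obtain c where c: "proper (edges B) c" unfolding colourable3_def by blast
  obtain H f where H: "hajos_wheel_sequence H" "edges B = (`) f ` edges H"
    using assms unfolding obtainable_from_odd_wheels_def graph_iso_def by blast
  have "proper (edges H) (\<lambda>x. c (f x))"
    unfolding proper_def
  proof (intro conjI allI impI)
    show "c (f x) < 3" for x using c unfolding proper_def by blast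
    fix x y assume "{x, y} \<in> edges H"
    then have "f ` {x, y} \<in> edges B" unfolding H(2) by (rule imageI)
    then show "c (f x) \<noteq> c (f y)" using c unfolding proper_def by simp
  qed
  then show False using hajos_wheel_sequence_not_colourable[OF H(1)] unfolding colourable3_def by blast
qed

section \<open>Critical subgraphs are blocks\<close>

text \<open>\<open>S\<close> is what \<open>x\<close> reaches while avoiding \<open>W\<close>, so it
  can be left only into \<open>W\<close>. The empty \<open>W\<close> gives connectedness and a
  singleton treats cut-vertices.\<close>

lemma path_or_separator:
  assumes G: "simple_graph G" and x: "x \<in> verts G" "x \<notin> W"
  obtains p where "is_path G x p y" "set p \<inter> W = {}"
  | S where "x \<in> S" "y \<notin> S" "S \<subseteq> verts G - W"
      "\<And>a b. {a, b} \<in> edges G \<Longrightarrow> a \<in> S \<Longrightarrow> b \<notin> S \<Longrightarrow> b \<in> W"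
proof -
  define R where "R = {(a, b). {a, b} \<in> edges G \<and> b \<notin> W}"
  have RV: "R `` (verts G - W) \<subseteq> verts G - W"
    using simple_graph_edge(2)[OF G] unfolding R_def by blast
  show ?thesis
  proof (cases "(x, y) \<in> R\<^sup>*")
    case True
    then obtain p where p: "p \<noteq> []" "hd p = x" "last p = y" "distinct p" "successively (\<lambda>a b. (a, b) \<in> R) p"
      by (rule rtrancl_distinct_walk)
    have pV: "set p \<subseteq> verts G - W" using successively_set_subset[OF p(5,1) _ RV] p(2) x by simp
    have "path_edges p \<subseteq> edges G"
      unfolding path_edges_subset_iff by (rule successively_mono[OF p(5)]) (simp add: R_def)
    then have "is_path G x p y" unfolding is_path_def using p pV by blast
    then show ?thesis using that(1) pV by blast
  next
    case False
    define S where "S = R\<^sup>* `` {x}"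
    have "s \<in> verts G - W" if "s \<in> S" for s
    proof -
      have "(x, s) \<in> R\<^sup>*" using that unfolding S_def by blast
      then show ?thesis using x RV by (induction rule: rtrancl_induct) auto
    qed
    moreover have "b \<in> W" if "{a, b} \<in> edges G" "a \<in> S" "b \<notin> S" for a b
    proof (rule ccontr)
      assume "b \<notin> W"
      then have "(a, b) \<in> R" using that(1) unfolding R_def by simp
      then show False using that(2,3) unfolding S_def by (metis Image_singleton_iff rtrancl.rtrancl_into_rtrancl)
    qed
    moreover have "x \<in> S" "y \<notin> S" using False unfolding S_def by auto
    ultimately show ?thesis using that(2)[of S] by blast
  qed
qed

lemma critical_simple_graph:
  assumes "critical E"
  shows "simple_graph (SGraph (\<Union>E) E)"
  using critical_doubletons[OF assms] doubletons_finite_Union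
  unfolding simple_graph_def doubletons_def by auto

text \<open>A disconnection would be an empty cut, and a cut-vertex a separation without a crossing
  edge.\<close>

lemma critical_nonseparable:
  assumes crit: "critical E"
  shows "nonseparable (SGraph (\<Union>E) E)"
proof -
  let ?G = "SGraph (\<Union>E) E"
  have G: "simple_graph ?G" by (rule critical_simple_graph[OF crit])
  have "\<Union>E \<noteq> {}"
  proof -
    obtain e where "e \<in> E" using critical_not_empty[OF crit] by blast
    then show ?thesis using doubletonsE[OF critical_doubletons[OF crit]] by (metis Union_upper insert_not_empty subset_empty)
  qed
  moreover have "\<exists>p. is_path ?G x p y" if xy: "x \<in> \<Union>E" "y \<in> \<Union>E" for x y
  proof -
    have "x \<in> verts ?G" "x \<notin> {}" using xy by simp_all
    then show ?thesis
    proof (rule path_or_separator[OF G, of x "{}" y])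
      fix S assume S: "x \<in> S" "y \<notin> S" "\<And>a b. {a, b} \<in> edges ?G \<Longrightarrow> a \<in> S \<Longrightarrow> b \<notin> S \<Longrightarrow> b \<in> {}"
      then have "cut E S = {}" unfolding between_def by fastforce
      then show ?thesis using critical_cut_ge_3[OF crit xy(1) S(1) xy(2) S(2)] by simp
    qed blast
  qed
  moreover have "\<not> cut_vertex ?G v" for v
  proof
    assume "cut_vertex ?G v"
    then obtain x y where v: "v \<in> \<Union>E" and xy: "x \<in> \<Union>E" "x \<noteq> v" "y \<in> \<Union>E" "y \<noteq> v"
      and all: "\<And>p. is_path ?G x p y \<Longrightarrow> v \<in> set p"
      unfolding cut_vertex_def by auto
    have "x \<in> verts ?G" "x \<notin> {v}" using xy by simp_all
    then show False
    proof (rule path_or_separator[OF G, of x "{v}" y])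
      fix p assume "is_path ?G x p y" "set p \<inter> {v} = {}"
      then show False using all by blast
    next
      fix S assume S: "x \<in> S" "y \<notin> S" "S \<subseteq> verts ?G - {v}"
        "\<And>a b. {a, b} \<in> edges ?G \<Longrightarrow> a \<in> S \<Longrightarrow> b \<notin> S \<Longrightarrow> b \<in> {v}"
      have "between E S (\<Union>E - {v} - S) = {}"
      proof (rule ccontr)
        assume "between E S (\<Union>E - {v} - S) \<noteq> {}"
        then obtain a b where "{a, b} \<in> E" "a \<in> S" "b \<noteq> v" "b \<notin> S" unfolding between_def by auto
        then show False using S(4)[of a b] by simp
      qed
      moreover from this have "separation E v S (\<Union>E - {v} - S)"
        unfolding separation_def using v xy S(1-3) by auto
      ultimately show False using separation_edge[OF crit] by (metis insert_not_empty)
    qed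
  qed
  ultimately show ?thesis unfolding nonseparable_def connected_graph_def by simp
qed

text \<open>Two vertices of a critical subgraph \<open>K\<close> are separated by a cut of at most three edges, all of
  which belong to \<open>K\<close>; an ear attached to \<open>K\<close> would provide a fourth edge.\<close>

lemma critical_block:
  assumes G: "simple_graph G" and s3: "separable3 (edges G)"
    and KG: "K \<subseteq> edges G" and crit: "critical K"
  shows "block (SGraph (\<Union>K) K) G"
proof -
  let ?H = "SGraph (\<Union>K) K"
  have H: "simple_graph ?H" by (rule critical_simple_graph[OF crit])
  have "\<Union>K \<subseteq> verts G" using KG G unfolding simple_graph_def by blast
  then have HG: "subgraph ?H G" unfolding subgraph_def using H KG by simp
  moreover have "B = ?H" if B: "subgraph B G" "nonseparable B" "subgraph ?H B" for B
  proof -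
    have sB: "simple_graph B" and BG: "edges B \<subseteq> edges G" using B(1) unfolding subgraph_def by blast+
    have KB: "K \<subseteq> edges B" "\<Union>K \<subseteq> verts B" using B(3) unfolding subgraph_def by simp_all
    have dG: "doubletons (edges G)" by (rule simple_graph_doubletons[OF G])
    \<comment> \<open>The separating cut has at most three edges in \<open>G\<close> and at least
      three in \<open>K\<close>, so all of them lie in \<open>K\<close>; every other edge of
      \<open>B\<close> stays on one side of \<open>C\<close>.\<close>
    have key: "\<exists>C. p \<in> C \<and> q \<notin> C \<and> (\<forall>a b. {a, b} \<in> edges B \<longrightarrow> {a, b} \<notin> K \<longrightarrow> a \<in> C \<longleftrightarrow> b \<in> C)"
      if pq: "p \<in> \<Union>K" "q \<in> \<Union>K" "p \<noteq> q" for p q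
    proof -
      have "p \<in> \<Union>(edges G)" "q \<in> \<Union>(edges G)" using pq KG by auto
      then obtain C where C: "p \<in> C" "q \<notin> C" "card (cut (edges G) C) \<le> 3"
        using s3 pq(3) unfolding separable3_def by meson
      have "cut K C = cut (edges G) C"
      proof (rule card_seteq[OF finite_between[OF dG] between_mono[OF KG]])
        show "card (cut (edges G) C) \<le> card (cut K C)"
          using critical_cut_ge_3[OF crit pq(1) C(1) pq(2) C(2)] C(3) by simp
      qed
      then have sub: "f \<in> K" if "f \<in> cut (edges G) C" for f
        using that unfolding between_def by auto
      have "a \<in> C \<longleftrightarrow> b \<in> C" if "{a, b} \<in> edges B" "{a, b} \<notin> K" for a b
      proof -
        have "{a, b} \<in> edges G" "{b, a} \<in> edges G" using that(1) BG by (auto simp: insert_commute)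
        moreover have "{b, a} \<notin> K" using that(2) by (simp add: insert_commute)
        ultimately show ?thesis using sub in_cutI[of a b] in_cutI[of b a] that(2) by metis
      qed
      then show ?thesis using C(1,2) by blast
    qed
    have edge: "{a, b} \<in> K" if ab: "{a, b} \<in> edges B" "a \<in> \<Union>K" "b \<in> \<Union>K" for a b
      using key[OF ab(2,3) simple_graph_edge(3)[OF sB ab(1)]] ab(1) by blast
    have "verts B = \<Union>K"
    proof (rule ccontr)
      assume "verts B \<noteq> \<Union>K"
      then obtain z where z: "z \<in> verts B" "z \<notin> \<Union>K" using KB by blast
      \<comment> \<open>\<open>S\<close> is the component of \<open>z\<close> in \<open>B\<close>
        after the vertices of \<open>K\<close> are deleted.\<close>
      define R where "R = {(a, b). {a, b} \<in> edges B \<and> b \<notin> \<Union>K}"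
      define S where "S = R\<^sup>* `` {z}"
      have SK: "s \<notin> \<Union>K" if "s \<in> S" for s
      proof -
        have "(z, s) \<in> R\<^sup>*" using that unfolding S_def by blast
        then show ?thesis using z(2) by (induction rule: rtrancl_induct) (auto simp: R_def)
      qed
      have zS: "z \<in> S" unfolding S_def by blast
      have exit: "b \<in> \<Union>K" if "{a, b} \<in> edges B" "a \<in> S" "b \<notin> S" for a b
      proof (rule ccontr)
        assume "b \<notin> \<Union>K"
        then have "(a, b) \<in> R" using that(1) unfolding R_def by blast
        then show False using that(2,3) unfolding S_def by (metis Image_singleton_iff rtrancl.rtrancl_into_rtrancl)
      qed
      have cross: "\<exists>a n. {a, n} \<in> edges B \<and> a \<in> S \<and> n \<in> \<Union>K \<and> n \<in> set p"
        if p: "is_path B z p h" "h \<in> \<Union>K" for p h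
      proof -
        have "p \<noteq> []" "hd p \<in> S" "last p \<notin> S" using p zS SK unfolding is_path_def by auto
        then obtain a b where ab: "{a, b} \<in> path_edges p" "a \<in> S" "b \<notin> S" "a \<in> set p" "b \<in> set p"
          by (rule path_edges_crossing)
        then have "{a, b} \<in> edges B" using p(1) unfolding is_path_def by blast
        then show ?thesis using exit ab by blast
      qed
      have conn: "\<exists>p. is_path B x p y" if "x \<in> verts B" "y \<in> verts B" for x y
        using B(2) that unfolding nonseparable_def connected_graph_def by blast
      obtain e where e: "e \<in> K" using critical_not_empty[OF crit] by blast
      then obtain k l where kl: "e = {k, l}" "k \<noteq> l" by (rule doubletonsE[OF critical_doubletons[OF crit]])
      have klK: "k \<in> \<Union>K" "l \<in> \<Union>K" using e kl by auto
      obtain p where "is_path B z p k" using conn[OF z(1), of k] klK(1) KB(2) by blast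
      from cross[OF this klK(1)] obtain a n where n: "{a, n} \<in> edges B" "a \<in> S" "n \<in> \<Union>K" by blast
      \<comment> \<open>A cut separating two different attachment vertices has only edges of
        \<open>K\<close>. So \<open>S\<close> lies on one side of it, together with both attachment
        vertices.\<close>
      have through: "b = n" if b: "{a', b} \<in> edges B" "a' \<in> S" "b \<in> \<Union>K" for a' b
      proof (rule ccontr)
        assume "b \<noteq> n"
        then obtain C where C: "n \<in> C" "b \<notin> C"
          and CK: "\<And>a b. {a, b} \<in> edges B \<Longrightarrow> {a, b} \<notin> K \<Longrightarrow> a \<in> C \<longleftrightarrow> b \<in> C"
          using key[OF n(3) b(3)] by metis
        have nK: "{s, t} \<notin> K" if "s \<in> S" for s t using SK[OF that] by blast
        have zC: "s \<in> C \<longleftrightarrow> z \<in> C" if "s \<in> S" for s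
        proof -
          have "(z, s) \<in> R\<^sup>*" using that unfolding S_def by blast
          then show ?thesis
          proof (induction rule: rtrancl_induct)
            case (step s t)
            then have "s \<in> S" "{s, t} \<in> edges B" unfolding S_def R_def by auto
            then show ?case using CK nK step.IH by blast
          qed simp
        qed
        have "a \<in> C \<longleftrightarrow> n \<in> C" using CK[OF n(1) nK[OF n(2)]] .
        moreover have "a' \<in> C \<longleftrightarrow> b \<in> C" using CK[OF b(1) nK[OF b(2)]] .
        ultimately show False using C zC[OF n(2)] zC[OF b(2)] by blast
      qed
      \<comment> \<open>Every path from \<open>z\<close> to another vertex \<open>h\<close> of
        \<open>K\<close> enters \<open>K\<close> at \<open>n\<close>, which makes \<open>n\<close> a
        cut-vertex of \<open>B\<close>.\<close>
      obtain h where h: "h \<in> \<Union>K" "h \<noteq> n" using klK kl(2) by metis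
      have "n \<in> verts B" "z \<in> verts B - {n}" "h \<in> verts B - {n}" using n(3) z h KB(2) by auto
      moreover have "\<exists>p. is_path B z p h" using conn z(1) h(1) KB(2) by blast
      moreover have "n \<in> set p" if "is_path B z p h" for p
        using cross[OF that h(1)] through by blast
      ultimately have "cut_vertex B n" unfolding cut_vertex_def by blast
      then show False using B(2) unfolding nonseparable_def by blast
    qed
    moreover have "edges B = K"
    proof
      show "edges B \<subseteq> K"
      proof
        fix e assume e: "e \<in> edges B"
        then obtain a b where ab: "e = {a, b}" "a \<noteq> b" by (rule doubletonsE[OF simple_graph_doubletons[OF sB]])
        then have "a \<in> \<Union>K" "b \<in> \<Union>K" using simple_graph_edge[OF sB] e \<open>verts B = \<Union>K\<close> by metis+
        then show "e \<in> K" using edge e ab by simp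
      qed
    qed (rule KB(1))
    ultimately show ?thesis by (cases B) simp
  qed
  ultimately show ?thesis unfolding block_def using critical_nonseparable[OF crit] by blast
qed

lemma maximal_local_edge_connectivity_separable3:
  assumes G: "simple_graph G" and "maximal_local_edge_connectivity 3 G"
  shows "separable3 (edges G)"
  unfolding separable3_def
proof (intro ballI impI)
  fix x y assume xy: "x \<in> \<Union>(edges G)" "y \<in> \<Union>(edges G)" "x \<noteq> y"
  then have V: "x \<in> verts G" "y \<in> verts G" using G unfolding simple_graph_def by blast+
  then have "local_edge_connectivity G x y \<le> 3"
    using assms(2) xy(3) unfolding maximal_local_edge_connectivity_def by blast
  then obtain S where "x \<in> S" "y \<notin> S" "card (cut (edges G) S) \<le> 3"
    by (rule edge_menger[OF G V xy(3)])
  then show "\<exists>S. x \<in> S \<and> y \<notin> S \<and> card (cut (edges G) S) \<le> 3" by blast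
qed

theorem theorem1p3:
  fixes G :: "'a sgraph"
  assumes "simple_graph G"
    and "maximal_local_edge_connectivity 3 G"
  shows "colourable 3 G \<longleftrightarrow> (\<forall>B. block B G \<longrightarrow> \<not> obtainable_from_odd_wheels B)"
proof
  assume "colourable 3 G"
  then have col: "colourable3 (edges G)" using colourable_iff[OF assms(1)] by blast
  show "\<forall>B. block B G \<longrightarrow> \<not> obtainable_from_odd_wheels B"
  proof (intro allI impI notI)
    fix B assume "block B G" "obtainable_from_odd_wheels B"
    then have "edges B \<subseteq> edges G" "\<not> colourable3 (edges B)"
      using obtainable_not_colourable unfolding block_def subgraph_def by blast+
    then show False using colourable3_subset[OF col] by blast
  qed
next
  assume B: "\<forall>B. block B G \<longrightarrow> \<not> obtainable_from_odd_wheels B"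
  have s3: "separable3 (edges G)" by (rule maximal_local_edge_connectivity_separable3[OF assms])
  have dG: "doubletons (edges G)" by (rule simple_graph_doubletons[OF assms(1)])
  show "colourable 3 G"
  proof (rule ccontr)
    assume "\<not> colourable 3 G"
    then have "\<not> colourable3 (edges G)" using colourable_iff[OF assms(1)] by blast
    then obtain K where K: "K \<subseteq> edges G" "critical K" by (rule critical_subset_exists[OF dG])
    have "obtainable_from_odd_wheels (SGraph (\<Union>K) K)"
      by (rule critical_obtainable[OF K(2) separable3_subset[OF s3 K(1) dG]])
    then show False using B critical_block[OF assms(1) s3 K] by blast
  qed
qed

end
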